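(* Let $p\ge0$, let $(\mathring\Pi^l)_{l\in\{0,1,2,3\}}$ and $(\Pi_\partial^l)_{l\in\{0,1,2,3\}}$ be an admissible pair of families of operators (defined in the context), and let $\Pi^l:V^l\to V^l_p$ be defined by $\Pi^l:=\mathring\Pi^l(I-\Pi_\partial^l)+\Pi_\partial^l$, where $I$ is the identity. For $l\in\{0,1,2\}$ let $E^l:\mathrm{tr}^l(V^l)\to V^l$ be the harmonic extension operator, which satisfies $\mathrm{tr}^l(E^l(g))=g$ and $\|E^l(g)\|_{V^l}\lesssim\|g\|_{\mathrm{tr}^l(V^l)}$ for all $g\in\mathrm{tr}^l(V^l)$. Define the linear operators $L^l_p:\mathrm{tr}^l(V^l_p)\to V^l_p$ by $L^l_p:=\Pi^l\circ E^l$ for all $l\in\{0,1,2\}$. Then, for all $l\in\{0,1,2\}$ and all $g_h\in\mathrm{tr}^l(V^l_p)$, $$\mathrm{tr}^l(L^l_p(g_h))=g_h,\qquad \|L^l_p(g_h)\|_{V^l}\lesssim\|g_h\|_{\mathrm{tr}^l(V^l)}.$$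
   Context: $\Omega\subset\mathbb R^3$ is a Lipschitz, polyhedral, open, bounded, connected set, $\Gamma:=\partial\Omega$, $\mathbf n$ its unit outward normal. $d^0:=\mathrm{grad}$, $d^1:=\mathrm{curl}$, $d^2:=\mathrm{div}$, $d^3:=0$. $V^0:=H^1(\Omega)$, $V^1:=\mathbf H(\mathrm{curl},\Omega)$, $V^2:=\mathbf H(\mathrm{div},\Omega)$, $V^3:=L^2(\Omega)$, with canonical graph norms $\|v\|_{V^l}^2:=\|v\|_{L^2(\Omega)}^2+\|d^lv\|_{L^2(\Omega)}^2$. Traces (in the usual weak sense): $\mathrm{tr}^0(u):=u|_\Gamma$, $\mathrm{tr}^1(\mathbf u):=(\mathbf n\times\mathbf u|_\Gamma)\times\mathbf n$, $\mathrm{tr}^2(\mathbf u):=\mathbf u|_\Gamma\cdot\mathbf n$, and by convention $\mathrm{tr}^3(u):=\int_\Omega u$. $\mathring V^l:=\{u\in V^l:\mathrm{tr}^l(u)=0\}$. For $g\in\mathrm{tr}^l(V^l)$, $l\in\{0,1,2\}$: $\|g\|_{\mathrm{tr}^l(V^l)}:=\inf\{\|v\|_{V^l}:v\in V^l,\ \mathrm{tr}^l(v)=g\}$. Mesh: $\mathcal T_h$ is a simplicial triangulation of $\Omega$ (closed tetrahedra), $h_\tau:=\mathrm{diam}(\tau)$; $\rho_{\mathcal T_h}:=\max_\tau h_\tau/\theta_\tau$, $\theta_\tau$ the diameter of the largest ball inscribed in $\tau$. Discrete spaces: $V^0_p:=\{u\in V^0:u|_\tau\in\mathbb P_{p+1}(\tau)\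 \forall\tau\in\mathcal T_h\}$; $V^1_p:=\{\mathbf u\in V^1:\mathbf u|_\tau\in\mathbf N_p(\tau)\ \forall\tau\}$ with $\mathbf N_p(\tau):=\{\mathbf a(\mathbf x)+\mathbf x\times\mathbf b(\mathbf x):\mathbf a,\mathbf b\in\mathbb P_p(\tau;\mathbb R^3)\}$; $V^2_p:=\{\mathbf u\in V^2:\mathbf u|_\tau\in\mathbf{RT}_p(\tau)\ \forall\tau\}$ with $\mathbf{RT}_p(\tau):=\{\mathbf a(\mathbf x)+b(\mathbf x)\mathbf x:\mathbf a\in\mathbb P_p(\tau;\mathbb R^3),b\in\mathbb P_p(\tau)\}$; $V^3_p:=\{u\in L^2(\Omega):u|_\tau\in\mathbb P_p(\tau)\ \forall\tau\}$. $\mathring V^l_p:=V^l_p\cap\mathring V^l$. $V^l_{\mathrm{tr},p}:=\{u\in V^l:\mathrm{tr}^l(u)\in\mathrm{tr}^l(V^l_p)\}$. Patches: for $\tau\in\mathcal T_h$, $\mathrm{es}^1(\tau)$ is the interior of the union of all $\tau'\in\mathcal T_h$ with $\tau'\cap\tau\ne\emptyset$; for $k\ge2$, $\mathrm{es}^k(\tau)$ is the interior of the union of all $\tau'\in\mathcal T_h$ meeting the closure of $\mathrm{es}^{k-1}(\tau)$. For $l\in\{0,1,2\}$, $\mathcal T_h^{l,\partial}$ is the set of $\tau\in\mathcal T_h$ having at least one $l$-dimensional subsimplex contained in $\Gamma$; $\mathring{\mathcal T}_h^l:=\mathcal T_h\setminus\mathcal T_h^{l,\partial}$; $\Omega^{l,\partial}$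 is the interior of the union of the cells of $\mathcal T_h^{l,\partial}$; $\mathrm{es}^{k,l,\partial}(\tau):=\mathrm{es}^k(\tau)\cap\Omega^{l,\partial}$. Admissible pair: linear operators $\mathring\Pi^l:\mathring V^l\to\mathring V^l_p$ and $\Pi_\partial^l:V^l\to V^l_p$, $l\in\{0,1,2,3\}$, with (1) $\mathring\Pi^l(u)=u$ for $u\in\mathring V^l_p$; $d^l\mathring\Pi^l(u)=\mathring\Pi^{l+1}(d^lu)$ for $u\in\mathring V^l$, $l\le2$; $\|\mathring\Pi^l(u)\|_{L^2(\tau)}\lesssim\|u\|_{L^2(\mathrm{es}^2(\tau))}$ for $u\in\mathring V^l$, $\tau\in\mathcal T_h$; (2) $\mathrm{tr}^l(\Pi_\partial^l(u))=\mathrm{tr}^l(u)$ for $u\in V^l_{\mathrm{tr},p}$; $\mathrm{tr}^{l+1}(d^l\Pi_\partial^l(u))=\mathrm{tr}^{l+1}(\Pi_\partial^{l+1}(d^lu))$ for $u\in V^l$, $l\le2$; for $l\le2$ and $u\in V^l$: $\Pi_\partial^l(u)|_\tau=0$ if $\tau\in\mathring{\mathcal T}_h^l$ and $\|\Pi_\partial^l(u)\|_{L^2(\tau)}\lesssim\|u\|_{L^2(\mathrm{es}^{2,l,\partial}(\tau))}+h_\tau\|d^lu\|_{L^2(\mathrm{es}^{2,l,\partial}(\tau))}$ if $\tau\in\mathcal T_h^{l,\partial}$; and $\|\Pi_\partial^3(u)\|_{L^2(\tau)}\lesssim\|u\|_{L^2(\tau)}$ for $u\in V^3$, $\tau\in\mathcal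 T_h$. $a\lesssim b$ means $a\le Cb$ with $C$ depending only on $\rho_{\mathcal T_h}$ and $p$. *)

theory Defs
  imports "HOL-Analysis.Analysis"
begin

type_synonym R3 = "real ^ 3"
type_synonym scalar_field = "R3 \<Rightarrow> real"
type_synonym vector_field = "R3 \<Rightarrow> R3"


section \<open>The domain\<close>

text \<open>Near every boundary point the set is, in the direction \<open>e\<close>, the strict subgraph of a Lipschitz
  function of the two coordinates orthogonal to \<open>e\<close>.\<close>

definition lipschitz_boundary :: "R3 set \<Rightarrow> bool" where
  "lipschitz_boundary \<Omega> \<longleftrightarrow>
     (\<forall>x\<in>frontier \<Omega>. \<exists>U e L (f :: R3 \<Rightarrow> real).
        open U \<and> x \<in> U \<and> norm e = 1 \<and> L-lipschitz_on UNIV f \<and>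
        \<Omega> \<inter> U = {y \<in> U. y \<bullet> e < f (y - (y \<bullet> e) *\<^sub>R e)})"

definition lipschitz_polyhedral_domain :: "R3 set \<Rightarrow> bool" where
  "lipschitz_polyhedral_domain \<Omega> \<longleftrightarrow>
     open \<Omega> \<and> bounded \<Omega> \<and> connected \<Omega> \<and> lipschitz_boundary \<Omega> \<and>
     (\<exists>\<P>. finite \<P> \<and> (\<forall>P\<in>\<P>. polytope P) \<and> closure \<Omega> = \<Union>\<P>)"


section \<open>Smooth fields and classical differential operators\<close>

primrec Ck :: "nat \<Rightarrow> (R3 \<Rightarrow> 'b::real_normed_vector) \<Rightarrow> bool" where
  "Ck 0 f \<longleftrightarrow> continuous_on UNIV f"
| "Ck (Suc k) f \<longleftrightarrow> (\<forall>x. f differentiable at x) \<and>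
     (\<forall>i. Ck k (\<lambda>x. frechet_derivative f (at x) (axis i 1)))"

definition smooth :: "(R3 \<Rightarrow> 'b::real_normed_vector) \<Rightarrow> bool" where
  "smooth f \<longleftrightarrow> (\<forall>k. Ck k f)"

definition test_functions :: "R3 set \<Rightarrow> (R3 \<Rightarrow> 'b::real_normed_vector) set" where
  "test_functions \<Omega> = {\<phi>. smooth \<phi> \<and> (\<exists>S. compact S \<and> S \<subseteq> \<Omega> \<and> (\<forall>x. x \<notin> S \<longrightarrow> \<phi> x = 0))}"

definition cl_grad :: "scalar_field \<Rightarrow> vector_field" where
  "cl_grad \<phi> x = (\<chi> i. frechet_derivative \<phi> (at x) (axis i 1))"

definition cl_div :: "vector_field \<Rightarrow> scalar_field" where
  "cl_div \<phi> x = (\<Sum>i\<in>UNIV. frechet_derivative \<phi> (at x) (axis i 1) $ i)"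

definition cl_curl :: "vector_field \<Rightarrow> vector_field" where
  "cl_curl \<phi> x =
     (let D = (\<lambda>i j. frechet_derivative \<phi> (at x) (axis i 1) $ j)
      in vector [D 2 3 - D 3 2, D 3 1 - D 1 3, D 1 2 - D 2 1])"


section \<open>Square-integrable fields\<close>

text \<open>Elements of \<open>L\<^sup>2(\<Omega>)\<close> are represented by functions on the whole space whose values outside
  \<open>\<Omega>\<close> are irrelevant; equality in \<open>L\<^sup>2(\<Omega>)\<close> is \<open>ae_eq \<Omega>\<close>.\<close>

definition ae_eq :: "R3 set \<Rightarrow> (R3 \<Rightarrow> 'b) \<Rightarrow> (R3 \<Rightarrow> 'b) \<Rightarrow> bool" where
  "ae_eq S f g \<longleftrightarrow> (AE x in lebesgue_on S. f x = g x)"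

definition L2 :: "R3 set \<Rightarrow> (R3 \<Rightarrow> 'b::euclidean_space) set" where
  "L2 S = {f. f \<in> borel_measurable (lebesgue_on S) \<and>
              integrable (lebesgue_on S) (\<lambda>x. (norm (f x))\<^sup>2)}"

definition L2_norm_on :: "R3 set \<Rightarrow> (R3 \<Rightarrow> 'b::euclidean_space) \<Rightarrow> real" where
  "L2_norm_on S f = sqrt (LINT x|lebesgue_on S. (norm (f x))\<^sup>2)"


section \<open>Weak derivatives and the spaces of the de Rham complex\<close>

definition has_weak_grad :: "R3 set \<Rightarrow> scalar_field \<Rightarrow> vector_field \<Rightarrow> bool" where
  "has_weak_grad \<Omega> u w \<longleftrightarrow> (\<forall>\<phi>\<in>test_functions \<Omega>.
     (LINT x|lebesgue_on \<Omega>. u x * cl_div \<phi> x) = - (LINT x|lebesgue_on \<Omega>. w x \<bullet> \<phi> x))"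

definition has_weak_curl :: "R3 set \<Rightarrow> vector_field \<Rightarrow> vector_field \<Rightarrow> bool" where
  "has_weak_curl \<Omega> u w \<longleftrightarrow> (\<forall>\<phi>\<in>test_functions \<Omega>.
     (LINT x|lebesgue_on \<Omega>. u x \<bullet> cl_curl \<phi> x) = (LINT x|lebesgue_on \<Omega>. w x \<bullet> \<phi> x))"

definition has_weak_div :: "R3 set \<Rightarrow> vector_field \<Rightarrow> scalar_field \<Rightarrow> bool" where
  "has_weak_div \<Omega> u w \<longleftrightarrow> (\<forall>\<phi>\<in>test_functions \<Omega>.
     (LINT x|lebesgue_on \<Omega>. u x \<bullet> cl_grad \<phi> x) = - (LINT x|lebesgue_on \<Omega>. w x * \<phi> x))"

definition V0 :: "R3 set \<Rightarrow> scalar_field set" where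
  "V0 \<Omega> = {u \<in> L2 \<Omega>. \<exists>w\<in>L2 \<Omega>. has_weak_grad \<Omega> u w}"

definition V1 :: "R3 set \<Rightarrow> vector_field set" where
  "V1 \<Omega> = {u \<in> L2 \<Omega>. \<exists>w\<in>L2 \<Omega>. has_weak_curl \<Omega> u w}"

definition V2 :: "R3 set \<Rightarrow> vector_field set" where
  "V2 \<Omega> = {u \<in> L2 \<Omega>. \<exists>w\<in>L2 \<Omega>. has_weak_div \<Omega> u w}"

definition V3 :: "R3 set \<Rightarrow> scalar_field set" where
  "V3 \<Omega> = L2 \<Omega>"

text \<open>The weak derivatives are unique only up to \<open>ae_eq \<Omega>\<close>; a representative is chosen.\<close>

definition d0 :: "R3 set \<Rightarrow> scalar_field \<Rightarrow> vector_field" where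
  "d0 \<Omega> u = (SOME w. w \<in> L2 \<Omega> \<and> has_weak_grad \<Omega> u w)"

definition d1 :: "R3 set \<Rightarrow> vector_field \<Rightarrow> vector_field" where
  "d1 \<Omega> u = (SOME w. w \<in> L2 \<Omega> \<and> has_weak_curl \<Omega> u w)"

definition d2 :: "R3 set \<Rightarrow> vector_field \<Rightarrow> scalar_field" where
  "d2 \<Omega> u = (SOME w. w \<in> L2 \<Omega> \<and> has_weak_div \<Omega> u w)"

definition graph_norm ::
  "R3 set \<Rightarrow> ((R3 \<Rightarrow> 'b::euclidean_space) \<Rightarrow> (R3 \<Rightarrow> 'c::euclidean_space)) \<Rightarrow> (R3 \<Rightarrow> 'b) \<Rightarrow> real" where
  "graph_norm \<Omega> d v = sqrt ((L2_norm_on \<Omega> v)\<^sup>2 + (L2_norm_on \<Omega> (d v))\<^sup>2)"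


section \<open>Traces\<close>

text \<open>Weak traces are functionals on smooth fields \<open>\<phi>\<close> given by Green's formulas. With \<open>n\<close> the unit
  outward normal on \<open>\<Gamma> = \<partial>\<Omega>\<close>, for smooth \<open>u\<close> the values are
    \<open>tr0 \<Omega> u \<phi> = \<integral>\<^sub>\<Gamma> u (\<phi> \<bullet> n)\<close>,
    \<open>tr1 \<Omega> u \<phi> = \<integral>\<^sub>\<Gamma> ((n \<times> u) \<times> n) \<bullet> (n \<times> \<phi>)\<close>,
    \<open>tr2 \<Omega> u \<phi> = \<integral>\<^sub>\<Gamma> (u \<bullet> n) \<phi>\<close>,
  i.e. the duality pairings of the boundary fields \<open>u\<close>, \<open>(n \<times> u) \<times> n\<close>, \<open>u \<bullet> n\<close> with the boundary
  values \<open>\<phi> \<bullet> n\<close>, \<open>n \<times> \<phi>\<close>, \<open>\<phi>\<close>. The functionals are set to 0 off the smooth fields, so that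
  equality of traces is equality of functions.\<close>

definition tr0 :: "R3 set \<Rightarrow> scalar_field \<Rightarrow> (vector_field \<Rightarrow> real)" where
  "tr0 \<Omega> u = (\<lambda>\<phi>. if smooth \<phi>
     then LINT x|lebesgue_on \<Omega>. d0 \<Omega> u x \<bullet> \<phi> x + u x * cl_div \<phi> x else 0)"

definition tr1 :: "R3 set \<Rightarrow> vector_field \<Rightarrow> (vector_field \<Rightarrow> real)" where
  "tr1 \<Omega> u = (\<lambda>\<phi>. if smooth \<phi>
     then LINT x|lebesgue_on \<Omega>. u x \<bullet> cl_curl \<phi> x - d1 \<Omega> u x \<bullet> \<phi> x else 0)"

definition tr2 :: "R3 set \<Rightarrow> vector_field \<Rightarrow> (scalar_field \<Rightarrow> real)" where
  "tr2 \<Omega> u = (\<lambda>\<phi>. if smooth \<phi>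
     then LINT x|lebesgue_on \<Omega>. u x \<bullet> cl_grad \<phi> x + d2 \<Omega> u x * \<phi> x else 0)"

definition tr3 :: "R3 set \<Rightarrow> scalar_field \<Rightarrow> real" where
  "tr3 \<Omega> u = (LINT x|lebesgue_on \<Omega>. u x)"

definition V0_zero :: "R3 set \<Rightarrow> scalar_field set" where
  "V0_zero \<Omega> = {u \<in> V0 \<Omega>. tr0 \<Omega> u = (\<lambda>_. 0)}"

definition V1_zero :: "R3 set \<Rightarrow> vector_field set" where
  "V1_zero \<Omega> = {u \<in> V1 \<Omega>. tr1 \<Omega> u = (\<lambda>_. 0)}"

definition V2_zero :: "R3 set \<Rightarrow> vector_field set" where
  "V2_zero \<Omega> = {u \<in> V2 \<Omega>. tr2 \<Omega> u = (\<lambda>_. 0)}"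

definition V3_zero :: "R3 set \<Rightarrow> scalar_field set" where
  "V3_zero \<Omega> = {u \<in> V3 \<Omega>. tr3 \<Omega> u = 0}"

definition trace_norm :: "'v set \<Rightarrow> ('v \<Rightarrow> 'g) \<Rightarrow> ('v \<Rightarrow> real) \<Rightarrow> 'g \<Rightarrow> real" where
  "trace_norm V tr N g = Inf {N v |v. v \<in> V \<and> tr v = g}"


section \<open>Meshes\<close>

definition simplicial_mesh :: "R3 set \<Rightarrow> R3 set set \<Rightarrow> bool" where
  "simplicial_mesh \<Omega> \<T> \<longleftrightarrow> triangulation \<T> \<and> (\<forall>\<tau>\<in>\<T>. 3 simplex \<tau>) \<and> \<Union>\<T> = closure \<Omega>"

definition inball_diameter :: "R3 set \<Rightarrow> real" where
  "inball_diameter \<tau> = Sup {2 * r |r. 0 \<le> r \<and> (\<exists>c. cball c r \<subseteq> \<tau>)}"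

definition shape_regularity :: "R3 set set \<Rightarrow> real" where
  "shape_regularity \<T> = Max ((\<lambda>\<tau>. diameter \<tau> / inball_diameter \<tau>) ` \<T>)"

text \<open>The extended patches \<open>es\<^sup>k(\<tau>)\<close>, \<open>k \<ge> 1\<close>; the value at 0 only starts the recursion (cells are
  closed).\<close>

primrec es :: "R3 set set \<Rightarrow> nat \<Rightarrow> R3 set \<Rightarrow> R3 set" where
  "es \<T> 0 \<tau> = \<tau>"
| "es \<T> (Suc k) \<tau> = interior (\<Union>{\<tau>' \<in> \<T>. \<tau>' \<inter> closure (es \<T> k \<tau>) \<noteq> {}})"

definition boundary_cells :: "R3 set \<Rightarrow> R3 set set \<Rightarrow> nat \<Rightarrow> R3 set set" where
  "boundary_cells \<Omega> \<T> l =
     {\<tau> \<in> \<T>. \<exists>F. F face_of \<tau> \<and> int l simplex F \<and> F \<subseteq> frontier \<Omega>}"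

definition es_boundary :: "R3 set \<Rightarrow> R3 set set \<Rightarrow> nat \<Rightarrow> nat \<Rightarrow> R3 set \<Rightarrow> R3 set" where
  "es_boundary \<Omega> \<T> k l \<tau> = es \<T> k \<tau> \<inter> interior (\<Union>(boundary_cells \<Omega> \<T> l))"


section \<open>Discrete spaces\<close>

definition poly_space :: "nat \<Rightarrow> scalar_field set" where
  "poly_space k = {q. \<exists>c :: (3 \<Rightarrow> nat) \<Rightarrow> real. q = (\<lambda>x.
     \<Sum>\<alpha> | (\<Sum>i\<in>UNIV. \<alpha> i) \<le> k. c \<alpha> * (\<Prod>i\<in>UNIV. (x $ i) ^ \<alpha> i))}"

lemma finite_multi_indices: "finite {\<alpha> :: 3 \<Rightarrow> nat. (\<Sum>i\<in>UNIV. \<alpha> i) \<le> k}"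
proof (rule finite_subset)
  show "{\<alpha> :: 3 \<Rightarrow> nat. (\<Sum>i\<in>UNIV. \<alpha> i) \<le> k} \<subseteq> Pi\<^sub>E UNIV (\<lambda>_. {..k})"
  proof -
    have "\<alpha> i \<le> k" if "(\<Sum>i\<in>UNIV. \<alpha> i) \<le> k" for \<alpha> :: "3 \<Rightarrow> nat" and i
      using that member_le_sum[of i UNIV \<alpha>] by (meson UNIV_I finite le_trans zero_le)
    then show ?thesis
      by auto
  qed
  show "finite (Pi\<^sub>E (UNIV :: 3 set) (\<lambda>_. {..k}))"
    by (intro finite_PiE) auto
qed

definition vpoly_space :: "nat \<Rightarrow> vector_field set" where
  "vpoly_space k = {q. \<forall>i. (\<lambda>x. q x $ i) \<in> poly_space k}"

definition nedelec_space :: "nat \<Rightarrow> vector_field set" where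
  "nedelec_space p = {\<lambda>x. a x + cross3 x (b x) |a b. a \<in> vpoly_space p \<and> b \<in> vpoly_space p}"

definition raviart_thomas_space :: "nat \<Rightarrow> vector_field set" where
  "raviart_thomas_space p = {\<lambda>x. a x + b x *\<^sub>R x |a b. a \<in> vpoly_space p \<and> b \<in> poly_space p}"

definition piecewise :: "R3 set set \<Rightarrow> (R3 \<Rightarrow> 'b) set \<Rightarrow> (R3 \<Rightarrow> 'b) set" where
  "piecewise \<T> Q = {u. \<forall>\<tau>\<in>\<T>. \<exists>q\<in>Q. ae_eq \<tau> u q}"

definition V0_h :: "R3 set \<Rightarrow> R3 set set \<Rightarrow> nat \<Rightarrow> scalar_field set" where
  "V0_h \<Omega> \<T> p = V0 \<Omega> \<inter> piecewise \<T> (poly_space (p + 1))"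

definition V1_h :: "R3 set \<Rightarrow> R3 set set \<Rightarrow> nat \<Rightarrow> vector_field set" where
  "V1_h \<Omega> \<T> p = V1 \<Omega> \<inter> piecewise \<T> (nedelec_space p)"

definition V2_h :: "R3 set \<Rightarrow> R3 set set \<Rightarrow> nat \<Rightarrow> vector_field set" where
  "V2_h \<Omega> \<T> p = V2 \<Omega> \<inter> piecewise \<T> (raviart_thomas_space p)"

definition V3_h :: "R3 set \<Rightarrow> R3 set set \<Rightarrow> nat \<Rightarrow> scalar_field set" where
  "V3_h \<Omega> \<T> p = V3 \<Omega> \<inter> piecewise \<T> (poly_space p)"


section \<open>Admissible pairs\<close>

text \<open>Operators act on representatives; only their values on the respective domain matter, and they
  are linear up to \<open>ae_eq \<Omega>\<close>. Operators on \<open>L\<^sup>2\<close> functions must in addition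
  respect \<open>ae_eq \<Omega>\<close>.\<close>

definition ae_linear ::
  "R3 set \<Rightarrow> ('a \<Rightarrow> 'r::real_vector) set \<Rightarrow> (('a \<Rightarrow> 'r) \<Rightarrow> (R3 \<Rightarrow> 'b::real_vector)) \<Rightarrow> bool" where
  "ae_linear \<Omega> D F \<longleftrightarrow> (\<forall>u\<in>D. \<forall>v\<in>D. \<forall>a b.
     ae_eq \<Omega> (F (\<lambda>x. a *\<^sub>R u x + b *\<^sub>R v x)) (\<lambda>x. a *\<^sub>R F u x + b *\<^sub>R F v x))"

definition field_operator ::
  "R3 set \<Rightarrow> (R3 \<Rightarrow> 'b::real_vector) set \<Rightarrow> (R3 \<Rightarrow> 'b) set \<Rightarrow> ((R3 \<Rightarrow> 'b) \<Rightarrow> (R3 \<Rightarrow> 'b)) \<Rightarrow> bool" where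
  "field_operator \<Omega> D R F \<longleftrightarrow>
     (\<forall>u\<in>D. F u \<in> R) \<and>
     (\<forall>u\<in>D. \<forall>v\<in>D. ae_eq \<Omega> u v \<longrightarrow> ae_eq \<Omega> (F u) (F v)) \<and>
     ae_linear \<Omega> D F"

record operators =
  op0 :: "scalar_field \<Rightarrow> scalar_field"
  op1 :: "vector_field \<Rightarrow> vector_field"
  op2 :: "vector_field \<Rightarrow> vector_field"
  op3 :: "scalar_field \<Rightarrow> scalar_field"

definition stable_projection ::
  "R3 set \<Rightarrow> R3 set set \<Rightarrow> real \<Rightarrow> (R3 \<Rightarrow> 'b::euclidean_space) set \<Rightarrow> (R3 \<Rightarrow> 'b) set
     \<Rightarrow> ((R3 \<Rightarrow> 'b) \<Rightarrow> (R3 \<Rightarrow> 'b)) \<Rightarrow> bool" where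
  "stable_projection \<Omega> \<T> K D R F \<longleftrightarrow>
     field_operator \<Omega> D R F \<and>
     (\<forall>u\<in>R. ae_eq \<Omega> (F u) u) \<and>
     (\<forall>u\<in>D. \<forall>\<tau>\<in>\<T>. L2_norm_on \<tau> (F u) \<le> K * L2_norm_on (es \<T> 2 \<tau>) u)"

definition interior_operators ::
  "R3 set \<Rightarrow> R3 set set \<Rightarrow> nat \<Rightarrow> real \<Rightarrow> operators \<Rightarrow> bool" where
  "interior_operators \<Omega> \<T> p K P \<longleftrightarrow>
     stable_projection \<Omega> \<T> K (V0_zero \<Omega>) (V0_h \<Omega> \<T> p \<inter> V0_zero \<Omega>) (op0 P) \<and>
     stable_projection \<Omega> \<T> K (V1_zero \<Omega>) (V1_h \<Omega> \<T> p \<inter> V1_zero \<Omega>) (op1 P) \<and>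
     stable_projection \<Omega> \<T> K (V2_zero \<Omega>) (V2_h \<Omega> \<T> p \<inter> V2_zero \<Omega>) (op2 P) \<and>
     stable_projection \<Omega> \<T> K (V3_zero \<Omega>) (V3_h \<Omega> \<T> p \<inter> V3_zero \<Omega>) (op3 P) \<and>
     (\<forall>u\<in>V0_zero \<Omega>. ae_eq \<Omega> (d0 \<Omega> (op0 P u)) (op1 P (d0 \<Omega> u))) \<and>
     (\<forall>u\<in>V1_zero \<Omega>. ae_eq \<Omega> (d1 \<Omega> (op1 P u)) (op2 P (d1 \<Omega> u))) \<and>
     (\<forall>u\<in>V2_zero \<Omega>. ae_eq \<Omega> (d2 \<Omega> (op2 P u)) (op3 P (d2 \<Omega> u)))"

definition trace_preserving :: "'v set \<Rightarrow> 'v set \<Rightarrow> ('v \<Rightarrow> 'g) \<Rightarrow> ('v \<Rightarrow> 'v) \<Rightarrow> bool" where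
  "trace_preserving V Vh tr F \<longleftrightarrow> (\<forall>u\<in>V. tr u \<in> tr ` Vh \<longrightarrow> tr (F u) = tr u)"

definition boundary_local ::
  "R3 set \<Rightarrow> R3 set set \<Rightarrow> real \<Rightarrow> nat \<Rightarrow> (R3 \<Rightarrow> 'b::euclidean_space) set
     \<Rightarrow> ((R3 \<Rightarrow> 'b) \<Rightarrow> (R3 \<Rightarrow> 'c::euclidean_space)) \<Rightarrow> ((R3 \<Rightarrow> 'b) \<Rightarrow> (R3 \<Rightarrow> 'b)) \<Rightarrow> bool" where
  "boundary_local \<Omega> \<T> K l V d F \<longleftrightarrow> (\<forall>u\<in>V.
     (\<forall>\<tau> \<in> \<T> - boundary_cells \<Omega> \<T> l. ae_eq \<tau> (F u) (\<lambda>_. 0)) \<and>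
     (\<forall>\<tau> \<in> boundary_cells \<Omega> \<T> l. L2_norm_on \<tau> (F u) \<le>
        K * (L2_norm_on (es_boundary \<Omega> \<T> 2 l \<tau>) u
             + diameter \<tau> * L2_norm_on (es_boundary \<Omega> \<T> 2 l \<tau>) (d u))))"

definition boundary_operators ::
  "R3 set \<Rightarrow> R3 set set \<Rightarrow> nat \<Rightarrow> real \<Rightarrow> operators \<Rightarrow> bool" where
  "boundary_operators \<Omega> \<T> p K P \<longleftrightarrow>
     field_operator \<Omega> (V0 \<Omega>) (V0_h \<Omega> \<T> p) (op0 P) \<and>
     field_operator \<Omega> (V1 \<Omega>) (V1_h \<Omega> \<T> p) (op1 P) \<and>
     field_operator \<Omega> (V2 \<Omega>) (V2_h \<Omega> \<T> p) (op2 P) \<and>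
     field_operator \<Omega> (V3 \<Omega>) (V3_h \<Omega> \<T> p) (op3 P) \<and>
     trace_preserving (V0 \<Omega>) (V0_h \<Omega> \<T> p) (tr0 \<Omega>) (op0 P) \<and>
     trace_preserving (V1 \<Omega>) (V1_h \<Omega> \<T> p) (tr1 \<Omega>) (op1 P) \<and>
     trace_preserving (V2 \<Omega>) (V2_h \<Omega> \<T> p) (tr2 \<Omega>) (op2 P) \<and>
     trace_preserving (V3 \<Omega>) (V3_h \<Omega> \<T> p) (tr3 \<Omega>) (op3 P) \<and>
     (\<forall>u\<in>V0 \<Omega>. tr1 \<Omega> (d0 \<Omega> (op0 P u)) = tr1 \<Omega> (op1 P (d0 \<Omega> u))) \<and>
     (\<forall>u\<in>V1 \<Omega>. tr2 \<Omega> (d1 \<Omega> (op1 P u)) = tr2 \<Omega> (op2 P (d1 \<Omega> u))) \<and>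
     (\<forall>u\<in>V2 \<Omega>. tr3 \<Omega> (d2 \<Omega> (op2 P u)) = tr3 \<Omega> (op3 P (d2 \<Omega> u))) \<and>
     boundary_local \<Omega> \<T> K 0 (V0 \<Omega>) (d0 \<Omega>) (op0 P) \<and>
     boundary_local \<Omega> \<T> K 1 (V1 \<Omega>) (d1 \<Omega>) (op1 P) \<and>
     boundary_local \<Omega> \<T> K 2 (V2 \<Omega>) (d2 \<Omega>) (op2 P) \<and>
     (\<forall>u\<in>V3 \<Omega>. \<forall>\<tau>\<in>\<T>. L2_norm_on \<tau> (op3 P u) \<le> K * L2_norm_on \<tau> u)"

text \<open>\<open>K\<close> is the constant hidden in the estimates of the definition.\<close>

definition admissible_pair ::
  "R3 set \<Rightarrow> R3 set set \<Rightarrow> nat \<Rightarrow> real \<Rightarrow> operators \<Rightarrow> operators \<Rightarrow> bool" where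
  "admissible_pair \<Omega> \<T> p K P\<^sub>0 P\<^sub>b \<longleftrightarrow>
     interior_operators \<Omega> \<T> p K P\<^sub>0 \<and> boundary_operators \<Omega> \<T> p K P\<^sub>b"


section \<open>Extension and discrete lifting operators\<close>

text \<open>An operator satisfying the properties required of the harmonic extension, with stability
  constant \<open>K\<close>.\<close>

definition stable_extension ::
  "R3 set \<Rightarrow> real \<Rightarrow> (R3 \<Rightarrow> 'b::euclidean_space) set \<Rightarrow> ((R3 \<Rightarrow> 'b) \<Rightarrow> ('t \<Rightarrow> real))
     \<Rightarrow> ((R3 \<Rightarrow> 'b) \<Rightarrow> real) \<Rightarrow> (('t \<Rightarrow> real) \<Rightarrow> (R3 \<Rightarrow> 'b)) \<Rightarrow> bool" where
  "stable_extension \<Omega> K V tr N E \<longleftrightarrow>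
     ae_linear \<Omega> (tr ` V) E \<and>
     (\<forall>g \<in> tr ` V. E g \<in> V \<and> tr (E g) = g \<and> N (E g) \<le> K * trace_norm V tr N g)"

text \<open>In particular an extension of minimal norm qualifies, with constant 1.\<close>

lemma minimal_extension_stable:
  assumes "ae_linear \<Omega> (tr ` V) E"
    and "\<And>g. g \<in> tr ` V \<Longrightarrow> E g \<in> V \<and> tr (E g) = g"
    and "\<And>v. v \<in> V \<Longrightarrow> N (E (tr v)) \<le> N v"
  shows "stable_extension \<Omega> 1 V tr N E"
proof -
  have "N (E g) \<le> trace_norm V tr N g" if "g \<in> tr ` V" for g
    unfolding trace_norm_def
  proof (rule cInf_greatest)
    show "{N v |v. v \<in> V \<and> tr v = g} \<noteq> {}"
      using that by auto
    show "N (E g) \<le> y" if "y \<in> {N v |v. v \<in> V \<and> tr v = g}" for y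
      using that assms(3) by force
  qed
  then show ?thesis
    using assms(1,2) by (auto simp: stable_extension_def)
qed

definition combined_operator ::
  "((R3 \<Rightarrow> 'b) \<Rightarrow> (R3 \<Rightarrow> 'b)) \<Rightarrow> ((R3 \<Rightarrow> 'b) \<Rightarrow> (R3 \<Rightarrow> 'b)) \<Rightarrow> (R3 \<Rightarrow> 'b::real_vector) \<Rightarrow> (R3 \<Rightarrow> 'b)" where
  "combined_operator F\<^sub>0 F\<^sub>b u = (\<lambda>x. F\<^sub>0 (\<lambda>y. u y - F\<^sub>b u y) x + F\<^sub>b u x)"

definition lifting ::
  "((R3 \<Rightarrow> 'b) \<Rightarrow> (R3 \<Rightarrow> 'b)) \<Rightarrow> ((R3 \<Rightarrow> 'b) \<Rightarrow> (R3 \<Rightarrow> 'b)) \<Rightarrow> ('g \<Rightarrow> (R3 \<Rightarrow> 'b::real_vector))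
     \<Rightarrow> 'g \<Rightarrow> (R3 \<Rightarrow> 'b)" where
  "lifting F\<^sub>0 F\<^sub>b E = combined_operator F\<^sub>0 F\<^sub>b \<circ> E"

definition stable_lifting ::
  "R3 set \<Rightarrow> real \<Rightarrow> (R3 \<Rightarrow> 'b::euclidean_space) set \<Rightarrow> (R3 \<Rightarrow> 'b) set
     \<Rightarrow> ((R3 \<Rightarrow> 'b) \<Rightarrow> ('t \<Rightarrow> real)) \<Rightarrow> ((R3 \<Rightarrow> 'b) \<Rightarrow> real)
     \<Rightarrow> (('t \<Rightarrow> real) \<Rightarrow> (R3 \<Rightarrow> 'b)) \<Rightarrow> bool" where
  "stable_lifting \<Omega> C V Vh tr N L \<longleftrightarrow>
     ae_linear \<Omega> (tr ` Vh) L \<and>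
     (\<forall>g \<in> tr ` Vh. L g \<in> Vh \<and> tr (L g) = g \<and> N (L g) \<le> C * trace_norm V tr N g)"

end

(* The lifting is P u = F0 (u - Fb u) + Fb u at u = E g. The trace condition on the boundary operators
   makes d (Fb u) - Gb (d u) a discrete field with zero trace, so the projection G0 of the next level
   fixes it and d (P u) = G0 (d u - Gb (d u)) + Gb (d u). Hence d (P u) is bounded by the local L2
   estimates of the next level and no inverse estimate for d (Fb u) is needed. Summing local estimates
   over the mesh needs only that each cell lies in boundedly many patches. This follows by counting:
   cells sharing a vertex, shrunk towards it to a common size, contain disjoint balls of comparable
   radius.
   Weak derivatives are unique by the fundamental lemma of the calculus of variations, for which smooth
   bump functions are built from exp (- 1 / t). *)
theory Submission
  imports Defs
begin

section \<open>Smooth functions and mixed partial derivatives\<close>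

text \<open>All levels share one frame: a weak derivative given by a formal adjoint and a sign, with
  the trace read off from Green's formula. The last level breaks the pattern, since its successor
  \<open>V3\<close> has the integral as trace and no further derivative; for this reason the next
  level enters the central argument only through abstract properties. That the derivative of a
  discrete field is again discrete rests on locality: inside a cell the weak derivative is the
  classical one, and the classical derivative stays in the next polynomial space. The factor
  \<open>diameter \<tau>\<close> in the boundary estimates is bounded by the diameter of the domain,
  so the constant depends on the domain as well as on shape regularity and degree. On the next level
  the corresponding term disappears, because consecutive derivatives compose to zero. Fields agree
  only almost everywhere while traces are equal as functions. Each operator must therefore respect
  null sets before identities between fields can be passed through it.\<close>

abbreviation pderiv_axis :: "3 \<Rightarrow> (R3 \<Rightarrow> 'b::real_normed_vector) \<Rightarrow> R3 \<Rightarrow> 'b"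
  where "pderiv_axis i f \<equiv> (\<lambda>x. frechet_derivative f (at x) (axis i 1))"

lemma pderiv_axis_unique:
  assumes "(f has_derivative f') (at x)"
  shows "pderiv_axis i f x = f' (axis i 1)"
  using frechet_derivative_at[OF assms] by simp

lemma pderiv_axis_has_derivative:
  assumes "f differentiable at x"
  shows "(f has_derivative frechet_derivative f (at x)) (at x)"
  using assms frechet_derivative_works by blast

lemma Ck_imp_continuous: "Ck k f \<Longrightarrow> continuous_on UNIV f"
  by (cases k) (auto simp: continuous_on_eq_continuous_at intro: differentiable_imp_continuous_within)

lemma Ck_Suc_imp: "Ck (Suc k) f \<Longrightarrow> Ck k f"
proof (induction k arbitrary: f)
  case 0
  then show ?case
    by (simp add: continuous_at_imp_continuous_on differentiable_imp_continuous_within)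
next
  case (Suc k)
  then show ?case by (metis Ck.simps(2))
qed

lemma Ck_const: "Ck k (\<lambda>x. c)"
proof (induction k arbitrary: c)
  case (Suc k)
  have "pderiv_axis i (\<lambda>x::R3. c) = (\<lambda>x. 0)" for i
    by (rule ext) (simp)
  with Suc show ?case by simp
qed auto

lemma pderiv_axis_bounded_linear:
  assumes "bounded_linear L" "\<And>x. f differentiable at x"
  shows "(\<lambda>x. L (f x)) differentiable at x"
    and "pderiv_axis i (\<lambda>x. L (f x)) x = L (pderiv_axis i f x)"
proof -
  have "((\<lambda>x. L (f x)) has_derivative (\<lambda>h. L (frechet_derivative f (at x) h))) (at x)"
    using bounded_linear.has_derivative[OF assms(1) pderiv_axis_has_derivative[OF assms(2)]] .
  then show "(\<lambda>x. L (f x)) differentiable at x" "pderiv_axis i (\<lambda>x. L (f x)) x = L (pderiv_axis i f x)"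
    using pderiv_axis_unique by (auto simp: differentiable_def)
qed

lemma Ck_bounded_linear:
  assumes "bounded_linear L"
  shows "Ck k f \<Longrightarrow> Ck k (\<lambda>x. L (f x))"
proof (induction k arbitrary: f)
  case 0
  then show ?case
    using assms by (auto intro: bounded_linear.continuous_on)
next
  case (Suc k)
  have d: "f differentiable at x" for x using Suc by simp
  show ?case
    using Suc pderiv_axis_bounded_linear[OF assms d] by simp
qed

lemma pderiv_axis_add:
  assumes "f differentiable at x" "g differentiable at x"
  shows "pderiv_axis i (\<lambda>x. f x + g x) x = pderiv_axis i f x + pderiv_axis i g x"
  by (rule pderiv_axis_unique[where f' = "\<lambda>h. frechet_derivative f (at x) h + frechet_derivative g (at x) h", simplified])
    (intro has_derivative_add pderiv_axis_has_derivative assms)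

lemma Ck_add: "Ck k f \<Longrightarrow> Ck k g \<Longrightarrow> Ck k (\<lambda>x. f x + g x)"
proof (induction k arbitrary: f g)
  case (Suc k)
  then show ?case
    by (simp add: pderiv_axis_add)
qed (auto intro: continuous_on_add)

lemma pderiv_axis_bilinear:
  assumes "bounded_bilinear B" "f differentiable at x" "g differentiable at x"
  shows "(\<lambda>x. B (f x) (g x)) differentiable at x"
    and "pderiv_axis i (\<lambda>x. B (f x) (g x)) x = B (f x) (pderiv_axis i g x) + B (pderiv_axis i f x) (g x)"
proof -
  have "((\<lambda>x. B (f x) (g x)) has_derivative
      (\<lambda>h. B (f x) (frechet_derivative g (at x) h) + B (frechet_derivative f (at x) h) (g x))) (at x)"
    using bounded_bilinear.FDERIV[OF assms(1) pderiv_axis_has_derivative[OF assms(2)]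
        pderiv_axis_has_derivative[OF assms(3)]] .
  then show "(\<lambda>x. B (f x) (g x)) differentiable at x"
    "pderiv_axis i (\<lambda>x. B (f x) (g x)) x = B (f x) (pderiv_axis i g x) + B (pderiv_axis i f x) (g x)"
    using pderiv_axis_unique by (auto simp: differentiable_def)
qed

text \<open>Stated for an arbitrary bounded bilinear map so that one induction serves every product:
  the product rule returns a sum of two terms of the same form, with factors one order less
  smooth.\<close>

lemma Ck_bilinear:
  assumes "bounded_bilinear B"
  shows "Ck k f \<Longrightarrow> Ck k g \<Longrightarrow> Ck k (\<lambda>x. B (f x) (g x))"
proof (induction k arbitrary: f g)
  case 0
  then show ?case
    using assms by (auto intro: bounded_bilinear.continuous_on)
next
  case (Suc k)
  have d: "f differentiable at x" "g differentiable at x" for x using Suc by auto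
  have "Ck k (\<lambda>x. B (f x) (pderiv_axis i g x) + B (pderiv_axis i f x) (g x))" for i
    using Suc.prems Ck_Suc_imp[OF Suc.prems(1)] Ck_Suc_imp[OF Suc.prems(2)]
    by (intro Ck_add Suc.IH) simp_all
  then show ?case
    using pderiv_axis_bilinear[OF assms d] by simp
qed

lemma smooth_const [intro]: "smooth (\<lambda>x. c)"
  by (simp add: smooth_def Ck_const)

lemma smooth_bounded_linear: "bounded_linear L \<Longrightarrow> smooth f \<Longrightarrow> smooth (\<lambda>x. L (f x))"
  by (simp add: smooth_def Ck_bounded_linear)

lemma smooth_add [intro]: "smooth f \<Longrightarrow> smooth g \<Longrightarrow> smooth (\<lambda>x. f x + g x)"
  by (simp add: smooth_def Ck_add)

lemma smooth_scaleR [intro]: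
  "smooth f \<Longrightarrow> smooth g \<Longrightarrow> smooth (\<lambda>x. f x *\<^sub>R g x)"
  unfolding smooth_def by (intro allI Ck_bilinear[OF bounded_bilinear_scaleR]) simp_all

lemma smooth_mult [intro]:
  fixes f g :: "R3 \<Rightarrow> real"
  shows "smooth f \<Longrightarrow> smooth g \<Longrightarrow> smooth (\<lambda>x. f x * g x)"
  using smooth_scaleR[of f g] by simp

lemma smooth_diff [intro]: "smooth f \<Longrightarrow> smooth g \<Longrightarrow> smooth (\<lambda>x. f x - g x)"
  using smooth_add[of f "\<lambda>x. - g x"] smooth_bounded_linear[OF bounded_linear_minus[OF bounded_linear_ident], of g]
  by simp

lemma smooth_sum [intro]:
  "(\<And>i. i \<in> I \<Longrightarrow> smooth (f i)) \<Longrightarrow> smooth (\<lambda>x. \<Sum>i\<in>I. f i x)"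
  by (induction I rule: infinite_finite_induct) auto

lemma smooth_imp_differentiable: "smooth f \<Longrightarrow> f differentiable at x"
  unfolding smooth_def by (metis Ck.simps(2))

lemma smooth_imp_continuous: "smooth f \<Longrightarrow> continuous_on UNIV f"
  unfolding smooth_def using Ck_imp_continuous by blast

lemma smooth_pderiv_axis [intro]: "smooth f \<Longrightarrow> smooth (pderiv_axis i f)"
  unfolding smooth_def by (metis Ck.simps(2))

lemma smooth_component [intro]: "smooth f \<Longrightarrow> smooth (\<lambda>x. f x $ i)"
  by (rule smooth_bounded_linear[OF bounded_linear_vec_nth])

lemma vec_eq_sum_axis: "v = (\<Sum>i\<in>UNIV. (v $ i) *\<^sub>R axis i 1)" for v :: "real ^ 'n"
  by (simp add: vec_eq_iff axis_def if_distrib[of "\<lambda>x. _ * x"] sum.delta' cong: if_cong)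

lemma smooth_vec:
  fixes f :: "R3 \<Rightarrow> real ^ 'n"
  assumes "\<And>i. smooth (\<lambda>x. f x $ i)"
  shows "smooth f"
proof -
  have "smooth (\<lambda>x. \<Sum>i\<in>UNIV. (f x $ i) *\<^sub>R axis i 1)"
    using assms by (intro smooth_sum smooth_scaleR smooth_const)
  then show ?thesis
    using vec_eq_sum_axis by (metis (no_types, lifting) ext)
qed

lemma smooth_ident: "smooth (\<lambda>x::R3. x)"
proof -
  have "Ck k (\<lambda>x::R3. x)" for k
  proof (cases k)
    case (Suc k)
    have "pderiv_axis i (\<lambda>x::R3. x) = (\<lambda>x. axis i 1)" for i
      by (rule ext) (simp add: frechet_derivative_ident)
    with Suc show ?thesis by (simp add: Ck_const)
  qed auto
  then show ?thesis by (simp add: smooth_def)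
qed

lemma pderiv_axis_component:
  "f differentiable at x \<Longrightarrow> pderiv_axis i (\<lambda>x. f x $ j) x = pderiv_axis i f x $ j"
  by (rule pderiv_axis_unique[where f' = "\<lambda>h. frechet_derivative f (at x) h $ j"])
    (rule bounded_linear.has_derivative[OF bounded_linear_vec_nth pderiv_axis_has_derivative])

lemma smooth_cl_grad [intro]: "smooth \<phi> \<Longrightarrow> smooth (cl_grad \<phi>)"
  by (rule smooth_vec) (auto simp: cl_grad_def)

lemma smooth_cl_div [intro]: "smooth \<phi> \<Longrightarrow> smooth (cl_div \<phi>)"
  unfolding cl_div_def[abs_def] by (auto intro!: smooth_sum smooth_component smooth_pderiv_axis)

lemma cl_curl_nth:
  "cl_curl \<phi> x $ 1 = pderiv_axis 2 \<phi> x $ 3 - pderiv_axis 3 \<phi> x $ 2"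
  "cl_curl \<phi> x $ 2 = pderiv_axis 3 \<phi> x $ 1 - pderiv_axis 1 \<phi> x $ 3"
  "cl_curl \<phi> x $ 3 = pderiv_axis 1 \<phi> x $ 2 - pderiv_axis 2 \<phi> x $ 1"
  by (simp_all add: cl_curl_def Let_def vector_3)

lemma smooth_cl_curl [intro]: "smooth \<phi> \<Longrightarrow> smooth (cl_curl \<phi>)"
proof -
  assume "smooth \<phi>"
  then have "smooth (\<lambda>x. cl_curl \<phi> x $ i)" for i :: 3
    using exhaust_3[of i]
    by (elim disjE) (simp_all add: cl_curl_nth smooth_diff smooth_component smooth_pderiv_axis)
  then show ?thesis by (rule smooth_vec)
qed

section \<open>Symmetry of mixed second derivatives\<close>

lemma has_real_derivative_along_axis:
  fixes f :: "R3 \<Rightarrow> real"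
  assumes "\<And>x. f differentiable at x"
  shows "((\<lambda>t. f (x + t *\<^sub>R axis i 1)) has_real_derivative pderiv_axis i f (x + t *\<^sub>R axis i 1)) (at t)"
proof -
  have "((\<lambda>t. f (x + t *\<^sub>R axis i 1)) has_derivative
     (\<lambda>h. frechet_derivative f (at (x + t *\<^sub>R axis i 1)) (h *\<^sub>R axis i 1))) (at t)"
    by (rule has_derivative_compose[OF _ pderiv_axis_has_derivative[OF assms]])
       (auto intro!: derivative_eq_intros)
  moreover have "frechet_derivative f (at y) (h *\<^sub>R axis i 1) = h * pderiv_axis i f y" for h y
    using linear_frechet_derivative[OF assms] by (simp add: linear_scale)
  ultimately show ?thesis
    by (simp add: has_field_derivative_def mult.commute[of _ "pderiv_axis i f _"])
qed

lemma mean_value_along_axis: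
  fixes f :: "R3 \<Rightarrow> real"
  assumes "\<And>x. f differentiable at x" "0 < h"
  obtains s where "0 < s" "s < h" "f (x + h *\<^sub>R axis i 1) - f x = h * pderiv_axis i f (x + s *\<^sub>R axis i 1)"
  using MVT2[OF assms(2), of "\<lambda>t. f (x + t *\<^sub>R axis i 1)"
      "\<lambda>t. pderiv_axis i f (x + t *\<^sub>R axis i 1)"]
    has_real_derivative_along_axis[OF assms(1)] by auto

text \<open>Two applications of the mean value theorem: along \<open>i\<close> to the increment of
  \<open>f\<close> in direction \<open>j\<close>, then along \<open>j\<close> to the partial
  derivative that this produces.\<close>

lemma second_difference:
  fixes f :: "R3 \<Rightarrow> real"
  assumes f: "smooth f" and "0 < h"
  obtains y where "norm (y - x) \<le> 2 * h"
    "f (x + h *\<^sub>R axis i 1 + h *\<^sub>R axis j 1) - f (x + h *\<^sub>R axis i 1) - f (x + h *\<^sub>R axis j 1) + f x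
       = h\<^sup>2 * pderiv_axis j (pderiv_axis i f) y"
proof -
  let ?g = "\<lambda>y. f (y + h *\<^sub>R axis j 1) - f y"
  have df: "f differentiable at y" for y using f by (rule smooth_imp_differentiable)
  have sh: "((\<lambda>y. f (y + h *\<^sub>R axis j 1)) has_derivative frechet_derivative f (at (y + h *\<^sub>R axis j 1))) (at y)" for y
    by (rule has_derivative_compose[OF _ pderiv_axis_has_derivative[OF df], where f'="\<lambda>h. h"])
      (auto intro!: derivative_eq_intros)
  have g: "(?g has_derivative (\<lambda>v. frechet_derivative f (at (y + h *\<^sub>R axis j 1)) v - frechet_derivative f (at y) v)) (at y)" for y
    by (intro has_derivative_diff sh pderiv_axis_has_derivative df)
  then have dg: "?g differentiable at y" for y by (auto simp: differentiable_def)
  obtain s where s: "0 < s" "s < h" "?g (x + h *\<^sub>R axis i 1) - ?g x = h * pderiv_axis i ?g (x + s *\<^sub>R axis i 1)"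
    using mean_value_along_axis[OF dg \<open>0 < h\<close>] by blast
  have dd: "pderiv_axis i f differentiable at y" for y
    using smooth_imp_differentiable[OF smooth_pderiv_axis[OF f]] .
  obtain t where t: "0 < t" "t < h" "pderiv_axis i f (x + s *\<^sub>R axis i 1 + h *\<^sub>R axis j 1) - pderiv_axis i f (x + s *\<^sub>R axis i 1)
     = h * pderiv_axis j (pderiv_axis i f) (x + s *\<^sub>R axis i 1 + t *\<^sub>R axis j 1)"
    using mean_value_along_axis[OF dd \<open>0 < h\<close>] by blast
  have "norm (s *\<^sub>R axis i 1 + t *\<^sub>R (axis j 1 :: R3)) \<le> 2 * h"
    using norm_triangle_ineq[of "s *\<^sub>R axis i 1" "t *\<^sub>R (axis j 1 :: R3)"] s t by simp
  moreover have "f (x + h *\<^sub>R axis i 1 + h *\<^sub>R axis j 1) - f (x + h *\<^sub>R axis i 1) - f (x + h *\<^sub>R axis j 1) + f x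
     = h\<^sup>2 * pderiv_axis j (pderiv_axis i f) (x + s *\<^sub>R axis i 1 + t *\<^sub>R axis j 1)"
    using s(3) t(3) pderiv_axis_unique[OF g, where i = i] by (simp add: power2_eq_square algebra_simps)
  ultimately show ?thesis
    by (intro that[of "x + s *\<^sub>R axis i 1 + t *\<^sub>R axis j 1"]) (simp_all add: add.assoc)
qed

text \<open>The second difference is symmetric in \<open>i\<close> and \<open>j\<close>. Both mixed
  derivatives therefore take a common value at points that tend to \<open>x\<close>, and continuity
  carries the equality to the limit.\<close>

lemma pderiv_axis_commute:
  fixes f :: "R3 \<Rightarrow> real"
  assumes f: "smooth f"
  shows "pderiv_axis i (pderiv_axis j f) x = pderiv_axis j (pderiv_axis i f) x"
proof -
  define H :: "nat \<Rightarrow> real" where "H n = inverse (real (Suc n))" for n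
  have H: "0 < H n" for n by (simp add: H_def)
  let ?P = "\<lambda>i j n y. norm (y - x) \<le> 2 * H n \<and>
    f (x + H n *\<^sub>R axis i 1 + H n *\<^sub>R axis j 1) - f (x + H n *\<^sub>R axis i 1) - f (x + H n *\<^sub>R axis j 1) + f x
       = (H n)\<^sup>2 * pderiv_axis j (pderiv_axis i f) y"
  have "\<forall>n. \<exists>y. ?P i j n y" "\<forall>n. \<exists>y. ?P j i n y"
    using second_difference[OF f H] by metis+
  then obtain y z where y: "\<And>n. ?P i j n (y n)" and z: "\<And>n. ?P j i n (z n)"
    by metis
  have "(\<lambda>n. 2 * H n) \<longlonglongrightarrow> 0"
    unfolding H_def using tendsto_mult_right_zero[OF LIMSEQ_inverse_real_of_nat] by blast
  then have lim: "y \<longlonglongrightarrow> x" "z \<longlonglongrightarrow> x"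
    using y z by (auto intro!: LIM_zero_cancel[where f=y] LIM_zero_cancel[where f=z] intro: Lim_null_comparison[where g="\<lambda>n. 2 * H n"])
  have c: "isCont (pderiv_axis j (pderiv_axis i f)) x" "isCont (pderiv_axis i (pderiv_axis j f)) x"
    using f by (auto intro!: continuous_on_interior[of UNIV] smooth_imp_continuous smooth_pderiv_axis)
  have "pderiv_axis j (pderiv_axis i f) (y n) = pderiv_axis i (pderiv_axis j f) (z n)" for n
  proof -
    have "(H n)\<^sup>2 * pderiv_axis j (pderiv_axis i f) (y n) = (H n)\<^sup>2 * pderiv_axis i (pderiv_axis j f) (z n)"
      using y[of n] z[of n] by (simp add: algebra_simps)
    then show ?thesis using H[of n] by simp
  qed
  moreover have "(\<lambda>n. pderiv_axis j (pderiv_axis i f) (y n)) \<longlonglongrightarrow> pderiv_axis j (pderiv_axis i f) x"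
    using c(1) lim(1) isCont_tendsto_compose by blast
  moreover have "(\<lambda>n. pderiv_axis i (pderiv_axis j f) (z n)) \<longlonglongrightarrow> pderiv_axis i (pderiv_axis j f) x"
    using c(2) lim(2) isCont_tendsto_compose by blast
  ultimately show ?thesis
    using LIMSEQ_unique by (metis (no_types, lifting) ext)
qed

text \<open>Needed for test fields: inserting a curl into the weak formulation of the gradient
  yields that the weak curl of a weak gradient vanishes.\<close>

lemma cl_div_cl_curl:
  assumes "smooth \<phi>"
  shows "cl_div (cl_curl \<phi>) x = 0"
proof -
  have s: "smooth (\<lambda>x. \<phi> x $ i)" for i using assms by blast
  have e: "(\<lambda>x. pderiv_axis i \<phi> x $ j) = pderiv_axis i (\<lambda>x. \<phi> x $ j)" for i j
    using pderiv_axis_component[OF smooth_imp_differentiable[OF assms]] by auto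
  have d: "pderiv_axis i (\<lambda>x. \<phi> x $ j) differentiable at x" for i j x
    using s smooth_imp_differentiable by blast
  have dc: "pderiv_axis i (cl_curl \<phi>) x $ j = pderiv_axis i (\<lambda>x. cl_curl \<phi> x $ j) x" for i j
    using pderiv_axis_component[OF smooth_imp_differentiable[OF smooth_cl_curl[OF assms]]] by auto
  have dd: "pderiv_axis k (\<lambda>x. pderiv_axis i \<phi> x $ j - pderiv_axis i' \<phi> x $ j') x
     = pderiv_axis k (pderiv_axis i (\<lambda>x. \<phi> x $ j)) x - pderiv_axis k (pderiv_axis i' (\<lambda>x. \<phi> x $ j')) x" for i j i' j' k
  proof -
    have "((\<lambda>x. pderiv_axis i \<phi> x $ j) has_derivative
        frechet_derivative (pderiv_axis i (\<lambda>x. \<phi> x $ j)) (at x)) (at x)" for i j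
      unfolding e by (rule pderiv_axis_has_derivative[OF d])
    then show ?thesis
      by (intro pderiv_axis_unique has_derivative_diff)
  qed
  show ?thesis
    using pderiv_axis_commute[OF s]
    by (simp add: cl_div_def sum_3 dc cl_curl_nth[abs_def] dd)
qed

text \<open>The counterpart one level up: inserting a gradient into the weak formulation of the curl
  shows that the weak divergence of a weak curl vanishes.\<close>

lemma cl_curl_cl_grad:
  assumes "smooth \<phi>"
  shows "cl_curl (cl_grad \<phi>) x = 0"
proof -
  have "pderiv_axis i (cl_grad \<phi>) x $ j = pderiv_axis i (\<lambda>x. cl_grad \<phi> x $ j) x" for i j
    using pderiv_axis_component[OF smooth_imp_differentiable[OF smooth_cl_grad[OF assms]]] by auto
  then have "pderiv_axis i (cl_grad \<phi>) x $ j = pderiv_axis i (pderiv_axis j \<phi>) x" for i j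
    by (simp add: cl_grad_def)
  then show ?thesis
    using pderiv_axis_commute[OF assms] by (simp add: vec_eq_iff forall_3 cl_curl_nth)
qed

section \<open>Bump functions and the fundamental lemma of the calculus of variations\<close>

lemma AE_lebesgue_onI: "(AE x in lebesgue. P x) \<Longrightarrow> S \<in> sets lebesgue \<Longrightarrow> AE x in lebesgue_on S. P x"
  by (subst AE_restrict_space_iff) auto

lemma smooth_prod:
  fixes f :: "'i \<Rightarrow> R3 \<Rightarrow> real"
  shows "(\<And>i. i \<in> I \<Longrightarrow> smooth (f i)) \<Longrightarrow> smooth (\<lambda>x. \<Prod>i\<in>I. f i x)"
  by (induction I rule: infinite_finite_induct) auto

section \<open>Flat functions and smooth bumps on boxes\<close>

text \<open>The polynomial factor makes the family closed under differentiation, which is what an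
  induction on the order of smoothness requires.\<close>

definition flat_exp :: "real poly \<Rightarrow> real \<Rightarrow> real" where
  "flat_exp P t = (if t > 0 then poly P (1 / t) * exp (- (1 / t)) else 0)"

text \<open>From the right, substitute \<open>s = 1 / t\<close>: the exponential beats every
  polynomial at infinity.\<close>

lemma flat_exp_tendsto_0: "(flat_exp P \<longlongrightarrow> 0) (at 0)"
proof -
  have "((\<lambda>s. \<Sum>i\<le>degree P. coeff P i * (s ^ i / exp s)) \<longlongrightarrow> (\<Sum>i\<le>degree P. coeff P i * 0)) at_top"
    by (intro tendsto_intros tendsto_power_div_exp_0)
  then have "((\<lambda>s. poly P s * exp (- s)) \<longlongrightarrow> 0) at_top"
    by (simp add: poly_altdef sum_distrib_right exp_minus divide_inverse mult.assoc)
  then have "((\<lambda>t. poly P (inverse t) * exp (- (inverse t))) \<longlongrightarrow> 0) (at_right 0)"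
    by (rule filterlim_compose[OF _ filterlim_inverse_at_top_right])
  then have "(flat_exp P \<longlongrightarrow> 0) (at_right 0)"
    by (rule Lim_transform_eventually)
      (auto simp: flat_exp_def eventually_at_filter inverse_eq_divide)
  moreover have "(flat_exp P \<longlongrightarrow> 0) (at_left 0)"
    by (rule Lim_transform_eventually[OF tendsto_const]) (auto simp: flat_exp_def eventually_at_filter)
  ultimately show ?thesis
    by (simp add: filterlim_at_split)
qed

text \<open>With \<open>s = 1 / t\<close>, differentiating \<open>P(s) exp(-s)\<close> in
  \<open>t\<close> gives \<open>s^2 (P - P')(s) exp(-s)\<close>; the factor
  \<open>[:0, 0, 1:]\<close> is \<open>s^2\<close>.\<close>

definition flat_deriv :: "real poly \<Rightarrow> real poly" where
  "flat_deriv P = [:0, 0, 1:] * (P - pderiv P)"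

lemma flat_exp_has_derivative:
  "(flat_exp P has_real_derivative flat_exp (flat_deriv P) t) (at t)"
proof -
  consider "t > 0" | "t < 0" | "t = 0" by linarith
  then show ?thesis
  proof cases
    case 1
    have "((\<lambda>t. poly P (1 / t) * exp (- (1 / t))) has_real_derivative
        poly (pderiv P) (1 / t) * (- (1 / t\<^sup>2)) * exp (- (1 / t)) + exp (- (1 / t)) * (1 / t\<^sup>2) * poly P (1 / t)) (at t)"
      using 1 by (auto intro!: derivative_eq_intros DERIV_chain2[OF poly_DERIV] simp: power2_eq_square)
    also have "poly (pderiv P) (1 / t) * (- (1 / t\<^sup>2)) * exp (- (1 / t)) + exp (- (1 / t)) * (1 / t\<^sup>2) * poly P (1 / t)
        = flat_exp (flat_deriv P) t"
      using 1 by (simp add: flat_exp_def flat_deriv_def field_simps power2_eq_square)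
    finally show ?thesis
      by (rule has_field_derivative_transform_within_open[of _ _ _ "{0<..}"]) (use 1 in \<open>auto simp: flat_exp_def\<close>)
  next
    case 2
    have "((\<lambda>t. 0) has_real_derivative 0) (at t)" by simp
    then have "(flat_exp P has_real_derivative 0) (at t)"
      by (rule has_field_derivative_transform_within_open[of _ _ _ "{..<0}"]) (use 2 in \<open>auto simp: flat_exp_def\<close>)
    then show ?thesis using 2 by (simp add: flat_exp_def)
  next
    case 3
    \<comment> \<open>Dividing by \<open>h\<close> multiplies the polynomial in \<open>1 / h\<close>
      by its variable, so the difference quotient at 0 is again a flat function and tends to
      0.\<close>
    have "(flat_exp P (0 + h) - flat_exp P 0) / h = flat_exp (pCons 0 P) h" for h
      by (simp add: flat_exp_def)
    then have "(\<lambda>h. (flat_exp P (0 + h) - flat_exp P 0) / h) \<midarrow>0\<rightarrow> 0"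
      using flat_exp_tendsto_0 by simp
    moreover have "flat_exp (flat_deriv P) 0 = 0"
      by (simp add: flat_exp_def)
    ultimately show ?thesis
      using 3 by (simp add: DERIV_def)
  qed
qed

lemma smooth_flat_exp: "smooth (\<lambda>x. flat_exp P (c * x $ i + d))"
proof -
  have "Ck k (\<lambda>x. flat_exp P (c * x $ i + d))" for k
  proof (induction k arbitrary: P)
    case 0
    have "continuous_on UNIV (flat_exp P)"
      using flat_exp_has_derivative DERIV_continuous_on by blast
    then have "continuous_on UNIV (\<lambda>x::R3. flat_exp P (c * x $ i + d))"
      by (rule continuous_on_compose2) (auto intro!: continuous_intros)
    then show ?case by simp
  next
    case (Suc k)
    have D: "((\<lambda>x::R3. flat_exp P (c * x $ i + d)) has_derivative
        (\<lambda>h. flat_exp (flat_deriv P) (c * x $ i + d) * (c * h $ i))) (at x)" for x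
      by (rule has_derivative_compose[OF _ flat_exp_has_derivative[THEN has_field_derivative_imp_has_derivative], where f' = "\<lambda>h. c * h $ i"])
        (auto intro!: derivative_eq_intros bounded_linear.has_derivative[OF bounded_linear_vec_nth])
    then have "pderiv_axis j (\<lambda>x. flat_exp P (c * x $ i + d))
        = (\<lambda>x. (c * axis j 1 $ i) * flat_exp (flat_deriv P) (c * x $ i + d))" for j
      using pderiv_axis_unique[OF D] by auto
    moreover have "Ck k (\<lambda>x. (c * axis j 1 $ i) * flat_exp (flat_deriv P) (c * x $ i + d))" for j :: 3
      by (rule Ck_bounded_linear[OF bounded_linear_mult_right Suc])
    ultimately show ?case
      using D by (auto simp: differentiable_def)
  qed
  then show ?thesis by (simp add: smooth_def)
qed

text \<open>The parameter \<open>n\<close> stretches the arguments: the bump rises to 1 at each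
  interior point of the box as \<open>n\<close> grows, while it stays 0 outside.\<close>

definition box_bump :: "R3 \<Rightarrow> R3 \<Rightarrow> nat \<Rightarrow> R3 \<Rightarrow> real" where
  "box_bump a b n x = (\<Prod>i\<in>UNIV. flat_exp 1 (real n * (x $ i - a $ i)) * flat_exp 1 (real n * (b $ i - x $ i)))"

lemma flat_exp_1_bounds: "0 \<le> flat_exp 1 t" "flat_exp 1 t \<le> 1"
  by (auto simp: flat_exp_def)

lemma box_bump_bounds: "0 \<le> box_bump a b n x" "box_bump a b n x \<le> 1"
  unfolding box_bump_def using flat_exp_1_bounds
  by (auto intro!: prod_nonneg prod_le_1 mult_nonneg_nonneg mult_le_one)

lemma box_bump_outside: "x \<notin> box a b \<Longrightarrow> box_bump a b n x = 0"
proof -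
  assume "x \<notin> box a b"
  then obtain i where "\<not> (a $ i < x $ i \<and> x $ i < b $ i)"
    by (auto simp: mem_box_cart)
  then have "flat_exp 1 (real n * (x $ i - a $ i)) * flat_exp 1 (real n * (b $ i - x $ i)) = 0"
    by (auto simp: flat_exp_def zero_less_mult_iff)
  then show ?thesis
    unfolding box_bump_def by (intro prod_zero bexI[of _ i]) auto
qed

lemma box_bump_tendsto_1:
  assumes "x \<in> box a b"
  shows "(\<lambda>n. box_bump a b n x) \<longlonglongrightarrow> 1"
proof -
  have L: "(\<lambda>n. flat_exp 1 (real n * d)) \<longlonglongrightarrow> 1" if "d > 0" for d
  proof -
    have "(\<lambda>n. exp (- (1 / d) * (1 / real n))) \<longlonglongrightarrow> exp (- (1 / d) * 0)"
      by (intro tendsto_intros lim_1_over_n)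
    then have "(\<lambda>n. exp (- (1 / d) * (1 / real n))) \<longlonglongrightarrow> 1" by simp
    then show ?thesis
      by (rule Lim_transform_eventually)
        (use that in \<open>auto simp: flat_exp_def mult.commute intro!: eventually_sequentiallyI[of 1]\<close>)
  qed
  have "(\<lambda>n. flat_exp 1 (real n * (x $ i - a $ i)) * flat_exp 1 (real n * (b $ i - x $ i))) \<longlonglongrightarrow> 1 * 1" for i
    by (intro tendsto_mult L) (use assms in \<open>auto simp: mem_box_cart\<close>)
  then have "(\<lambda>n. box_bump a b n x) \<longlonglongrightarrow> (\<Prod>i\<in>(UNIV :: 3 set). 1 * 1)"
    unfolding box_bump_def by (rule tendsto_prod)
  then show ?thesis by simp
qed

lemma smooth_box_bump: "smooth (box_bump a b n)"
proof -
  have "smooth (\<lambda>x. flat_exp 1 (real n * (x $ i - a $ i)))" for a :: R3 and i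
    using smooth_flat_exp[of 1 "real n" i "- real n * a $ i"] by (simp add: algebra_simps)
  moreover have "smooth (\<lambda>x. flat_exp 1 (real n * (b $ i - x $ i)))" for i
    using smooth_flat_exp[of 1 "- real n" i "real n * b $ i"] by (simp add: algebra_simps)
  ultimately show ?thesis
    unfolding box_bump_def[abs_def] by (intro smooth_prod smooth_mult)
qed

lemma box_bump_test: "cbox a b \<subseteq> S \<Longrightarrow> box_bump a b n \<in> test_functions S"
  unfolding test_functions_def using smooth_box_bump box_bump_outside box_subset_cbox
  by (fastforce intro: exI[of _ "cbox a b"])

section \<open>Smooth approximation of indicators of open sets\<close>

lemma test_function_subset: "\<phi> \<in> test_functions S \<Longrightarrow> S \<subseteq> T \<Longrightarrow> \<phi> \<in> test_functions T"
  unfolding test_functions_def by blast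

text \<open>The combination is \<open>1 - (1 - \<phi>) (1 - \<psi>)\<close>, a smooth substitute for
  the indicator of a union that preserves values between 0 and 1.\<close>

lemma test_function_union:
  fixes \<phi> \<psi> :: "R3 \<Rightarrow> real"
  assumes "\<phi> \<in> test_functions S" "\<psi> \<in> test_functions S"
  shows "(\<lambda>x. \<phi> x + \<psi> x - \<phi> x * \<psi> x) \<in> test_functions S"
proof -
  obtain A B where "smooth \<phi>" "smooth \<psi>" "compact A" "A \<subseteq> S" "compact B" "B \<subseteq> S"
    "\<forall>x. x \<notin> A \<longrightarrow> \<phi> x = 0" "\<forall>x. x \<notin> B \<longrightarrow> \<psi> x = 0"
    using assms by (auto simp: test_functions_def)
  then have "smooth (\<lambda>x. \<phi> x + \<psi> x - \<phi> x * \<psi> x)"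
     "compact (A \<union> B) \<and> A \<union> B \<subseteq> S \<and> (\<forall>x. x \<notin> A \<union> B \<longrightarrow> \<phi> x + \<psi> x - \<phi> x * \<psi> x = 0)"
    by (auto intro!: smooth_diff smooth_add smooth_mult)
  then show ?thesis
    unfolding test_functions_def by blast
qed

primrec union_bump :: "(nat \<Rightarrow> R3 \<times> R3) \<Rightarrow> nat \<Rightarrow> nat \<Rightarrow> R3 \<Rightarrow> real" where
  "union_bump c n 0 = (\<lambda>x. 0)"
| "union_bump c n (Suc k) = (\<lambda>x. union_bump c n k x + box_bump (fst (c k)) (snd (c k)) n x
     - union_bump c n k x * box_bump (fst (c k)) (snd (c k)) n x)"

lemma union_bump_test:
  assumes "\<And>k. cbox (fst (c k)) (snd (c k)) \<subseteq> S"
  shows "union_bump c n k \<in> test_functions S"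
proof (induction k)
  case 0
  show ?case
    by (auto simp: test_functions_def intro: exI[of _ "{}"])
next
  case (Suc k)
  then show ?case
    using test_function_union[OF Suc box_bump_test[OF assms[of k]]] by simp
qed

lemma union_bump_eq: "1 - union_bump c n k x = (\<Prod>j<k. 1 - box_bump (fst (c j)) (snd (c j)) n x)"
proof (induction k)
  case (Suc k)
  have "1 - union_bump c n (Suc k) x = (1 - union_bump c n k x) * (1 - box_bump (fst (c k)) (snd (c k)) n x)"
    by (simp add: algebra_simps)
  then show ?case using Suc by (simp add: mult.commute)
qed auto

lemma union_bump_bounds: "0 \<le> union_bump c n k x" "union_bump c n k x \<le> 1"
proof -
  have "0 \<le> 1 - union_bump c n k x" "1 - union_bump c n k x \<le> 1"
    unfolding union_bump_eq using box_bump_bounds by (auto intro!: prod_nonneg prod_le_1)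
  then show "0 \<le> union_bump c n k x" "union_bump c n k x \<le> 1" by auto
qed

text \<open>On the diagonal the number of boxes and the sharpness of the bumps grow together. A
  point of box \<open>k\<close> is captured because the union bump dominates the bump of that box as
  soon as the box takes part.\<close>

lemma union_bump_tendsto:
  "(\<lambda>n. union_bump c n n x) \<longlonglongrightarrow> indicator (\<Union>k. box (fst (c k)) (snd (c k))) x"
proof (cases "x \<in> (\<Union>k. box (fst (c k)) (snd (c k)))")
  case True
  then obtain k where k: "x \<in> box (fst (c k)) (snd (c k))" by auto
  let ?b = "\<lambda>n. box_bump (fst (c k)) (snd (c k)) n x"
  \<comment> \<open>\<open>union_bump c n n\<close> involves the boxes with index below
    \<open>n\<close>, so box \<open>k\<close> takes part from \<open>Suc k\<close> on.\<close>
  have "1 - union_bump c n n x \<le> 1 - ?b n" if "n \<ge> Suc k" for n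
  proof -
    have "1 - union_bump c n n x = (1 - ?b n) * (\<Prod>j\<in>{..<n} - {k}. 1 - box_bump (fst (c j)) (snd (c j)) n x)"
      unfolding union_bump_eq using that by (subst prod.remove[of _ k]) auto
    also have "\<dots> \<le> (1 - ?b n) * 1"
      using box_bump_bounds by (intro mult_left_mono prod_le_1) auto
    finally show ?thesis by simp
  qed
  then have "eventually (\<lambda>n. ?b n \<le> union_bump c n n x) sequentially"
    by (intro eventually_sequentiallyI[of "Suc k"]) force
  moreover have "?b \<longlonglongrightarrow> 1"
    by (rule box_bump_tendsto_1[OF k])
  ultimately have "(\<lambda>n. union_bump c n n x) \<longlonglongrightarrow> 1"
    using union_bump_bounds by (auto intro: tendsto_sandwich[where f = ?b and h = "\<lambda>_. 1"])
  then show ?thesis using True by simp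
next
  case False
  then have "1 - union_bump c n n x = 1" for n
    unfolding union_bump_eq by (simp add: box_bump_outside)
  then have "union_bump c n n x = 0" for n by (simp add: algebra_simps)
  then show ?thesis using False by simp
qed

section \<open>The fundamental lemma for integrable functions\<close>

lemma continuous_imp_measurable_lebesgue_on:
  fixes \<phi> :: "R3 \<Rightarrow> 'b::euclidean_space"
  assumes "continuous_on UNIV \<phi>"
  shows "\<phi> \<in> borel_measurable (lebesgue_on S)"
  using assms by (intro measurable_restrict_space1 measurable_completion) (simp add: borel_measurable_continuous_onI)

lemma test_function_smooth: "\<phi> \<in> test_functions S \<Longrightarrow> smooth \<phi>"
  by (simp add: test_functions_def)

text \<open>Suitable combinations of bumps converge almost everywhere to the indicator of an open set,
  so \<open>f\<close> has vanishing integral over open sets, hence over G-delta sets, hence over measurable sets.\<close>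

lemma orthogonal_to_test_functions_imp_zero:
  fixes f :: "R3 \<Rightarrow> real"
  assumes S: "open S" and f: "integrable (lebesgue_on S) f"
    and orth: "\<And>\<phi>. \<phi> \<in> test_functions S \<Longrightarrow> (LINT x|lebesgue_on S. f x * \<phi> x) = 0"
  shows "AE x in lebesgue_on S. f x = 0"
proof -
  let ?M = "lebesgue_on S"
  have Sm: "S \<in> sets lebesgue" using S by auto
  have fm[measurable]: "f \<in> borel_measurable ?M" using f by auto
  have opn: "(LINT x|?M. indicator U x * f x) = 0" if U: "open U" "U \<subseteq> S" for U
  proof (cases "U = {}")
    case False
    obtain D where D: "countable D" "\<And>X. X \<in> D \<Longrightarrow> X \<subseteq> U" "\<And>X. X \<in> D \<Longrightarrow> \<exists>a b. X = cbox a b" "\<Union>D = U"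
      using open_countable_Union_open_cbox[OF U(1)] by (metis Pow_iff subset_iff)
    have "D \<noteq> {}" using D(4) False by auto
    have "\<exists>c. \<forall>k. from_nat_into D k = cbox (fst (c k)) (snd (c k))"
      using D(3) from_nat_into[OF \<open>D \<noteq> {}\<close>] by (intro choice) (metis fst_conv snd_conv)
    then obtain c where c: "\<And>k. from_nat_into D k = cbox (fst (c k)) (snd (c k))"
      by blast
    have cU: "(\<Union>k. cbox (fst (c k)) (snd (c k))) = U"
      unfolding c[symmetric] using D(4) \<open>D \<noteq> {}\<close> D(1) by (metis range_from_nat_into)
    \<comment> \<open>The closed boxes exhaust \<open>U\<close>, but the bumps recover only the open
      ones; the difference is a countable union of null sets.\<close>
    let ?N = "\<Union>k. cbox (fst (c k)) (snd (c k)) - box (fst (c k)) (snd (c k))"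
    have "negligible ?N"
      by (rule negligible_countable_Union) (auto intro: negligible_frontier_interval)
    then have "AE x in lebesgue. x \<notin> ?N"
      by (intro AE_not_in) (simp only: negligible_iff_null_sets)
    then have N: "AE x in ?M. x \<notin> ?N"
      using Sm by (rule AE_lebesgue_onI)
    have t: "union_bump c n n \<in> test_functions S" for n
      using cU U(2) by (intro union_bump_test) auto
    have [measurable]: "union_bump c n n \<in> borel_measurable ?M" for n
      using t by (intro continuous_imp_measurable_lebesgue_on smooth_imp_continuous test_function_smooth)
    have [measurable]: "(indicator U :: _ \<Rightarrow> real) \<in> borel_measurable ?M"
      using U(1) by (intro measurable_restrict_space1 measurable_completion) auto
    have "(\<lambda>n. LINT x|?M. f x * union_bump c n n x) \<longlonglongrightarrow> (LINT x|?M. indicator U x * f x)"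
    proof (rule integral_dominated_convergence[where w = "\<lambda>x. norm (f x)"])
      show "AE x in ?M. (\<lambda>n. f x * union_bump c n n x) \<longlonglongrightarrow> indicator U x * f x"
        using N
      proof eventually_elim
        case (elim x)
        then have "indicator (\<Union>k. box (fst (c k)) (snd (c k))) x = (indicator U x :: real)"
          using cU box_subset_cbox by (fastforce simp: indicator_def)
        then show ?case
          using tendsto_mult[OF tendsto_const union_bump_tendsto, of "f x" c x] by (simp add: mult.commute)
      qed
      show "AE x in ?M. norm (f x * union_bump c n n x) \<le> norm (f x)" for n
        using union_bump_bounds[of c n n] by (intro AE_I2) (simp add: abs_mult mult_left_le)
      show "integrable ?M (\<lambda>x. norm (f x))" using f by auto
    qed measurable
    then show ?thesis
      using orth[OF t] by (simp add: LIMSEQ_const_iff)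
  qed auto
  have "set_lebesgue_integral ?M A f = 0" if A: "A \<in> sets ?M" for A
  proof -
    have Al: "A \<in> sets lebesgue" "A \<subseteq> S"
      using A Sm by (auto simp: sets_restrict_space_iff)
    obtain C T where C: "gdelta C" "T \<in> null_sets lebesgue" "A \<union> T = C" "disjnt A T"
      using lebesgue_set_almost_gdelta[OF Al(1)] .
    obtain F :: "nat \<Rightarrow> R3 set" where F: "\<And>n. open (F n)" "C = \<Inter>(F ` UNIV)"
      using C(1) by (auto elim: gdelta.cases)
    \<comment> \<open>Finite intersections keep the sets open and make them decrease to
      \<open>S \<inter> C\<close>, which agrees with \<open>A\<close> up to the null set
      \<open>T\<close>.\<close>
    let ?G = "\<lambda>n. S \<inter> (\<Inter>k\<le>n. F k)"
    have G: "open (?G n)" for n using S F(1) by auto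
    then have [measurable]: "(indicator (?G n) :: _ \<Rightarrow> real) \<in> borel_measurable ?M" for n
      by (intro measurable_restrict_space1 measurable_completion borel_measurable_indicator) simp
    have [measurable]: "(indicator A :: _ \<Rightarrow> real) \<in> borel_measurable ?M"
      using A by auto
    have T: "AE x in ?M. x \<notin> T"
      using AE_not_in[OF C(2)] Sm by (rule AE_lebesgue_onI)
    have "(\<lambda>n. LINT x|?M. indicator (?G n) x * f x) \<longlonglongrightarrow> (LINT x|?M. indicator A x * f x)"
    proof (rule integral_dominated_convergence[where w = "\<lambda>x. norm (f x)"])
      show "AE x in ?M. (\<lambda>n. indicator (?G n) x * f x) \<longlonglongrightarrow> indicator A x * f x"
        using T AE_space
      proof eventually_elim
        case (elim x)
        show ?case
        proof (cases "x \<in> C")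
          case True
          then have "x \<in> A" "\<And>n. x \<in> ?G n"
            using C(3) elim F(2) by auto
          then show ?thesis by simp
        next
          case False
          then obtain k where "x \<notin> F k" using F(2) by auto
          then have "eventually (\<lambda>n. indicator (?G n) x * f x = 0) sequentially"
            by (intro eventually_sequentiallyI[of k]) (auto simp: indicator_def)
          moreover have "x \<notin> A" using False C(3) by auto
          ultimately show ?thesis
            by (auto intro: tendsto_eventually)
        qed
      qed
      show "AE x in ?M. norm (indicator (?G n) x * f x) \<le> norm (f x)" for n
        by (auto simp: indicator_def)
      show "integrable ?M (\<lambda>x. norm (f x))" using f by auto
    qed measurable
    moreover have "(LINT x|?M. indicator (?G n) x * f x) = 0" for n
      using opn[OF G] by auto
    ultimately show ?thesis
      by (simp add: set_lebesgue_integral_def LIMSEQ_const_iff)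
  qed
  then show ?thesis
    \<comment> \<open>Two integrable densities with the same integral over every measurable set
      agree almost everywhere; here they are \<open>f\<close> and 0.\<close>
    using density_unique_real[OF f, of "\<lambda>_. 0"] by (simp add: set_lebesgue_integral_def)
qed

section \<open>Integration by parts\<close>

lemma pderiv_axis_zero_outside:
  assumes "compact S" "\<And>x. x \<notin> S \<Longrightarrow> f x = 0" "x \<notin> S"
  shows "pderiv_axis i f x = 0"
proof -
  have "((\<lambda>x. 0) has_derivative (\<lambda>h. 0)) (at x)" by simp
  then have "(f has_derivative (\<lambda>h. 0)) (at x)"
    by (rule has_derivative_transform_within_open[of _ _ _ _ "- S"])
      (use assms compact_imp_closed in \<open>auto simp: open_Compl\<close>)
  then show ?thesis by (rule pderiv_axis_unique)
qed

lemma integrable_compactly_supported: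
  fixes f :: "R3 \<Rightarrow> 'b::euclidean_space"
  assumes "continuous_on UNIV f" "compact S" "\<And>x. x \<notin> S \<Longrightarrow> f x = 0"
  shows "integrable lebesgue f"
proof -
  obtain a where a: "S \<subseteq> cbox (- a) a"
    using bounded_subset_cbox_symmetric[OF compact_imp_bounded[OF assms(2)]] by blast
  have "f absolutely_integrable_on cbox (- a) a"
    by (rule absolutely_integrable_continuous) (rule continuous_on_subset[OF assms(1) subset_UNIV])
  then have "integrable lebesgue (\<lambda>x. if x \<in> cbox (- a) a then f x else 0)"
    by (simp add: set_integrable_def indicator_scaleR_eq_if)
  moreover have "(\<lambda>x. if x \<in> cbox (- a) a then f x else 0) = f"
    using assms(3) a by (intro ext) (metis subsetD)
  ultimately show ?thesis by simp
qed

text \<open>Translation invariance is taken from the Borel measure; continuity makes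
  \<open>f\<close> Borel measurable, so that the passage to the completion does not change the
  integrals.\<close>

lemma lebesgue_integral_translate:
  fixes f :: "R3 \<Rightarrow> real"
  assumes "continuous_on UNIV f"
  shows "(LINT x|lebesgue. f (x + c)) = (LINT x|lebesgue. f x)"
proof -
  have [measurable]: "f \<in> borel_measurable borel"
    using assms by (rule borel_measurable_continuous_onI)
  have "(LINT x|lborel. f x) = (LINT x|distr lborel borel ((+) c). f x)"
    by (simp add: lborel_distr_plus)
  also have "\<dots> = (LINT x|lborel. f (c + x))"
    by (rule integral_distr) measurable
  finally show ?thesis
    by (simp add: integral_completion add.commute)
qed

text \<open>Each difference quotient has integral zero by translation invariance. The mean value
  theorem bounds the quotients uniformly, so dominated convergence passes this on to the
  derivative.\<close>

lemma integral_pderiv_axis_eq_0: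
  fixes f :: "R3 \<Rightarrow> real"
  assumes d: "\<And>x. f differentiable at x" and c: "continuous_on UNIV (pderiv_axis i f)"
    and S: "compact S" "\<And>x. x \<notin> S \<Longrightarrow> f x = 0"
  shows "(LINT x|lebesgue. pderiv_axis i f x) = 0"
proof -
  define e :: R3 where "e = axis i 1"
  let ?q = "\<lambda>n x. real (Suc n) * (f (x + (1 / real (Suc n)) *\<^sub>R e) - f x)"
  have cf: "continuous_on UNIV f"
    using d by (simp add: continuous_at_imp_continuous_on differentiable_imp_continuous_within)
  have cft: "continuous_on UNIV (\<lambda>x. f (x + v))" for v
    by (rule continuous_on_compose2[OF cf]) (auto intro!: continuous_intros)
  obtain B where B: "\<And>x. x \<in> S \<Longrightarrow> \<bar>pderiv_axis i f x\<bar> \<le> B"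
    using compact_imp_bounded[OF compact_continuous_image[OF continuous_on_subset[OF c subset_UNIV] S(1)]]
    unfolding bounded_iff by fastforce
  have B0: "\<bar>pderiv_axis i f x\<bar> \<le> max B 0" for x
    using B[of x] pderiv_axis_zero_outside[OF S, where x = x and i = i] by (cases "x \<in> S") auto
  obtain r where r: "S \<subseteq> cball 0 r"
    using compact_imp_bounded[OF S(1)] unfolding bounded_iff by (metis mem_cball_0 subsetI)
  \<comment> \<open>The steps \<open>1 / Suc n\<close> are at most 1, so the margin 1 around a ball
    containing the support covers all translates at once.\<close>
  define w :: "R3 \<Rightarrow> real" where "w x = (if x \<in> cball 0 (r + 1) then max B 0 else 0)" for x
  have q: "norm (?q n x) \<le> w x" for n x
  proof (cases "x \<in> cball 0 (r + 1)")
    case True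
    obtain s where s: "f (x + (1 / real (Suc n)) *\<^sub>R e) - f x = (1 / real (Suc n)) * pderiv_axis i f (x + s *\<^sub>R e)"
      using mean_value_along_axis[OF d, where h = "1 / real (Suc n)" and x = x and i = i] by (auto simp: e_def)
    then have "?q n x = pderiv_axis i f (x + s *\<^sub>R e)"
      by simp
    then show ?thesis
      using True B0 by (simp add: w_def)
  next
    case False
    have "norm ((1 / real (Suc n)) *\<^sub>R e) \<le> 1"
      by (simp add: e_def)
    moreover have "norm (x + v) > r" if "norm v \<le> 1" for v
      using False that norm_triangle_ineq2[of x "- v"] by simp
    ultimately have "norm (x + (1 / real (Suc n)) *\<^sub>R e) > r"
      by blast
    then have "x + (1 / real (Suc n)) *\<^sub>R e \<notin> S" "x \<notin> S"
      using False r by auto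
    then show ?thesis
      using False S(2) by (simp add: w_def)
  qed
  have lim: "(\<lambda>n. ?q n x) \<longlonglongrightarrow> pderiv_axis i f x" for x
  proof -
    have "((\<lambda>h. (f (x + h *\<^sub>R e) - f x) / h) \<longlongrightarrow> pderiv_axis i f x) (at 0)"
      using has_real_derivative_along_axis[OF d, where x = x and i = i and t = 0] by (simp add: DERIV_def e_def)
    moreover have "filterlim (\<lambda>n. 1 / real (Suc n)) (at 0) sequentially"
      unfolding filterlim_at using LIMSEQ_Suc[OF lim_1_over_n] by auto
    ultimately have "((\<lambda>n. (f (x + (1 / real (Suc n)) *\<^sub>R e) - f x) / (1 / real (Suc n))) \<longlongrightarrow> pderiv_axis i f x) sequentially"
      by (rule filterlim_compose)
    then show ?thesis by (simp add: mult.commute)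
  qed
  have m: "g \<in> borel_measurable lebesgue" if "continuous_on UNIV g" for g :: "R3 \<Rightarrow> real"
    using continuous_imp_measurable_lebesgue_on[OF that, of UNIV] by (simp add: lebesgue_on_UNIV_eq)
  have "(\<lambda>n. LINT x|lebesgue. ?q n x) \<longlonglongrightarrow> (LINT x|lebesgue. pderiv_axis i f x)"
  proof (rule integral_dominated_convergence[where w = w])
    show "integrable lebesgue w"
    proof -
      have "(\<lambda>x::R3. max B 0) absolutely_integrable_on cball 0 (r + 1)"
        by (rule absolutely_integrable_on_const) auto
      moreover have "w = (\<lambda>x. indicat_real (cball 0 (r + 1)) x *\<^sub>R max B 0)"
        by (auto simp: w_def fun_eq_iff indicator_def)
      ultimately show ?thesis
        unfolding set_integrable_def by metis
    qed
    show "?q n \<in> borel_measurable lebesgue" for n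
      using cf cft by (intro m continuous_intros)
  qed (use q lim m[OF c] in auto)
  moreover have "(LINT x|lebesgue. ?q n x) = 0" for n
  proof -
    have i: "integrable lebesgue f"
      using cf S by (rule integrable_compactly_supported)
    have "integrable lebesgue (\<lambda>x. f (x + (1 / real (Suc n)) *\<^sub>R e))"
    proof (rule integrable_compactly_supported[OF cft])
      show "compact ((\<lambda>x. x - (1 / real (Suc n)) *\<^sub>R e) ` S)"
        using S(1) by (intro compact_continuous_image continuous_intros)
      show "f (x + (1 / real (Suc n)) *\<^sub>R e) = 0" if "x \<notin> (\<lambda>x. x - (1 / real (Suc n)) *\<^sub>R e) ` S" for x
        using that by (intro S(2)) (force simp: image_iff)
    qed
    then show ?thesis
      using i lebesgue_integral_translate[OF cf, of "(1 / real (Suc n)) *\<^sub>R e"] by simp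
  qed
  ultimately show ?thesis
    by (simp add: LIMSEQ_const_iff)
qed

text \<open>The product \<open>q * \<phi>\<close> inherits the compact support of
  \<open>\<phi>\<close>, so the integral of its derivative vanishes. The integrability claims allow
  sums of such identities to be split componentwise.\<close>

lemma integral_by_parts_axis:
  fixes q \<phi> :: "R3 \<Rightarrow> real"
  assumes q: "smooth q" and \<phi>: "\<phi> \<in> test_functions T"
  shows "(LINT x|lebesgue. q x * pderiv_axis i \<phi> x) = - (LINT x|lebesgue. pderiv_axis i q x * \<phi> x)"
    and "integrable lebesgue (\<lambda>x. q x * pderiv_axis i \<phi> x)"
    and "integrable lebesgue (\<lambda>x. q x * \<phi> x)"
proof -
  obtain S where S: "smooth \<phi>" "compact S" "\<And>x. x \<notin> S \<Longrightarrow> \<phi> x = 0"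
    using \<phi> by (auto simp: test_functions_def)
  have sm: "smooth (\<lambda>x. q x * \<phi> x)" "smooth (\<lambda>x. q x * pderiv_axis i \<phi> x)" "smooth (\<lambda>x. pderiv_axis i q x * \<phi> x)"
    using q S by (auto intro!: smooth_mult smooth_pderiv_axis)
  show i: "integrable lebesgue (\<lambda>x. q x * pderiv_axis i \<phi> x)" "integrable lebesgue (\<lambda>x. q x * \<phi> x)"
    using sm S pderiv_axis_zero_outside[OF S(2,3)]
    by (auto intro!: integrable_compactly_supported[OF _ S(2)] smooth_imp_continuous)
  have i': "integrable lebesgue (\<lambda>x. pderiv_axis i q x * \<phi> x)"
    using sm S by (auto intro!: integrable_compactly_supported[OF _ S(2)] smooth_imp_continuous)
  have e: "pderiv_axis i (\<lambda>x. q x * \<phi> x) = (\<lambda>x. q x * pderiv_axis i \<phi> x + pderiv_axis i q x * \<phi> x)"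
    using pderiv_axis_bilinear(2)[OF bounded_bilinear_mult smooth_imp_differentiable[OF q] smooth_imp_differentiable[OF S(1)]]
    by blast
  have "(LINT x|lebesgue. pderiv_axis i (\<lambda>x. q x * \<phi> x) x) = 0"
    using S by (intro integral_pderiv_axis_eq_0[OF _ _ S(2)] smooth_imp_differentiable smooth_imp_continuous smooth_pderiv_axis sm) auto
  then show "(LINT x|lebesgue. q x * pderiv_axis i \<phi> x) = - (LINT x|lebesgue. pderiv_axis i q x * \<phi> x)"
    unfolding e using i(1) i' by simp
qed

section \<open>Weak derivatives and traces\<close>

lemma ae_eq_refl [simp]: "ae_eq S f f"
  by (simp add: ae_eq_def)

lemma ae_eq_trans [trans]: "ae_eq S f g \<Longrightarrow> ae_eq S g h \<Longrightarrow> ae_eq S f h"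
  by (auto simp: ae_eq_def elim: eventually_elim2)

lemma ae_eq_lincomb:
  fixes f g :: "R3 \<Rightarrow> 'b::real_vector"
  shows "ae_eq S f f' \<Longrightarrow> ae_eq S g g' \<Longrightarrow> ae_eq S (\<lambda>x. a *\<^sub>R f x + b *\<^sub>R g x) (\<lambda>x. a *\<^sub>R f' x + b *\<^sub>R g' x)"
  by (auto simp: ae_eq_def elim: eventually_elim2)

lemma ae_eq_add: "ae_eq S f f' \<Longrightarrow> ae_eq S g g' \<Longrightarrow> ae_eq S (\<lambda>x. f x + g x) (\<lambda>x. f' x + g' x)"
  by (auto simp: ae_eq_def elim: eventually_elim2)

lemma ae_eq_diff: "ae_eq S f f' \<Longrightarrow> ae_eq S g g' \<Longrightarrow> ae_eq S (\<lambda>x. f x - g x) (\<lambda>x. f' x - g' x)"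
  by (auto simp: ae_eq_def elim: eventually_elim2)

section \<open>Square-integrable fields and their norms\<close>

lemma L2_measurable [dest]: "f \<in> L2 S \<Longrightarrow> f \<in> borel_measurable (lebesgue_on S)"
  by (simp add: L2_def)

lemma L2_zero: "(\<lambda>_. 0) \<in> L2 S"
  by (simp add: L2_def)

lemma L2_lincomb:
  fixes f g :: "R3 \<Rightarrow> 'b::euclidean_space"
  assumes f: "f \<in> L2 S" and g: "g \<in> L2 S"
  shows "(\<lambda>x. a *\<^sub>R f x + b *\<^sub>R g x) \<in> L2 S"
proof -
  have [measurable]: "f \<in> borel_measurable (lebesgue_on S)" "g \<in> borel_measurable (lebesgue_on S)"
    using f g by auto
  have "integrable (lebesgue_on S) (\<lambda>x. (norm (a *\<^sub>R f x + b *\<^sub>R g x))\<^sup>2)"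
  proof (rule Bochner_Integration.integrable_bound)
    show "integrable (lebesgue_on S) (\<lambda>x. 2 * a\<^sup>2 * (norm (f x))\<^sup>2 + 2 * b\<^sup>2 * (norm (g x))\<^sup>2)"
      using f g by (auto simp: L2_def)
    have "(norm (a *\<^sub>R f x + b *\<^sub>R g x))\<^sup>2 \<le> 2 * a\<^sup>2 * (norm (f x))\<^sup>2 + 2 * b\<^sup>2 * (norm (g x))\<^sup>2" for x
    proof -
      have "(norm (a *\<^sub>R f x + b *\<^sub>R g x))\<^sup>2 \<le> (\<bar>a\<bar> * norm (f x) + \<bar>b\<bar> * norm (g x))\<^sup>2"
        using norm_triangle_ineq[of "a *\<^sub>R f x" "b *\<^sub>R g x"] by (intro power_mono) auto
      also have "\<dots> \<le> 2 * (\<bar>a\<bar> * norm (f x))\<^sup>2 + 2 * (\<bar>b\<bar> * norm (g x))\<^sup>2"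
        using sum_squares_bound[of "\<bar>a\<bar> * norm (f x)" "\<bar>b\<bar> * norm (g x)"] by (simp add: power2_sum)
      finally show ?thesis by (simp add: power_mult_distrib)
    qed
    then show "AE x in lebesgue_on S. norm ((norm (a *\<^sub>R f x + b *\<^sub>R g x))\<^sup>2)
      \<le> norm (2 * a\<^sup>2 * (norm (f x))\<^sup>2 + 2 * b\<^sup>2 * (norm (g x))\<^sup>2)"
      by (intro AE_I2) (simp add: order_trans[OF _ abs_ge_self])
  qed measurable
  then show ?thesis by (simp add: L2_def)
qed

lemma L2_add: "f \<in> L2 S \<Longrightarrow> g \<in> L2 S \<Longrightarrow> (\<lambda>x. f x + g x) \<in> L2 S"
  using L2_lincomb[of f S g 1 1] by simp

lemma L2_diff: "f \<in> L2 S \<Longrightarrow> g \<in> L2 S \<Longrightarrow> (\<lambda>x. f x - g x) \<in> L2 S"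
  using L2_lincomb[of f S g 1 "-1"] by simp

definition L2_sq :: "R3 set \<Rightarrow> (R3 \<Rightarrow> 'b::euclidean_space) \<Rightarrow> real" where
  "L2_sq S f = (LINT x|lebesgue_on S. (norm (f x))\<^sup>2)"

lemma L2_sq_nonneg [simp]: "0 \<le> L2_sq S f"
  by (simp add: L2_sq_def)

lemma L2_norm_on_sqrt: "L2_norm_on S f = sqrt (L2_sq S f)"
  by (simp add: L2_norm_on_def L2_sq_def)

lemma L2_norm_on_square [simp]: "(L2_norm_on S f)\<^sup>2 = L2_sq S f"
  by (simp add: L2_norm_on_sqrt)

lemma L2_norm_on_nonneg [simp]: "0 \<le> L2_norm_on S f"
  by (simp add: L2_norm_on_sqrt)

lemma L2_sq_cong:
  assumes "f \<in> L2 S" "g \<in> L2 S" "ae_eq S f g"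
  shows "L2_sq S f = L2_sq S g"
  unfolding L2_sq_def using assms L2_measurable
  by (intro integral_cong_AE) (auto simp: ae_eq_def elim: eventually_mono)

lemma L2_sq_lincomb_le:
  fixes f g :: "R3 \<Rightarrow> 'b::euclidean_space"
  assumes f: "f \<in> L2 S" and g: "g \<in> L2 S" and "\<bar>c\<bar> = 1"
  shows "L2_sq S (\<lambda>x. f x + c *\<^sub>R g x) \<le> 2 * L2_sq S f + 2 * L2_sq S g"
proof -
  have i: "integrable (lebesgue_on S) (\<lambda>x. (norm (f x))\<^sup>2)" "integrable (lebesgue_on S) (\<lambda>x. (norm (g x))\<^sup>2)"
    "integrable (lebesgue_on S) (\<lambda>x. (norm (f x + c *\<^sub>R g x))\<^sup>2)"
    using f g L2_lincomb[OF f g, of 1 c] by (auto simp: L2_def)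
  have "(norm (f x + c *\<^sub>R g x))\<^sup>2 \<le> 2 * (norm (f x))\<^sup>2 + 2 * (norm (g x))\<^sup>2" for x
  proof -
    have "(norm (f x + c *\<^sub>R g x))\<^sup>2 \<le> (norm (f x) + norm (g x))\<^sup>2"
      using norm_triangle_ineq[of "f x" "c *\<^sub>R g x"] \<open>\<bar>c\<bar> = 1\<close> by (intro power_mono) auto
    also have "\<dots> \<le> 2 * (norm (f x))\<^sup>2 + 2 * (norm (g x))\<^sup>2"
      using sum_squares_bound[of "norm (f x)" "norm (g x)"] by (simp add: power2_sum)
    finally show ?thesis .
  qed
  then have "L2_sq S (\<lambda>x. f x + c *\<^sub>R g x) \<le> (LINT x|lebesgue_on S. 2 * (norm (f x))\<^sup>2 + 2 * (norm (g x))\<^sup>2)"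
    unfolding L2_sq_def using i by (intro integral_mono) auto
  then show ?thesis
    using i by (simp add: L2_sq_def)
qed

lemma L2_sq_add_le:
  "f \<in> L2 S \<Longrightarrow> g \<in> L2 S \<Longrightarrow> L2_sq S (\<lambda>x. f x + g x) \<le> 2 * L2_sq S f + 2 * L2_sq S g"
  using L2_sq_lincomb_le[of f S g 1] by simp

lemma L2_sq_diff_le:
  "f \<in> L2 S \<Longrightarrow> g \<in> L2 S \<Longrightarrow> L2_sq S (\<lambda>x. f x - g x) \<le> 2 * L2_sq S f + 2 * L2_sq S g"
  using L2_sq_lincomb_le[of f S g "-1"] by simp

text \<open>On a set of finite measure the bound \<open>t \<le> 1 + t^2\<close> suffices.\<close>

lemma L2_imp_integrable:
  assumes "f \<in> L2 S" "S \<in> lmeasurable"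
  shows "integrable (lebesgue_on S) f"
proof -
  interpret finite_measure "lebesgue_on S"
    using assms(2) by (rule finite_measure_lebesgue_on)
  show ?thesis
  proof (rule Bochner_Integration.integrable_bound)
    show "integrable (lebesgue_on S) (\<lambda>x. 1 + (norm (f x))\<^sup>2)"
      using assms(1) by (auto simp: L2_def)
    have "t \<le> 1 + t\<^sup>2" for t :: real
      using zero_le_power2[of "t - 1/2"] by (simp add: power2_diff power_divide)
    then have "norm (f x) \<le> norm (1 + (norm (f x))\<^sup>2)" for x
      by (simp add: order_trans[OF _ abs_ge_self])
    then show "AE x in lebesgue_on S. norm (f x) \<le> norm (1 + (norm (f x))\<^sup>2)"
      by simp
  qed (use assms in auto)
qed

lemma integrable_inner_continuous:
  fixes f \<phi> :: "R3 \<Rightarrow> 'b::euclidean_space"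
  assumes f: "f \<in> L2 S" and S: "open S" "bounded S" and \<phi>: "continuous_on UNIV \<phi>"
  shows "integrable (lebesgue_on S) (\<lambda>x. f x \<bullet> \<phi> x)"
proof -
  have "S \<in> lmeasurable" using S by (simp add: lmeasurable_open)
  have [measurable]: "f \<in> borel_measurable (lebesgue_on S)" "\<phi> \<in> borel_measurable (lebesgue_on S)"
    using f \<phi> continuous_imp_measurable_lebesgue_on by auto
  have "bounded (\<phi> ` closure S)"
    using S(2) continuous_on_subset[OF \<phi>]
    by (intro compact_imp_bounded compact_continuous_image) (auto simp: compact_closure)
  then obtain B where B: "\<And>x. x \<in> S \<Longrightarrow> norm (\<phi> x) \<le> B"
    unfolding bounded_iff using closure_subset by (metis image_eqI subsetD)
  show ?thesis
  proof (rule Bochner_Integration.integrable_bound)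
    show "integrable (lebesgue_on S) (\<lambda>x. norm (f x) * B)"
      using L2_imp_integrable[OF f \<open>S \<in> lmeasurable\<close>] by auto
    have "norm (f x \<bullet> \<phi> x) \<le> norm (norm (f x) * B)" if "x \<in> S" for x
    proof -
      have "norm (f x \<bullet> \<phi> x) \<le> norm (f x) * norm (\<phi> x)"
        using Cauchy_Schwarz_ineq2 by auto
      also have "\<dots> \<le> norm (f x) * B" using B[OF that] by (rule mult_left_mono) simp
      finally show ?thesis by simp
    qed
    then show "AE x in lebesgue_on S. norm (f x \<bullet> \<phi> x) \<le> norm (norm (f x) * B)"
      by (intro AE_I2) simp
  qed measurable
qed

lemma L2_subset:
  fixes f :: "R3 \<Rightarrow> 'b::euclidean_space"
  assumes f: "f \<in> L2 S" and T: "T \<subseteq> S" and "T \<in> sets lebesgue" "S \<in> sets lebesgue"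
  shows "f \<in> L2 T"
proof -
  have "f \<in> borel_measurable (lebesgue_on T)"
    using L2_measurable[OF f] T by (rule measurable_restrict_mono)
  moreover have "set_integrable lebesgue S (\<lambda>x. (norm (f x))\<^sup>2)"
    using f assms(4) by (simp add: L2_def integrable_restrict_space set_integrable_def)
  then have "set_integrable lebesgue T (\<lambda>x. (norm (f x))\<^sup>2)"
    using assms(3) T by (rule set_integrable_subset)
  ultimately show ?thesis
    using assms(3) by (simp add: L2_def integrable_restrict_space set_integrable_def)
qed

lemma continuous_imp_L2:
  fixes f :: "R3 \<Rightarrow> 'b::euclidean_space"
  assumes f: "continuous_on UNIV f" and "bounded T" "T \<in> sets lebesgue"
  shows "f \<in> L2 T"
proof -
  obtain a where a: "T \<subseteq> cbox (- a) a"
    using bounded_subset_cbox_symmetric[OF assms(2)] by blast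
  have "(\<lambda>x. (norm (f x))\<^sup>2) absolutely_integrable_on cbox (- a) a"
    by (rule absolutely_integrable_continuous) (intro continuous_intros continuous_on_subset[OF f subset_UNIV])
  then have "(\<lambda>x. (norm (f x))\<^sup>2) absolutely_integrable_on T"
    using assms(3) a by (rule set_integrable_subset)
  then show ?thesis
    using continuous_imp_measurable_lebesgue_on[OF f] assms(3)
    by (simp add: L2_def integrable_restrict_space set_integrable_def)
qed

section \<open>Weak derivatives given by a formal adjoint\<close>

text \<open>A common frame for weak gradient, curl and divergence: \<open>A\<close> is the formal adjoint up to the
  sign \<open>s\<close>. Green's formula turns this into the weak trace.\<close>

definition wd_rel :: "R3 set \<Rightarrow> ((R3 \<Rightarrow> 'c::euclidean_space) \<Rightarrow> (R3 \<Rightarrow> 'b::euclidean_space)) \<Rightarrow> real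
    \<Rightarrow> (R3 \<Rightarrow> 'b) \<Rightarrow> (R3 \<Rightarrow> 'c) \<Rightarrow> bool" where
  "wd_rel \<Omega> A s u w \<longleftrightarrow> (\<forall>\<phi>\<in>test_functions \<Omega>.
     (LINT x|lebesgue_on \<Omega>. u x \<bullet> A \<phi> x) = s * (LINT x|lebesgue_on \<Omega>. w x \<bullet> \<phi> x))"

lemma wd_relD:
  "wd_rel \<Omega> A s u w \<Longrightarrow> \<phi> \<in> test_functions \<Omega> \<Longrightarrow>
    (LINT x|lebesgue_on \<Omega>. u x \<bullet> A \<phi> x) = s * (LINT x|lebesgue_on \<Omega>. w x \<bullet> \<phi> x)"
  by (simp add: wd_rel_def)

definition wd_space :: "R3 set \<Rightarrow> ((R3 \<Rightarrow> 'c::euclidean_space) \<Rightarrow> (R3 \<Rightarrow> 'b::euclidean_space)) \<Rightarrow> real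
    \<Rightarrow> (R3 \<Rightarrow> 'b) set" where
  "wd_space \<Omega> A s = {u \<in> L2 \<Omega>. \<exists>w\<in>L2 \<Omega>. wd_rel \<Omega> A s u w}"

definition wd :: "R3 set \<Rightarrow> ((R3 \<Rightarrow> 'c::euclidean_space) \<Rightarrow> (R3 \<Rightarrow> 'b::euclidean_space)) \<Rightarrow> real
    \<Rightarrow> (R3 \<Rightarrow> 'b) \<Rightarrow> (R3 \<Rightarrow> 'c)" where
  "wd \<Omega> A s u = (SOME w. w \<in> L2 \<Omega> \<and> wd_rel \<Omega> A s u w)"

text \<open>The defect in \<open>wd_rel\<close> when the field is smooth but need not vanish near
  the boundary. For \<open>u\<close> in \<open>wd_space \<Omega> A s\<close> it is zero on test
  functions, so it sees only the behaviour of \<open>\<phi>\<close> at the boundary.\<close>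

definition wd_trace :: "R3 set \<Rightarrow> ((R3 \<Rightarrow> 'c::euclidean_space) \<Rightarrow> (R3 \<Rightarrow> 'b::euclidean_space)) \<Rightarrow> real
    \<Rightarrow> (R3 \<Rightarrow> 'b) \<Rightarrow> ((R3 \<Rightarrow> 'c) \<Rightarrow> real)" where
  "wd_trace \<Omega> A s u = (\<lambda>\<phi>. if smooth \<phi>
     then LINT x|lebesgue_on \<Omega>. u x \<bullet> A \<phi> x - s * (wd \<Omega> A s u x \<bullet> \<phi> x) else 0)"

lemma test_function_vector:
  assumes "\<phi> \<in> test_functions S"
  shows "(\<lambda>x. \<phi> x *\<^sub>R b) \<in> test_functions S"
  using assms by (auto simp: test_functions_def intro!: smooth_scaleR smooth_const)

lemma ae_eq_if_inner_basis:
  fixes w w' :: "R3 \<Rightarrow> 'c::euclidean_space"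
  assumes "\<And>b. b \<in> Basis \<Longrightarrow> AE x in lebesgue_on S. (w x - w' x) \<bullet> b = 0"
  shows "ae_eq S w w'"
proof -
  have "AE x in lebesgue_on S. \<forall>b\<in>Basis. (w x - w' x) \<bullet> b = 0"
    using assms by (simp add: AE_finite_all)
  then show ?thesis
    unfolding ae_eq_def
    by eventually_elim (simp add: euclidean_eq_iff[of "w _"] inner_diff_left)
qed

lemma integral_lebesgue_on_zero_outside:
  fixes f :: "R3 \<Rightarrow> 'b::euclidean_space"
  assumes "S \<subseteq> T" "S \<in> sets lebesgue" "T \<in> sets lebesgue" "\<And>x. x \<notin> S \<Longrightarrow> f x = 0"
  shows "integral\<^sup>L (lebesgue_on T) f = integral\<^sup>L (lebesgue_on S) f"
proof -
  have "integral\<^sup>L (lebesgue_on T) f = integral\<^sup>L (lebesgue_on T) (\<lambda>x. if x \<in> S then f x else 0)"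
    by (rule Bochner_Integration.integral_cong[OF refl]) (metis assms(4))
  also have "\<dots> = integral\<^sup>L (lebesgue_on S) f"
    by (rule Lebesgue_Measure.integral_restrict[OF assms(1-3)])
  finally show ?thesis .
qed

text \<open>The last two assumptions say that \<open>A\<close> preserves smoothness and is local;
  together they make \<open>A \<phi>\<close> a test function whenever \<open>\<phi>\<close> is
  one.\<close>

locale weak_derivative =
  fixes \<Omega> :: "R3 set" and A :: "(R3 \<Rightarrow> 'c::euclidean_space) \<Rightarrow> (R3 \<Rightarrow> 'b::euclidean_space)" and s :: real
  assumes open_domain: "open \<Omega>" and bounded_domain: "bounded \<Omega>" and sign: "s \<noteq> 0"
    and smooth_adjoint: "\<And>\<phi>. smooth \<phi> \<Longrightarrow> smooth (A \<phi>)"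
    and adjoint_zero_outside: "\<And>\<phi> S x. compact S \<Longrightarrow> (\<And>y. y \<notin> S \<Longrightarrow> \<phi> y = 0) \<Longrightarrow> x \<notin> S \<Longrightarrow> A \<phi> x = 0"
begin

abbreviation "V \<equiv> wd_space \<Omega> A s"
abbreviation "D \<equiv> wd \<Omega> A s"
abbreviation "tr \<equiv> wd_trace \<Omega> A s"

lemma adjoint_test: "\<phi> \<in> test_functions S \<Longrightarrow> A \<phi> \<in> test_functions S"
proof -
  assume "\<phi> \<in> test_functions S"
  then obtain K where K: "smooth \<phi>" "compact K" "K \<subseteq> S" "\<And>x. x \<notin> K \<Longrightarrow> \<phi> x = 0"
    by (auto simp: test_functions_def)
  have "\<forall>x. x \<notin> K \<longrightarrow> A \<phi> x = 0"
    using adjoint_zero_outside[OF K(2), of \<phi>] K(4) by blast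
  then show ?thesis
    using K smooth_adjoint unfolding test_functions_def by blast
qed

lemma V_L2: "u \<in> V \<Longrightarrow> u \<in> L2 \<Omega>"
  by (simp add: wd_space_def)

lemma D_L2: "u \<in> V \<Longrightarrow> D u \<in> L2 \<Omega>"
  and D_rel: "u \<in> V \<Longrightarrow> wd_rel \<Omega> A s u (D u)"
proof -
  assume "u \<in> V"
  then have "\<exists>w. w \<in> L2 \<Omega> \<and> wd_rel \<Omega> A s u w"
    by (auto simp: wd_space_def)
  from someI_ex[OF this] show "D u \<in> L2 \<Omega>" "wd_rel \<Omega> A s u (D u)"
    by (auto simp: wd_def)
qed

lemma integrable_inner_smooth: "f \<in> L2 \<Omega> \<Longrightarrow> smooth \<phi> \<Longrightarrow> integrable (lebesgue_on \<Omega>) (\<lambda>x. f x \<bullet> \<phi> x)"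
  by (intro integrable_inner_continuous open_domain bounded_domain smooth_imp_continuous)

text \<open>Testing with \<open>\<phi>\<close> times a basis vector reduces the claim to the scalar
  fundamental lemma, applied to each component of the difference.\<close>

lemma rel_unique:
  assumes "w \<in> L2 \<Omega>" "w' \<in> L2 \<Omega>" "wd_rel \<Omega> A s u w" "wd_rel \<Omega> A s u w'"
  shows "ae_eq \<Omega> w w'"
proof (rule ae_eq_if_inner_basis)
  fix b :: 'c
  assume "b \<in> Basis"
  show "AE x in lebesgue_on \<Omega>. (w x - w' x) \<bullet> b = 0"
  proof (rule orthogonal_to_test_functions_imp_zero[OF open_domain])
    show "integrable (lebesgue_on \<Omega>) (\<lambda>x. (w x - w' x) \<bullet> b)"
      using integrable_inner_smooth[OF L2_diff[OF assms(1,2)] smooth_const] .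
    fix \<phi> :: "R3 \<Rightarrow> real"
    assume "\<phi> \<in> test_functions \<Omega>"
    then have t: "(\<lambda>x. \<phi> x *\<^sub>R b) \<in> test_functions \<Omega>" by (rule test_function_vector)
    then have i: "integrable (lebesgue_on \<Omega>) (\<lambda>x. w x \<bullet> (\<phi> x *\<^sub>R b))" "integrable (lebesgue_on \<Omega>) (\<lambda>x. w' x \<bullet> (\<phi> x *\<^sub>R b))"
      using assms integrable_inner_smooth test_function_smooth by blast+
    have "s * (LINT x|lebesgue_on \<Omega>. w x \<bullet> (\<phi> x *\<^sub>R b)) = s * (LINT x|lebesgue_on \<Omega>. w' x \<bullet> (\<phi> x *\<^sub>R b))"
      using wd_relD[OF assms(3) t] wd_relD[OF assms(4) t] by (rule trans[OF sym])
    then have "(LINT x|lebesgue_on \<Omega>. w x \<bullet> (\<phi> x *\<^sub>R b)) = (LINT x|lebesgue_on \<Omega>. w' x \<bullet> (\<phi> x *\<^sub>R b))"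
      using sign by simp
    then have "(LINT x|lebesgue_on \<Omega>. w x \<bullet> (\<phi> x *\<^sub>R b) - w' x \<bullet> (\<phi> x *\<^sub>R b)) = 0"
      using i by simp
    then show "(LINT x|lebesgue_on \<Omega>. (w x - w' x) \<bullet> b * \<phi> x) = 0"
      by (simp add: inner_diff_left algebra_simps)
  qed
qed

lemma D_unique: "u \<in> V \<Longrightarrow> w \<in> L2 \<Omega> \<Longrightarrow> wd_rel \<Omega> A s u w \<Longrightarrow> ae_eq \<Omega> (D u) w"
  using rel_unique D_L2 D_rel by blast

lemma rel_lincomb:
  assumes "u \<in> V" "v \<in> V"
  shows "wd_rel \<Omega> A s (\<lambda>x. a *\<^sub>R u x + b *\<^sub>R v x) (\<lambda>x. a *\<^sub>R D u x + b *\<^sub>R D v x)"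
  unfolding wd_rel_def
proof
  fix \<phi> :: "R3 \<Rightarrow> 'c"
  assume t: "\<phi> \<in> test_functions \<Omega>"
  then have "smooth \<phi>" "smooth (A \<phi>)" using smooth_adjoint test_function_smooth by auto
  then have i: "integrable (lebesgue_on \<Omega>) (\<lambda>x. u x \<bullet> A \<phi> x)" "integrable (lebesgue_on \<Omega>) (\<lambda>x. v x \<bullet> A \<phi> x)"
    "integrable (lebesgue_on \<Omega>) (\<lambda>x. D u x \<bullet> \<phi> x)" "integrable (lebesgue_on \<Omega>) (\<lambda>x. D v x \<bullet> \<phi> x)"
    using assms V_L2 D_L2 integrable_inner_smooth by blast+
  have "(LINT x|lebesgue_on \<Omega>. u x \<bullet> A \<phi> x) = s * (LINT x|lebesgue_on \<Omega>. D u x \<bullet> \<phi> x)"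
    "(LINT x|lebesgue_on \<Omega>. v x \<bullet> A \<phi> x) = s * (LINT x|lebesgue_on \<Omega>. D v x \<bullet> \<phi> x)"
    using wd_relD[OF D_rel[OF assms(1)] t] wd_relD[OF D_rel[OF assms(2)] t] .
  then show "(LINT x|lebesgue_on \<Omega>. (a *\<^sub>R u x + b *\<^sub>R v x) \<bullet> A \<phi> x) =
        s * (LINT x|lebesgue_on \<Omega>. (a *\<^sub>R D u x + b *\<^sub>R D v x) \<bullet> \<phi> x)"
    using i by (simp add: inner_add_left algebra_simps)
qed

lemma V_lincomb: "u \<in> V \<Longrightarrow> v \<in> V \<Longrightarrow> (\<lambda>x. a *\<^sub>R u x + b *\<^sub>R v x) \<in> V"
  unfolding wd_space_def[of \<Omega> A s] mem_Collect_eq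
  using rel_lincomb[of u v a b] L2_lincomb[OF V_L2 V_L2, of u v a b] L2_lincomb[OF D_L2 D_L2, of u v a b]
  by (simp add: wd_space_def) blast

text \<open>\<open>D\<close> picks a representative by choice, so linearity survives only almost
  everywhere.\<close>

lemma D_lincomb:
  "u \<in> V \<Longrightarrow> v \<in> V \<Longrightarrow> ae_eq \<Omega> (D (\<lambda>x. a *\<^sub>R u x + b *\<^sub>R v x)) (\<lambda>x. a *\<^sub>R D u x + b *\<^sub>R D v x)"
  by (intro D_unique V_lincomb rel_lincomb L2_lincomb D_L2)

lemma V_diff: "u \<in> V \<Longrightarrow> v \<in> V \<Longrightarrow> (\<lambda>x. u x - v x) \<in> V"
  using V_lincomb[of u v 1 "-1"] by simp

lemma D_diff: "u \<in> V \<Longrightarrow> v \<in> V \<Longrightarrow> ae_eq \<Omega> (D (\<lambda>x. u x - v x)) (\<lambda>x. D u x - D v x)"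
  using D_lincomb[of u v 1 "-1"] by simp

lemma D_add: "u \<in> V \<Longrightarrow> v \<in> V \<Longrightarrow> ae_eq \<Omega> (D (\<lambda>x. u x + v x)) (\<lambda>x. D u x + D v x)"
  using D_lincomb[of u v 1 1] by simp

lemma integral_inner_cong:
  assumes "f \<in> L2 \<Omega>" "g \<in> L2 \<Omega>" "ae_eq \<Omega> f g" "smooth \<phi>"
  shows "(LINT x|lebesgue_on \<Omega>. f x \<bullet> \<phi> x) = (LINT x|lebesgue_on \<Omega>. g x \<bullet> \<phi> x)"
proof (rule integral_cong_AE)
  show "AE x in lebesgue_on \<Omega>. f x \<bullet> \<phi> x = g x \<bullet> \<phi> x"
    using assms(3) by (auto simp: ae_eq_def elim: eventually_mono)
qed (use assms integrable_inner_smooth in blast)+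

lemma D_cong:
  assumes "u \<in> V" "v \<in> V" "ae_eq \<Omega> u v"
  shows "ae_eq \<Omega> (D u) (D v)"
proof (rule D_unique[OF assms(1) D_L2[OF assms(2)]])
  show "wd_rel \<Omega> A s u (D v)"
    unfolding wd_rel_def
  proof
    fix \<phi> :: "R3 \<Rightarrow> 'c"
    assume t: "\<phi> \<in> test_functions \<Omega>"
    show "(LINT x|lebesgue_on \<Omega>. u x \<bullet> A \<phi> x) = s * (LINT x|lebesgue_on \<Omega>. D v x \<bullet> \<phi> x)"
      using integral_inner_cong[OF V_L2[OF assms(1)] V_L2[OF assms(2)] assms(3)
          smooth_adjoint[OF test_function_smooth[OF t]]] wd_relD[OF D_rel[OF assms(2)] t]
      by (rule trans)
  qed
qed

lemma trace_eq:
  assumes "u \<in> V" "smooth \<phi>"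
  shows "tr u \<phi> = (LINT x|lebesgue_on \<Omega>. u x \<bullet> A \<phi> x) - s * (LINT x|lebesgue_on \<Omega>. D u x \<bullet> \<phi> x)"
  using assms integrable_inner_smooth[OF V_L2 smooth_adjoint] integrable_inner_smooth[OF D_L2]
  by (simp add: wd_trace_def)

text \<open>The traces are equal as functions although the fields agree only almost everywhere: the
  integrals ignore null sets, and \<open>D_cong\<close> absorbs the choice of representative made by
  \<open>D\<close>.\<close>

lemma trace_cong:
  assumes "u \<in> V" "v \<in> V" "ae_eq \<Omega> u v"
  shows "tr u = tr v"
proof
  fix \<phi> :: "R3 \<Rightarrow> 'c"
  show "tr u \<phi> = tr v \<phi>"
  proof (cases "smooth \<phi>")
    case True
    then show ?thesis
      using integral_inner_cong[OF V_L2[OF assms(1)] V_L2[OF assms(2)] assms(3) smooth_adjoint]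
        integral_inner_cong[OF D_L2[OF assms(1)] D_L2[OF assms(2)] D_cong[OF assms]]
      by (simp add: trace_eq assms)
  qed (simp add: wd_trace_def)
qed

lemma trace_lincomb:
  assumes "u \<in> V" "v \<in> V"
  shows "tr (\<lambda>x. a *\<^sub>R u x + b *\<^sub>R v x) = (\<lambda>\<phi>. a *\<^sub>R tr u \<phi> + b *\<^sub>R tr v \<phi>)"
proof
  fix \<phi> :: "R3 \<Rightarrow> 'c"
  show "tr (\<lambda>x. a *\<^sub>R u x + b *\<^sub>R v x) \<phi> = a *\<^sub>R tr u \<phi> + b *\<^sub>R tr v \<phi>"
  proof (cases "smooth \<phi>")
    case True
    have i: "integrable (lebesgue_on \<Omega>) (\<lambda>x. u x \<bullet> A \<phi> x)" "integrable (lebesgue_on \<Omega>) (\<lambda>x. v x \<bullet> A \<phi> x)"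
      "integrable (lebesgue_on \<Omega>) (\<lambda>x. D u x \<bullet> \<phi> x)" "integrable (lebesgue_on \<Omega>) (\<lambda>x. D v x \<bullet> \<phi> x)"
      using assms V_L2 D_L2 integrable_inner_smooth True smooth_adjoint by blast+
    have "(LINT x|lebesgue_on \<Omega>. D (\<lambda>x. a *\<^sub>R u x + b *\<^sub>R v x) x \<bullet> \<phi> x)
       = (LINT x|lebesgue_on \<Omega>. (a *\<^sub>R D u x + b *\<^sub>R D v x) \<bullet> \<phi> x)"
      using assms True by (intro integral_inner_cong D_L2 V_lincomb L2_lincomb D_lincomb)
    then show ?thesis
      using i True assms by (simp add: trace_eq V_lincomb inner_add_left algebra_simps)
  qed (simp add: wd_trace_def)
qed

lemma trace_eq_iff_diff:
  assumes "u \<in> V" "v \<in> V"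
  shows "tr u = tr v \<longleftrightarrow> tr (\<lambda>x. u x - v x) = (\<lambda>_. 0)"
  using trace_lincomb[OF assms, of 1 "-1"] by (auto simp: fun_eq_iff)

text \<open>A test field supported in \<open>T\<close> also tests \<open>u\<close> on the domain,
  where \<open>u\<close> may be replaced by \<open>q\<close>. Integration by parts over the whole
  space then moves the derivative onto \<open>q\<close>, and the fundamental lemma on
  \<open>T\<close> concludes.\<close>

lemma D_local:
  fixes q :: "R3 \<Rightarrow> 'b" and q' :: "R3 \<Rightarrow> 'c"
  assumes u: "u \<in> V" and T: "open T" "T \<subseteq> \<Omega>" "ae_eq T u q"
    and q: "smooth q" "smooth q'"
    and parts: "\<And>\<phi>. \<phi> \<in> test_functions UNIV \<Longrightarrow>
       (LINT x|lebesgue. q x \<bullet> A \<phi> x) = s * (LINT x|lebesgue. q' x \<bullet> \<phi> x)"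
  shows "ae_eq T (D u) q'"
proof (rule ae_eq_if_inner_basis)
  fix b :: 'c
  have Tm: "T \<in> sets lebesgue" and Om: "\<Omega> \<in> sets lebesgue"
    using T(1) open_domain by auto
  have bT: "bounded T" using T(2) bounded_domain bounded_subset by blast
  have L2T: "f \<in> L2 T" if "f \<in> L2 \<Omega>" for f :: "R3 \<Rightarrow> 'd::euclidean_space"
    using that T(2) Tm Om by (rule L2_subset)
  have L2c: "f \<in> L2 T" if "continuous_on UNIV f" for f :: "R3 \<Rightarrow> 'd::euclidean_space"
    using that bT Tm by (rule continuous_imp_L2)
  show "AE x in lebesgue_on T. (D u x - q' x) \<bullet> b = 0"
  proof (rule orthogonal_to_test_functions_imp_zero[OF T(1)])
    have DT: "D u \<in> L2 T" and qT: "q' \<in> L2 T"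
      using L2T D_L2[OF u] L2c q smooth_imp_continuous by blast+
    show "integrable (lebesgue_on T) (\<lambda>x. (D u x - q' x) \<bullet> b)"
      by (rule integrable_inner_continuous[OF L2_diff[OF DT qT] T(1) bT]) auto
    fix \<phi> :: "R3 \<Rightarrow> real"
    assume tT: "\<phi> \<in> test_functions T"
    then have t: "(\<lambda>x. \<phi> x *\<^sub>R b) \<in> test_functions T" by (rule test_function_vector)
    let ?p = "\<lambda>x. \<phi> x *\<^sub>R b"
    have t': "?p \<in> test_functions \<Omega>" "?p \<in> test_functions UNIV"
      using t T(2) test_function_subset by blast+
    have sp: "smooth ?p" "smooth (A ?p)"
      using t smooth_adjoint test_function_smooth by blast+
    have z: "\<phi> x = 0" "A ?p x = 0" if "x \<notin> T" for x
      using tT adjoint_test[OF t] that by (auto simp: test_functions_def)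
    have "s * (LINT x|lebesgue_on T. D u x \<bullet> ?p x) = s * (LINT x|lebesgue_on \<Omega>. D u x \<bullet> ?p x)"
      by (subst integral_lebesgue_on_zero_outside[OF T(2) Tm Om]) (use z in auto)
    also have "\<dots> = (LINT x|lebesgue_on \<Omega>. u x \<bullet> A ?p x)"
      by (rule wd_relD[OF D_rel[OF u] t'(1), symmetric])
    also have "\<dots> = (LINT x|lebesgue_on T. u x \<bullet> A ?p x)"
      by (subst integral_lebesgue_on_zero_outside[OF T(2) Tm Om]) (use z in auto)
    also have "\<dots> = (LINT x|lebesgue_on T. q x \<bullet> A ?p x)"
    proof (rule integral_cong_AE)
      show "AE x in lebesgue_on T. u x \<bullet> A ?p x = q x \<bullet> A ?p x"
        using T(3) by (auto simp: ae_eq_def elim: eventually_mono)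
    qed (use L2T[OF V_L2[OF u]] L2c[OF smooth_imp_continuous[OF q(1)]] sp smooth_imp_continuous
        integrable_inner_continuous[OF _ T(1) bT] in blast)+
    also have "\<dots> = (LINT x|lebesgue. q x \<bullet> A ?p x)"
      using integral_lebesgue_on_zero_outside[of T UNIV "\<lambda>x. q x \<bullet> A ?p x"] Tm z by (simp add: lebesgue_on_UNIV_eq)
    also have "\<dots> = s * (LINT x|lebesgue. q' x \<bullet> ?p x)"
      by (rule parts[OF t'(2)])
    also have "\<dots> = s * (LINT x|lebesgue_on T. q' x \<bullet> ?p x)"
      using integral_lebesgue_on_zero_outside[of T UNIV "\<lambda>x. q' x \<bullet> ?p x"] Tm z by (simp add: lebesgue_on_UNIV_eq)
    finally have e: "(LINT x|lebesgue_on T. D u x \<bullet> ?p x) = (LINT x|lebesgue_on T. q' x \<bullet> ?p x)"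
      using sign by simp
    have "integrable (lebesgue_on T) (\<lambda>x. D u x \<bullet> ?p x)" "integrable (lebesgue_on T) (\<lambda>x. q' x \<bullet> ?p x)"
      using DT qT sp smooth_imp_continuous integrable_inner_continuous[OF _ T(1) bT] by blast+
    then have "(LINT x|lebesgue_on T. D u x \<bullet> ?p x - q' x \<bullet> ?p x) = 0"
      using e by simp
    then show "(LINT x|lebesgue_on T. (D u x - q' x) \<bullet> b * \<phi> x) = 0"
      by (simp add: inner_diff_left algebra_simps)
  qed
qed

end

section \<open>Consecutive weak derivatives\<close>

text \<open>For formal adjoints the order is reversed: the second weak derivative annihilates the
  first because \<open>A\<close> annihilates the range of \<open>A'\<close>.\<close>

locale weak_complex =
  fst: weak_derivative \<Omega> A s + snd: weak_derivative \<Omega> A' s'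
  for \<Omega> :: "R3 set"
    and A :: "(R3 \<Rightarrow> 'c::euclidean_space) \<Rightarrow> (R3 \<Rightarrow> 'b::euclidean_space)" and s :: real
    and A' :: "(R3 \<Rightarrow> 'd::euclidean_space) \<Rightarrow> (R3 \<Rightarrow> 'c)" and s' :: real +
  assumes adjoint_adjoint: "\<And>\<phi> x. smooth \<phi> \<Longrightarrow> A (A' \<phi>) x = 0"
begin

lemma rel_D_zero:
  assumes "u \<in> fst.V"
  shows "wd_rel \<Omega> A' s' (fst.D u) (\<lambda>_. 0)"
  unfolding wd_rel_def
proof
  fix \<phi> :: "R3 \<Rightarrow> 'd"
  assume "\<phi> \<in> test_functions \<Omega>"
  then have "(LINT x|lebesgue_on \<Omega>. u x \<bullet> A (A' \<phi>) x) = s * (LINT x|lebesgue_on \<Omega>. fst.D u x \<bullet> A' \<phi> x)" "smooth \<phi>"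
    using wd_relD[OF fst.D_rel[OF assms] snd.adjoint_test] test_function_smooth by blast+
  then show "(LINT x|lebesgue_on \<Omega>. fst.D u x \<bullet> A' \<phi> x) = s' * (LINT x|lebesgue_on \<Omega>. 0 \<bullet> \<phi> x)"
    using adjoint_adjoint fst.sign by simp
qed

lemma D_in_V: "u \<in> fst.V \<Longrightarrow> fst.D u \<in> snd.V"
  unfolding wd_space_def[of \<Omega> A' s'] mem_Collect_eq
  by (intro conjI bexI[of _ "\<lambda>_. 0"] fst.D_L2 rel_D_zero L2_zero)

lemma D_D_zero: "u \<in> fst.V \<Longrightarrow> ae_eq \<Omega> (snd.D (fst.D u)) (\<lambda>_. 0)"
  by (intro snd.D_unique D_in_V rel_D_zero L2_zero)

text \<open>Green's formula for \<open>u\<close> with \<open>A' \<phi>\<close> in place of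
  \<open>\<phi>\<close>. It is available for every smooth \<open>\<phi>\<close>, not only for test
  functions, so a vanishing trace is inherited by the derivative.\<close>

lemma trace_D_zero:
  assumes "u \<in> fst.V" "fst.tr u = (\<lambda>_. 0)"
  shows "snd.tr (fst.D u) = (\<lambda>_. 0)"
proof
  fix \<phi> :: "R3 \<Rightarrow> 'd"
  show "snd.tr (fst.D u) \<phi> = 0"
  proof (cases "smooth \<phi>")
    case True
    have "fst.tr u (A' \<phi>) = 0" by (simp add: assms(2))
    then have "(LINT x|lebesgue_on \<Omega>. fst.D u x \<bullet> A' \<phi> x) = 0"
      using True adjoint_adjoint fst.sign by (simp add: fst.trace_eq[OF assms(1)] snd.smooth_adjoint)
    moreover have "(LINT x|lebesgue_on \<Omega>. snd.D (fst.D u) x \<bullet> \<phi> x) = (LINT x|lebesgue_on \<Omega>. 0 \<bullet> \<phi> x)"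
      using True assms(1) by (intro snd.integral_inner_cong snd.D_L2 D_in_V D_D_zero L2_zero)
    ultimately show ?thesis
      using True by (simp add: snd.trace_eq[OF D_in_V[OF assms(1)]])
  qed (simp add: wd_trace_def)
qed

end

section \<open>Polynomial spaces\<close>

definition monomial :: "(3 \<Rightarrow> nat) \<Rightarrow> scalar_field" where
  "monomial \<alpha> x = (\<Prod>i\<in>UNIV. (x $ i) ^ \<alpha> i)"

lemma poly_spaceE:
  assumes "q \<in> poly_space k"
  obtains c where "q = (\<lambda>x. \<Sum>\<alpha> | (\<Sum>i\<in>UNIV. \<alpha> i) \<le> k. c \<alpha> * monomial \<alpha> x)"
  using assms that unfolding poly_space_def mem_Collect_eq monomial_def by (elim exE)

lemma poly_spaceI: "(\<lambda>x. \<Sum>\<alpha> | (\<Sum>i\<in>UNIV. \<alpha> i) \<le> k. c \<alpha> * monomial \<alpha> x) \<in> poly_space k"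
  unfolding poly_space_def mem_Collect_eq monomial_def by (rule exI[where x = c]) (rule refl)

lemma poly_space_scale_add:
  assumes "q \<in> poly_space k" "r \<in> poly_space k"
  shows "(\<lambda>x. a * q x + b * r x) \<in> poly_space k"
proof -
  obtain c where c: "q = (\<lambda>x. \<Sum>\<alpha> | (\<Sum>i\<in>UNIV. \<alpha> i) \<le> k. c \<alpha> * monomial \<alpha> x)"
    using assms(1) by (rule poly_spaceE)
  obtain d where d: "r = (\<lambda>x. \<Sum>\<alpha> | (\<Sum>i\<in>UNIV. \<alpha> i) \<le> k. d \<alpha> * monomial \<alpha> x)"
    using assms(2) by (rule poly_spaceE)
  have "(\<lambda>x. a * q x + b * r x) = (\<lambda>x. \<Sum>\<alpha> | (\<Sum>i\<in>UNIV. \<alpha> i) \<le> k. (a * c \<alpha> + b * d \<alpha>) * monomial \<alpha> x)"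
    unfolding c d by (simp add: sum.distrib sum_distrib_left distrib_right mult.assoc)
  then show ?thesis
    by (simp only: poly_spaceI)
qed

lemma poly_space_monomial:
  assumes "(\<Sum>i\<in>UNIV. \<alpha> i) \<le> k"
  shows "monomial \<alpha> \<in> poly_space k"
proof -
  have "monomial \<alpha> = (\<lambda>x. \<Sum>\<beta> | (\<Sum>i\<in>UNIV. \<beta> i) \<le> k. (if \<beta> = \<alpha> then 1 else 0) * monomial \<beta> x)"
    using assms by (simp add: if_distrib[of "\<lambda>c. c * _"] sum.delta[OF finite_multi_indices] cong: if_cong)
  then show ?thesis
    by (simp only: poly_spaceI)
qed

lemma poly_space_zero: "(\<lambda>_. 0) \<in> poly_space k"
  using poly_space_scale_add[OF poly_space_monomial[of "\<lambda>_. 0" k] poly_space_monomial[of "\<lambda>_. 0" k], of 0 0]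
  by simp

lemma poly_space_add: "q \<in> poly_space k \<Longrightarrow> r \<in> poly_space k \<Longrightarrow> (\<lambda>x. q x + r x) \<in> poly_space k"
  using poly_space_scale_add[of q k r 1 1] by simp

lemma poly_space_diff: "q \<in> poly_space k \<Longrightarrow> r \<in> poly_space k \<Longrightarrow> (\<lambda>x. q x - r x) \<in> poly_space k"
  using poly_space_scale_add[of q k r 1 "-1"] by simp

lemma poly_space_scale: "q \<in> poly_space k \<Longrightarrow> (\<lambda>x. a * q x) \<in> poly_space k"
  using poly_space_scale_add[of q k q a 0] by simp

lemma poly_space_sum:
  "(\<And>i. i \<in> I \<Longrightarrow> q i \<in> poly_space k) \<Longrightarrow> (\<lambda>x. \<Sum>i\<in>I. q i x) \<in> poly_space k"
  by (induction I rule: infinite_finite_induct) (auto intro: poly_space_zero poly_space_add)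

lemma smooth_coordinate: "smooth (\<lambda>x::R3. x $ i)"
  by (rule smooth_component[OF smooth_ident])

lemma smooth_power:
  fixes f :: "R3 \<Rightarrow> real"
  shows "smooth f \<Longrightarrow> smooth (\<lambda>x. f x ^ n)"
  by (induction n) auto

lemma smooth_monomial: "smooth (monomial \<alpha>)"
  unfolding monomial_def[abs_def] by (intro smooth_prod smooth_power smooth_coordinate)

lemma smooth_poly_space: "q \<in> poly_space k \<Longrightarrow> smooth q"
  by (erule poly_spaceE) (auto intro!: smooth_sum smooth_mult smooth_const smooth_monomial)

section \<open>Degrees of polynomials under differentiation\<close>

lemma sum_fun_upd:
  fixes \<alpha> :: "3 \<Rightarrow> nat"
  shows "(\<Sum>i\<in>UNIV. (\<alpha>(j := n)) i) + \<alpha> j = (\<Sum>i\<in>UNIV. \<alpha> i) + n"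
  by (subst (1 2) sum.remove[of UNIV j]) auto

lemma monomial_fun_upd:
  "monomial (\<alpha>(j := n)) x = (x $ j) ^ n * (\<Prod>i\<in>UNIV - {j}. (x $ i) ^ \<alpha> i)"
  unfolding monomial_def by (subst prod.remove[of UNIV j]) auto

lemma coordinate_times_monomial: "x $ i * monomial \<alpha> x = monomial (\<alpha>(i := Suc (\<alpha> i))) x"
  using monomial_fun_upd[of \<alpha> i "\<alpha> i" x] by (simp add: monomial_fun_upd)

lemma pderiv_axis_monomial:
  "pderiv_axis j (monomial \<alpha>) x = real (\<alpha> j) * monomial (\<alpha>(j := \<alpha> j - 1)) x"
proof -
  have "((\<lambda>x. \<Prod>i\<in>UNIV. (x $ i) ^ \<alpha> i) has_derivative
     (\<lambda>y. \<Sum>i\<in>UNIV. (real (\<alpha> i) * y $ i * x $ i ^ (\<alpha> i - 1)) * (\<Prod>k\<in>UNIV - {i}. (x $ k) ^ \<alpha> k))) (at x)"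
    by (intro has_derivative_prod)
      (auto intro!: derivative_eq_intros bounded_linear.has_derivative[OF bounded_linear_vec_nth] simp: algebra_simps)
  then have "pderiv_axis j (\<lambda>x. \<Prod>i\<in>UNIV. (x $ i) ^ \<alpha> i) x
    = (\<Sum>i\<in>UNIV. (real (\<alpha> i) * axis j 1 $ i * x $ i ^ (\<alpha> i - 1)) * (\<Prod>k\<in>UNIV - {i}. (x $ k) ^ \<alpha> k))"
    by (rule pderiv_axis_unique)
  also have "\<dots> = (\<Sum>i\<in>UNIV. if i = j then real (\<alpha> j) * x $ j ^ (\<alpha> j - 1) * (\<Prod>k\<in>UNIV - {j}. (x $ k) ^ \<alpha> k) else 0)"
    by (intro sum.cong) (auto simp: axis_def)
  also have "(\<lambda>x. \<Prod>i\<in>UNIV. (x $ i) ^ \<alpha> i) = monomial \<alpha>"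
    by (simp add: monomial_def fun_eq_iff)
  finally show ?thesis
    by (simp add: monomial_fun_upd)
qed

lemma pderiv_axis_sum:
  assumes "\<And>i. i \<in> I \<Longrightarrow> smooth (f i :: R3 \<Rightarrow> real)" "finite I"
  shows "pderiv_axis j (\<lambda>x. \<Sum>i\<in>I. c i * f i x) x = (\<Sum>i\<in>I. c i * pderiv_axis j (f i) x)"
proof -
  have "((\<lambda>x. \<Sum>i\<in>I. c i * f i x) has_derivative (\<lambda>h. \<Sum>i\<in>I. c i * frechet_derivative (f i) (at x) h)) (at x)"
    using assms by (intro has_derivative_sum has_derivative_mult_right pderiv_axis_has_derivative smooth_imp_differentiable)
  then show ?thesis by (rule pderiv_axis_unique)
qed

lemma pderiv_axis_poly:
  "pderiv_axis j (\<lambda>x. \<Sum>\<alpha> | (\<Sum>i\<in>UNIV. \<alpha> i) \<le> k. c \<alpha> * monomial \<alpha> x) x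
    = (\<Sum>\<alpha> | (\<Sum>i\<in>UNIV. \<alpha> i) \<le> k. c \<alpha> * (real (\<alpha> j) * monomial (\<alpha>(j := \<alpha> j - 1)) x))"
  by (simp add: pderiv_axis_sum[OF smooth_monomial finite_multi_indices] pderiv_axis_monomial)

lemma pderiv_axis_poly_space_Suc:
  assumes "q \<in> poly_space (Suc k)"
  shows "pderiv_axis j q \<in> poly_space k"
proof -
  obtain c where q: "q = (\<lambda>x. \<Sum>\<alpha> | (\<Sum>i\<in>UNIV. \<alpha> i) \<le> Suc k. c \<alpha> * monomial \<alpha> x)"
    using assms by (rule poly_spaceE)
  have m: "(\<lambda>x. real (\<alpha> j) * monomial (\<alpha>(j := \<alpha> j - 1)) x) \<in> poly_space k" if "(\<Sum>i\<in>UNIV. \<alpha> i) \<le> Suc k" for \<alpha> :: "3 \<Rightarrow> nat"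
  \<comment> \<open>For \<open>\<alpha> j = 0\<close> truncated subtraction leaves the exponents as
    they are and the degree does not drop, but then the coefficient is 0.\<close>
  proof (cases "\<alpha> j = 0")
    case False
    then show ?thesis
      using that sum_fun_upd[of \<alpha> j "\<alpha> j - 1"] by (intro poly_space_scale poly_space_monomial) simp
  qed (simp add: poly_space_zero)
  then show ?thesis
    unfolding q pderiv_axis_poly by (intro poly_space_sum poly_space_scale[where q = "\<lambda>x. real (_ j) * _ x"] m) simp
qed

text \<open>The derivative lowers the degree before the coordinate raises it. This is why the extra
  terms of the Nedelec and Raviart-Thomas spaces do not push their derivatives beyond degree
  \<open>k\<close>.\<close>

lemma coordinate_times_pderiv_axis_poly_space:
  assumes "q \<in> poly_space k"
  shows "(\<lambda>x. x $ i * pderiv_axis j q x) \<in> poly_space k"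
proof -
  obtain c where q: "q = (\<lambda>x. \<Sum>\<alpha> | (\<Sum>i\<in>UNIV. \<alpha> i) \<le> k. c \<alpha> * monomial \<alpha> x)"
    using assms by (rule poly_spaceE)
  have m: "(\<lambda>x. real (\<alpha> j) * (x $ i * monomial (\<alpha>(j := \<alpha> j - 1)) x)) \<in> poly_space k" if "(\<Sum>i\<in>UNIV. \<alpha> i) \<le> k" for \<alpha> :: "3 \<Rightarrow> nat"
  proof (cases "\<alpha> j = 0")
    case False
    let ?\<beta> = "\<alpha>(j := \<alpha> j - 1)"
    have "(\<Sum>l\<in>UNIV. (?\<beta>(i := Suc (?\<beta> i))) l) \<le> k"
      using that False sum_fun_upd[of \<alpha> j "\<alpha> j - 1"] sum_fun_upd[of ?\<beta> i "Suc (?\<beta> i)"] by linarith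
    then show ?thesis
      unfolding coordinate_times_monomial by (intro poly_space_scale poly_space_monomial)
  qed (simp add: poly_space_zero)
  have "(\<lambda>x. \<Sum>\<alpha> | (\<Sum>i\<in>UNIV. \<alpha> i) \<le> k. c \<alpha> * (real (\<alpha> j) * (x $ i * monomial (\<alpha>(j := \<alpha> j - 1)) x))) \<in> poly_space k"
    by (intro poly_space_sum poly_space_scale[where q = "\<lambda>x. real (_ j) * (x $ i * _ x)"] m) simp
  then show ?thesis
    unfolding q pderiv_axis_poly by (simp add: sum_distrib_left algebra_simps)
qed

lemma poly_space_Suc: "q \<in> poly_space k \<Longrightarrow> q \<in> poly_space (Suc k)"
proof (erule poly_spaceE)
  fix c
  assume q: "q = (\<lambda>x. \<Sum>\<alpha> | (\<Sum>i\<in>UNIV. \<alpha> i) \<le> k. c \<alpha> * monomial \<alpha> x)"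
  show "q \<in> poly_space (Suc k)"
    unfolding q by (intro poly_space_sum poly_space_scale poly_space_monomial) simp
qed

lemma pderiv_axis_poly_space: "q \<in> poly_space k \<Longrightarrow> pderiv_axis j q \<in> poly_space k"
  by (intro pderiv_axis_poly_space_Suc poly_space_Suc)

lemma smooth_vpoly_space: "q \<in> vpoly_space k \<Longrightarrow> smooth q"
  by (rule smooth_vec) (auto simp: vpoly_space_def intro: smooth_poly_space)

lemma cross3_nth:
  "cross3 a b $ 1 = a $ 2 * b $ 3 - a $ 3 * b $ 2"
  "cross3 a b $ 2 = a $ 3 * b $ 1 - a $ 1 * b $ 3"
  "cross3 a b $ 3 = a $ 1 * b $ 2 - a $ 2 * b $ 1"
  by (simp_all add: cross3_def vector_3)

lemma smooth_nedelec_space: "q \<in> nedelec_space p \<Longrightarrow> smooth q"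
proof -
  assume "q \<in> nedelec_space p"
  then obtain a b where "q = (\<lambda>x. a x + cross3 x (b x))" and s: "smooth a" "smooth b"
    by (auto simp: nedelec_space_def dest: smooth_vpoly_space)
  moreover have "smooth (\<lambda>x. cross3 x (b x) $ i)" for i :: 3
    using exhaust_3[of i] s
    by (elim disjE) (simp_all add: cross3_nth smooth_diff smooth_mult smooth_coordinate smooth_component)
  then have "smooth (\<lambda>x. cross3 x (b x))" by (rule smooth_vec)
  ultimately show ?thesis by auto
qed

lemma smooth_raviart_thomas_space: "q \<in> raviart_thomas_space p \<Longrightarrow> smooth q"
  by (auto simp: raviart_thomas_space_def intro!: smooth_add smooth_scaleR smooth_ident
      intro: smooth_vpoly_space smooth_poly_space)

section \<open>Classical derivatives of the finite element spaces\<close>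

lemma pderiv_axis_coordinate: "pderiv_axis i (\<lambda>x::R3. x $ j) x = (if i = j then 1 else 0)"
  by (subst pderiv_axis_unique[OF bounded_linear_imp_has_derivative[OF bounded_linear_vec_nth]])
    (simp add: axis_def)

lemma pderiv_axis_mult:
  fixes f g :: "R3 \<Rightarrow> real"
  assumes "smooth f" "smooth g"
  shows "pderiv_axis i (\<lambda>x. f x * g x) x = f x * pderiv_axis i g x + pderiv_axis i f x * g x"
  by (rule pderiv_axis_bilinear(2)[OF bounded_bilinear_mult]) (intro smooth_imp_differentiable assms)+

lemma pderiv_axis_smooth_add:
  assumes "smooth f" "smooth g"
  shows "pderiv_axis i (\<lambda>x. f x + g x) x = pderiv_axis i f x + pderiv_axis i g x"
  by (intro pderiv_axis_add smooth_imp_differentiable assms)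

lemma pderiv_axis_smooth_diff:
  assumes "smooth f" "smooth g"
  shows "pderiv_axis i (\<lambda>x. f x - g x) x = pderiv_axis i f x - pderiv_axis i g x"
  by (rule pderiv_axis_unique) (intro has_derivative_diff pderiv_axis_has_derivative smooth_imp_differentiable assms)

lemma cl_grad_poly_space: "q \<in> poly_space (p + 1) \<Longrightarrow> cl_grad q \<in> nedelec_space p"
proof -
  assume "q \<in> poly_space (p + 1)"
  then have "cl_grad q \<in> vpoly_space p"
    using pderiv_axis_poly_space_Suc by (simp add: vpoly_space_def cl_grad_def)
  moreover have "(\<lambda>_. 0) \<in> vpoly_space p"
    by (simp add: vpoly_space_def poly_space_zero)
  ultimately show ?thesis
    unfolding nedelec_space_def mem_Collect_eq
    by (intro exI[where x = "cl_grad q"] exI[where x = "\<lambda>_. 0"]) simp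
qed

text \<open>For \<open>q = a + x \<times> b\<close> the curl is
  \<open>curl a - 2 b - (x . grad) b + (div b) x\<close>. The first three terms form the field
  \<open>c\<close> with components of degree at most \<open>p\<close>; the last is the radial part
  of the Raviart-Thomas space. The directional derivative \<open>e\<close> along \<open>x\<close>
  does not raise degrees.\<close>

lemma cl_curl_nedelec_space:
  assumes "q \<in> nedelec_space p"
  shows "cl_curl q \<in> raviart_thomas_space p"
proof -
  obtain a b where q: "q = (\<lambda>x. a x + cross3 x (b x))" and ab: "a \<in> vpoly_space p" "b \<in> vpoly_space p"
    using assms by (auto simp: nedelec_space_def)
  define a' b' where "a' j = (\<lambda>x. a x $ j)" and "b' j = (\<lambda>x. b x $ j)" for j
  have ab': "a' j \<in> poly_space p" "b' j \<in> poly_space p" for j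
    using ab by (auto simp: vpoly_space_def a'_def b'_def)
  have s: "smooth (a' j)" "smooth (b' j)" for j
    using ab' smooth_poly_space by auto
  have sm: "smooth (\<lambda>x. x $ i * b' j x)" for i j
    using s by (intro smooth_mult smooth_coordinate)
  define e where "e j x = (\<Sum>k\<in>UNIV. x $ k * pderiv_axis k (b' j) x)" for j x
  define c :: vector_field where "c x = vector
    [pderiv_axis 2 (a' 3) x - pderiv_axis 3 (a' 2) x - 2 * b' 1 x - e 1 x,
     pderiv_axis 3 (a' 1) x - pderiv_axis 1 (a' 3) x - 2 * b' 2 x - e 2 x,
     pderiv_axis 1 (a' 2) x - pderiv_axis 2 (a' 1) x - 2 * b' 3 x - e 3 x]" for x
  have e: "e j \<in> poly_space p" for j
    unfolding e_def[abs_def] by (intro poly_space_sum coordinate_times_pderiv_axis_poly_space ab')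
  have "(\<lambda>x. c x $ i) \<in> poly_space p" for i
    using exhaust_3[of i]
    by (elim disjE) (simp_all add: c_def vector_3 poly_space_diff poly_space_scale pderiv_axis_poly_space ab' e)
  then have "c \<in> vpoly_space p" by (simp add: vpoly_space_def)
  moreover have "(\<lambda>x. \<Sum>k\<in>UNIV. pderiv_axis k (b' k) x) \<in> poly_space p"
    by (intro poly_space_sum pderiv_axis_poly_space ab')
  moreover have "cl_curl q x = c x + (\<Sum>k\<in>UNIV. pderiv_axis k (b' k) x) *\<^sub>R x" for x
  proof -
    have d: "pderiv_axis i q x $ j = pderiv_axis i (\<lambda>x. q x $ j) x" for i j
      using pderiv_axis_component[OF smooth_imp_differentiable[OF smooth_nedelec_space[OF assms]]] by simp
    have qj: "(\<lambda>x. q x $ 1) = (\<lambda>x. a' 1 x + (x $ 2 * b' 3 x - x $ 3 * b' 2 x))"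
      "(\<lambda>x. q x $ 2) = (\<lambda>x. a' 2 x + (x $ 3 * b' 1 x - x $ 1 * b' 3 x))"
      "(\<lambda>x. q x $ 3) = (\<lambda>x. a' 3 x + (x $ 1 * b' 2 x - x $ 2 * b' 1 x))"
      by (simp_all add: q a'_def b'_def cross3_nth)
    have "pderiv_axis i (\<lambda>x. a' k x + (x $ l * b' m x - x $ m * b' l x)) x
      = pderiv_axis i (a' k) x + (x $ l * pderiv_axis i (b' m) x + (if i = l then 1 else 0) * b' m x
          - (x $ m * pderiv_axis i (b' l) x + (if i = m then 1 else 0) * b' l x))" for i k l m
      by (simp add: pderiv_axis_smooth_add pderiv_axis_smooth_diff pderiv_axis_mult s sm smooth_diff
          smooth_coordinate pderiv_axis_coordinate)
    then show ?thesis
      unfolding vec_eq_iff forall_3 cl_curl_nth d qj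
      by (simp add: c_def vector_3 e_def sum_3) (simp add: algebra_simps)
  qed
  ultimately show ?thesis
    unfolding raviart_thomas_space_def mem_Collect_eq
    by (intro exI[where x = c] exI[where x = "\<lambda>x. \<Sum>k\<in>UNIV. pderiv_axis k (b' k) x"] conjI ext)
qed

text \<open>The divergence of \<open>b x\<close> is \<open>3 b + x . grad b\<close>, again of degree
  at most \<open>p\<close>.\<close>

lemma cl_div_raviart_thomas_space:
  assumes "q \<in> raviart_thomas_space p"
  shows "cl_div q \<in> poly_space p"
proof -
  obtain a b where q: "q = (\<lambda>x. a x + b x *\<^sub>R x)" and ab: "a \<in> vpoly_space p" "b \<in> poly_space p"
    using assms by (auto simp: raviart_thomas_space_def)
  define a' where "a' j = (\<lambda>x. a x $ j)" for j
  have a': "a' j \<in> poly_space p" for j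
    using ab by (auto simp: vpoly_space_def a'_def)
  have s: "smooth (a' j)" "smooth b" for j
    using a' ab smooth_poly_space by auto
  have "cl_div q = (\<lambda>x. \<Sum>i\<in>UNIV. pderiv_axis i (a' i) x + (b x + x $ i * pderiv_axis i b x))"
  proof
    fix x
    have "pderiv_axis i q x $ i = pderiv_axis i (a' i) x + (b x + x $ i * pderiv_axis i b x)" for i
    proof -
      have "pderiv_axis i q x $ i = pderiv_axis i (\<lambda>x. q x $ i) x"
        using pderiv_axis_component[OF smooth_imp_differentiable[OF smooth_raviart_thomas_space[OF assms]]] by simp
      also have "(\<lambda>x. q x $ i) = (\<lambda>x. a' i x + b x * x $ i)"
        by (simp add: q a'_def)
      also have "pderiv_axis i \<dots> x = pderiv_axis i (a' i) x + (b x + x $ i * pderiv_axis i b x)"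
        by (simp add: pderiv_axis_smooth_add pderiv_axis_mult s smooth_mult smooth_coordinate
            pderiv_axis_coordinate algebra_simps)
      finally show ?thesis .
    qed
    then show "cl_div q x = (\<Sum>i\<in>UNIV. pderiv_axis i (a' i) x + (b x + x $ i * pderiv_axis i b x))"
      by (simp add: cl_div_def)
  qed
  moreover have "(\<lambda>x. \<Sum>i\<in>UNIV. pderiv_axis i (a' i) x + (b x + x $ i * pderiv_axis i b x)) \<in> poly_space p"
    by (intro poly_space_sum poly_space_add pderiv_axis_poly_space coordinate_times_pderiv_axis_poly_space a' ab)
  ultimately show ?thesis
    by (simp only:)
qed

section \<open>Integration by parts against test fields\<close>

lemma test_function_component:
  "\<phi> \<in> test_functions S \<Longrightarrow> (\<lambda>x. \<phi> x $ i) \<in> test_functions S" for \<phi> :: vector_field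
  unfolding test_functions_def by (force intro: smooth_component)

lemma pderiv_axis_smooth_component:
  "smooth f \<Longrightarrow> pderiv_axis i f x $ j = pderiv_axis i (\<lambda>x. f x $ j) x"
  using pderiv_axis_component[OF smooth_imp_differentiable] by metis

lemma cl_grad_by_parts:
  assumes q: "smooth q" and t: "\<phi> \<in> test_functions T"
  shows "(LINT x|lebesgue. q x \<bullet> cl_div \<phi> x) = -1 * (LINT x|lebesgue. cl_grad q x \<bullet> \<phi> x)"
proof -
  note t' = test_function_component[OF t] and s = test_function_smooth[OF t]
  note ibp = integral_by_parts_axis[OF q t'] integral_by_parts_axis(3)[OF smooth_pderiv_axis[OF q] t']
  show ?thesis
    by (simp add: cl_div_def cl_grad_def inner_vec_def sum_3 pderiv_axis_smooth_component[OF s]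
        distrib_left ibp)
qed

lemma cl_div_by_parts:
  assumes q: "smooth q" and t: "\<phi> \<in> test_functions T"
  shows "(LINT x|lebesgue. q x \<bullet> cl_grad \<phi> x) = -1 * (LINT x|lebesgue. cl_div q x \<bullet> \<phi> x)"
proof -
  note q' = smooth_component[OF q]
  note ibp = integral_by_parts_axis[OF q' t] integral_by_parts_axis(3)[OF smooth_pderiv_axis[OF q'] t]
  show ?thesis
    by (simp add: cl_div_def cl_grad_def inner_vec_def sum_3 pderiv_axis_smooth_component[OF q]
        distrib_right ibp)
qed

lemma cl_curl_by_parts:
  assumes q: "smooth q" and t: "\<phi> \<in> test_functions T"
  shows "(LINT x|lebesgue. q x \<bullet> cl_curl \<phi> x) = 1 * (LINT x|lebesgue. cl_curl q x \<bullet> \<phi> x)"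
proof -
  note q' = smooth_component[OF q] and t' = test_function_component[OF t] and s = test_function_smooth[OF t]
  note ibp = integral_by_parts_axis[OF q' t'] integral_by_parts_axis(3)[OF smooth_pderiv_axis[OF q'] t']
  show ?thesis
    by (simp add: cl_curl_nth inner_vec_def sum_3 pderiv_axis_smooth_component[OF s]
        pderiv_axis_smooth_component[OF q] right_diff_distrib left_diff_distrib ibp)
qed

section \<open>Gradient, curl and divergence in the common frame\<close>

text \<open>Gradient and divergence are formally adjoint up to the sign -1, whereas the curl is its
  own formal adjoint; this fixes the values of \<open>s\<close>.\<close>

lemma weak_grad: "open \<Omega> \<Longrightarrow> bounded \<Omega> \<Longrightarrow> weak_derivative \<Omega> cl_div (- 1)"
  by unfold_locales (auto simp: cl_div_def pderiv_axis_zero_outside)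

lemma weak_curl: "open \<Omega> \<Longrightarrow> bounded \<Omega> \<Longrightarrow> weak_derivative \<Omega> cl_curl 1"
  by unfold_locales (auto simp: vec_eq_iff forall_3 cl_curl_nth pderiv_axis_zero_outside)

lemma weak_div: "open \<Omega> \<Longrightarrow> bounded \<Omega> \<Longrightarrow> weak_derivative \<Omega> cl_grad (- 1)"
  by unfold_locales (auto simp: vec_eq_iff cl_grad_def pderiv_axis_zero_outside)

lemma wd_grad_eqs:
  "V0 \<Omega> = wd_space \<Omega> cl_div (- 1)" "d0 \<Omega> = wd \<Omega> cl_div (- 1)" "tr0 \<Omega> = wd_trace \<Omega> cl_div (- 1)"
proof -
  have r: "has_weak_grad \<Omega> = wd_rel \<Omega> cl_div (- 1)"
    by (simp add: fun_eq_iff has_weak_grad_def wd_rel_def)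
  show "V0 \<Omega> = wd_space \<Omega> cl_div (- 1)" and d: "d0 \<Omega> = wd \<Omega> cl_div (- 1)"
    by (simp_all add: fun_eq_iff V0_def wd_space_def r d0_def wd_def)
  show "tr0 \<Omega> = wd_trace \<Omega> cl_div (- 1)"
    by (simp add: fun_eq_iff tr0_def wd_trace_def d add.commute)
qed

lemma wd_curl_eqs:
  "V1 \<Omega> = wd_space \<Omega> cl_curl 1" "d1 \<Omega> = wd \<Omega> cl_curl 1" "tr1 \<Omega> = wd_trace \<Omega> cl_curl 1"
proof -
  have r: "has_weak_curl \<Omega> = wd_rel \<Omega> cl_curl 1"
    by (simp add: fun_eq_iff has_weak_curl_def wd_rel_def)
  show "V1 \<Omega> = wd_space \<Omega> cl_curl 1" and d: "d1 \<Omega> = wd \<Omega> cl_curl 1"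
    by (simp_all add: fun_eq_iff V1_def wd_space_def r d1_def wd_def)
  show "tr1 \<Omega> = wd_trace \<Omega> cl_curl 1"
    by (simp add: fun_eq_iff tr1_def wd_trace_def d)
qed

lemma wd_div_eqs:
  "V2 \<Omega> = wd_space \<Omega> cl_grad (- 1)" "d2 \<Omega> = wd \<Omega> cl_grad (- 1)" "tr2 \<Omega> = wd_trace \<Omega> cl_grad (- 1)"
proof -
  have r: "has_weak_div \<Omega> = wd_rel \<Omega> cl_grad (- 1)"
    by (simp add: fun_eq_iff has_weak_div_def wd_rel_def)
  show "V2 \<Omega> = wd_space \<Omega> cl_grad (- 1)" and d: "d2 \<Omega> = wd \<Omega> cl_grad (- 1)"
    by (simp_all add: fun_eq_iff V2_def wd_space_def r d2_def wd_def)
  show "tr2 \<Omega> = wd_trace \<Omega> cl_grad (- 1)"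
    by (simp add: fun_eq_iff tr2_def wd_trace_def d)
qed

lemma grad_curl_complex: "open \<Omega> \<Longrightarrow> bounded \<Omega> \<Longrightarrow> weak_complex \<Omega> cl_div (- 1) cl_curl 1"
  by (simp add: weak_complex_def weak_grad weak_curl weak_complex_axioms_def cl_div_cl_curl)

lemma curl_div_complex: "open \<Omega> \<Longrightarrow> bounded \<Omega> \<Longrightarrow> weak_complex \<Omega> cl_curl 1 cl_grad (- 1)"
  by (simp add: weak_complex_def weak_curl weak_div weak_complex_axioms_def cl_curl_cl_grad)

section \<open>Meshes and overlap of patches\<close>

text \<open>A point of the frontier has points strictly above the local graph arbitrarily close to
  it, and those lie outside the closure. The equation places interiors of cells and patches inside
  the domain; it would fail for a domain with a slit.\<close>

lemma interior_closure_lipschitz: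
  assumes "open \<Omega>" "lipschitz_boundary \<Omega>"
  shows "interior (closure \<Omega>) = \<Omega>"
proof (rule antisym)
  show "\<Omega> \<subseteq> interior (closure \<Omega>)"
    using assms(1) by (simp add: closure_subset interior_maximal)
  show "interior (closure \<Omega>) \<subseteq> \<Omega>"
  proof (rule ccontr)
    assume "\<not> interior (closure \<Omega>) \<subseteq> \<Omega>"
    then obtain x where x: "x \<in> interior (closure \<Omega>)" "x \<notin> \<Omega>" by auto
    then have fr: "x \<in> frontier \<Omega>"
      using assms(1) interior_subset by (auto simp: frontier_def interior_open)
    then obtain U e L f where U: "open U" "x \<in> U" "norm e = 1" "L-lipschitz_on UNIV (f :: R3 \<Rightarrow> real)"
      and graph: "\<Omega> \<inter> U = {y \<in> U. y \<bullet> e < f (y - (y \<bullet> e) *\<^sub>R e)}"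
      using bspec[OF assms(2)[unfolded lipschitz_boundary_def] fr] that by (elim exE conjE)
    define N where "N = U \<inter> interior (closure \<Omega>)"
    have N: "open N" "x \<in> N" using U x by (auto simp: N_def)
    have ge: "f (x - (x \<bullet> e) *\<^sub>R e) \<le> x \<bullet> e"
    proof (rule ccontr)
      assume "\<not> f (x - (x \<bullet> e) *\<^sub>R e) \<le> x \<bullet> e"
      then have "x \<in> \<Omega> \<inter> U" unfolding graph using U(2) by simp
      then show False using x(2) by simp
    qed
    obtain r where r: "r > 0" "ball x r \<subseteq> N" using N by (meson openE)
    define y where "y = x + (r / 2) *\<^sub>R e"
    have ee: "e \<bullet> e = 1" using U(3) by (simp add: norm_eq_1)
    have "y \<in> ball x r" using r(1) U(3) by (simp add: y_def dist_norm)
    then have "y \<in> N" using r(2) by auto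
    \<comment> \<open>Moving along the unit vector \<open>e\<close> leaves the coordinates
      orthogonal to \<open>e\<close> unchanged and only raises the height, hence \<open>y\<close>
      lies strictly above the graph.\<close>
    have "y - (y \<bullet> e) *\<^sub>R e = x - (x \<bullet> e) *\<^sub>R e" "y \<bullet> e = x \<bullet> e + r / 2"
      by (simp_all add: y_def inner_add_left ee scaleR_add_left)
    then have gt: "y \<bullet> e > f (y - (y \<bullet> e) *\<^sub>R e)" using ge r(1) by simp
    define W where "W = N \<inter> {y. f (y - (y \<bullet> e) *\<^sub>R e) < y \<bullet> e}"
    have "continuous_on UNIV (\<lambda>y. f (y - (y \<bullet> e) *\<^sub>R e))"
      by (rule continuous_on_compose2[OF lipschitz_on_continuous_on[OF U(4)]]) (auto intro!: continuous_intros)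
    then have "open W"
      unfolding W_def using N(1) by (intro open_Int open_Collect_less) (auto intro!: continuous_intros)
    moreover have "y \<in> W" using gt \<open>y \<in> N\<close> by (simp add: W_def)
    moreover have "y \<in> closure \<Omega>" using \<open>y \<in> N\<close> interior_subset by (auto simp: N_def)
    ultimately obtain z where "z \<in> W" "z \<in> \<Omega>"
      using open_Int_closure_eq_empty[of W \<Omega>] by blast
    then have "z \<in> \<Omega> \<inter> U" "f (z - (z \<bullet> e) *\<^sub>R e) < z \<bullet> e" by (auto simp: W_def N_def)
    then show False using graph by auto
  qed
qed

section \<open>Cells and patches of a mesh\<close>

locale mesh =
  fixes \<Omega> :: "R3 set" and \<T> :: "R3 set set"
  assumes domain: "lipschitz_polyhedral_domain \<Omega>" and mesh: "simplicial_mesh \<Omega> \<T>"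
begin

lemma open_\<Omega>: "open \<Omega>" and bounded_\<Omega>: "bounded \<Omega>"
  and interior_closure_\<Omega>: "interior (closure \<Omega>) = \<Omega>"
  using domain interior_closure_lipschitz by (auto simp: lipschitz_polyhedral_domain_def)

lemma sets_\<Omega>: "\<Omega> \<in> sets lebesgue"
  using open_\<Omega> by auto

lemma finite_\<T>: "finite \<T>" and Union_\<T>: "\<Union>\<T> = closure \<Omega>"
  and simplex_\<T>: "\<tau> \<in> \<T> \<Longrightarrow> 3 simplex \<tau>"
  and Int_face: "\<tau> \<in> \<T> \<Longrightarrow> \<tau>' \<in> \<T> \<Longrightarrow> (\<tau> \<inter> \<tau>') face_of \<tau>"
  using mesh by (auto simp: simplicial_mesh_def triangulation_def)

lemma convex_cell: "\<tau> \<in> \<T> \<Longrightarrow> convex \<tau>" and compact_cell: "\<tau> \<in> \<T> \<Longrightarrow> compact \<tau>"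
  using simplex_\<T> convex_simplex compact_simplex by blast+

lemma interior_cell: "\<tau> \<in> \<T> \<Longrightarrow> interior \<tau> \<noteq> {}"
proof -
  assume "\<tau> \<in> \<T>"
  then have "aff_dim \<tau> = 3" "convex \<tau>" using simplex_\<T> aff_dim_simplex convex_cell by blast+
  then have "interior \<tau> = rel_interior \<tau>" "\<tau> \<noteq> {}" by (auto simp: interior_rel_interior_gen)
  then show ?thesis
    using rel_interior_eq_empty[OF \<open>convex \<tau>\<close>] by simp
qed

lemma cell_subset: "\<tau> \<in> \<T> \<Longrightarrow> \<tau> \<subseteq> closure \<Omega>"
  using Union_\<T> by auto

lemma interior_cell_subset: "\<tau> \<in> \<T> \<Longrightarrow> interior \<tau> \<subseteq> \<Omega>"
  using interior_mono[OF cell_subset] interior_closure_\<Omega> by auto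

text \<open>The intersection is a face of both cells, and a face that meets the interior is the
  whole cell.\<close>

lemma interior_cells_disjoint:
  assumes "\<tau> \<in> \<T>" "\<tau>' \<in> \<T>" "interior \<tau> \<inter> interior \<tau>' \<noteq> {}"
  shows "\<tau> = \<tau>'"
proof -
  have "(\<tau> \<inter> \<tau>') \<inter> interior \<tau> \<noteq> {}" "(\<tau>' \<inter> \<tau>) \<inter> interior \<tau>' \<noteq> {}"
    using assms(3) interior_subset by blast+
  then have "\<tau> \<inter> \<tau>' = \<tau>" "\<tau>' \<inter> \<tau> = \<tau>'"
    using face_of_disjoint_interior Int_face assms(1,2) by metis+
  then show ?thesis by auto
qed

lemma es_subset: "es \<T> (Suc k) \<tau> \<subseteq> \<Omega>" and open_es: "open (es \<T> (Suc k) \<tau>)"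
proof -
  have "\<Union>{\<tau>' \<in> \<T>. \<tau>' \<inter> closure (es \<T> k \<tau>) \<noteq> {}} \<subseteq> closure \<Omega>"
    using Union_\<T> by auto
  from interior_mono[OF this] show "es \<T> (Suc k) \<tau> \<subseteq> \<Omega>"
    using interior_closure_\<Omega> by simp
qed simp

definition touching :: "R3 set \<Rightarrow> R3 set set" where
  "touching \<tau> = {\<tau>' \<in> \<T>. \<tau>' \<inter> \<tau> \<noteq> {}}"

text \<open>A combinatorial stand-in for \<open>es \<T> 2 \<tau>\<close>: a set of cells can be
  counted, and membership in it is a symmetric relation between cells.\<close>

definition patch2 :: "R3 set \<Rightarrow> R3 set set" where
  "patch2 \<tau> = (\<Union>\<tau>'\<in>touching \<tau>. touching \<tau>')"

lemma touching_subset: "touching \<tau> \<subseteq> \<T>" and patch2_subset: "patch2 \<tau> \<subseteq> \<T>"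
  by (auto simp: touching_def patch2_def)

lemma touching_sym: "\<tau> \<in> \<T> \<Longrightarrow> \<tau>' \<in> touching \<tau> \<Longrightarrow> \<tau> \<in> touching \<tau>'"
  by (auto simp: touching_def)

lemma patch2_sym: "\<tau> \<in> \<T> \<Longrightarrow> \<tau>' \<in> patch2 \<tau> \<Longrightarrow> \<tau> \<in> patch2 \<tau>'"
  unfolding patch2_def using touching_sym touching_subset by blast

text \<open>The finite union of the cells touching \<open>\<tau>\<close> is closed, so taking the
  closure of the first patch does not leave it.\<close>

lemma es2_subset_patch2:
  assumes "\<tau> \<in> \<T>"
  shows "es \<T> 2 \<tau> \<subseteq> \<Union>(patch2 \<tau>)"
proof -
  have c: "closure \<tau> = \<tau>" using compact_cell[OF assms] compact_imp_closed closure_closed by blast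
  have fin: "finite (touching \<tau>)" using finite_\<T> touching_subset finite_subset by blast
  have "es \<T> 1 \<tau> \<subseteq> \<Union>(touching \<tau>)"
    using interior_subset by (auto simp: touching_def c)
  moreover have "closed (\<Union>(touching \<tau>))"
    using fin touching_subset compact_cell compact_imp_closed by (intro closed_Union) auto
  ultimately have "closure (es \<T> 1 \<tau>) \<subseteq> \<Union>(touching \<tau>)"
    by (rule closure_minimal)
  then have "{\<tau>' \<in> \<T>. \<tau>' \<inter> closure (es \<T> 1 \<tau>) \<noteq> {}} \<subseteq> patch2 \<tau>"
    unfolding patch2_def touching_def by blast
  then have "interior (\<Union>{\<tau>' \<in> \<T>. \<tau>' \<inter> closure (es \<T> 1 \<tau>) \<noteq> {}}) \<subseteq> \<Union>(patch2 \<tau>)"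
    by (rule order_trans[OF interior_subset Union_mono])
  moreover have "es \<T> 2 \<tau> = interior (\<Union>{\<tau>' \<in> \<T>. \<tau>' \<inter> closure (es \<T> 1 \<tau>) \<noteq> {}})"
    by (simp add: numeral_2_eq_2)
  ultimately show ?thesis
    by simp
qed

section \<open>Bounded overlap by volume counting\<close>

lemma diameter_cell_pos: "\<tau> \<in> \<T> \<Longrightarrow> 0 < diameter \<tau>"
  and diameter_cell_le: "\<tau> \<in> \<T> \<Longrightarrow> diameter \<tau> \<le> diameter \<Omega>"
proof -
  assume t: "\<tau> \<in> \<T>"
  obtain c r where "r > 0" "cball c r \<subseteq> \<tau>"
    using interior_cell[OF t] by (auto simp: mem_interior_cball)
  then show "0 < diameter \<tau>"
    using diameter_subset[of "cball c r" \<tau>] compact_imp_bounded[OF compact_cell[OF t]] by simp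
  show "diameter \<tau> \<le> diameter \<Omega>"
    using diameter_subset[OF cell_subset[OF t]] bounded_\<Omega> by (simp add: diameter_closure bounded_closure)
qed

text \<open>The supremum in \<open>inball_diameter\<close> need not be known to be attained. A ball
  with more than half of that diameter is taken instead, which turns the factor 2 between diameter
  and radius into 4.\<close>

lemma inscribed_ball:
  assumes t: "\<tau> \<in> \<T>"
  obtains c r where "cball c r \<subseteq> \<tau>" "diameter \<tau> \<le> 4 * shape_regularity \<T> * r" "r > 0"
proof -
  let ?R = "{2 * r |r. 0 \<le> r \<and> (\<exists>c. cball c r \<subseteq> \<tau>)}"
  have "bdd_above ?R"
  proof (rule bdd_aboveI)
    fix x assume "x \<in> ?R"
    then obtain r c where "x = 2 * r" "0 \<le> r" "cball c r \<subseteq> \<tau>" by auto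
    then show "x \<le> diameter \<tau>"
      using diameter_subset[of "cball c r" \<tau>] compact_imp_bounded[OF compact_cell[OF t]] by simp
  qed
  obtain c0 r0 where "r0 > 0" "cball c0 r0 \<subseteq> \<tau>"
    using interior_cell[OF t] by (auto simp: mem_interior_cball)
  then have "2 * r0 \<in> ?R" by (auto intro: less_imp_le)
  then have "2 * r0 \<le> inball_diameter \<tau>"
    unfolding inball_diameter_def using \<open>bdd_above ?R\<close> by (rule cSup_upper)
  then have pos: "inball_diameter \<tau> > 0" using \<open>r0 > 0\<close> by simp
  then have "inball_diameter \<tau> / 2 < Sup ?R" by (simp add: inball_diameter_def)
  then obtain y where "y \<in> ?R" "inball_diameter \<tau> / 2 < y"
    using less_cSup_iff[of ?R] \<open>2 * r0 \<in> ?R\<close> \<open>bdd_above ?R\<close> by blast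
  then obtain c r where r: "cball c r \<subseteq> \<tau>" "inball_diameter \<tau> / 2 < 2 * r" by auto
  have "diameter \<tau> / inball_diameter \<tau> \<le> shape_regularity \<T>"
    unfolding shape_regularity_def using finite_\<T> t by (intro Max_ge) auto
  then have le: "diameter \<tau> \<le> shape_regularity \<T> * inball_diameter \<tau>"
    using pos by (simp add: divide_le_eq)
  then have "0 < shape_regularity \<T>"
    using diameter_cell_pos[OF t] pos by (smt (verit) mult_nonpos_nonneg)
  then have "shape_regularity \<T> * inball_diameter \<tau> \<le> shape_regularity \<T> * (4 * r)"
    using r(2) by (intro mult_left_mono) auto
  with le show thesis
    using r pos by (intro that[of c r]) auto
qed

text \<open>Shrinking the cells at \<open>v\<close> towards \<open>v\<close> to a common size produces disjoint balls of comparable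
  radius around \<open>v\<close>. This bounds the number of cells at \<open>v\<close> without comparing sizes of neighbours.\<close>

lemma card_cells_at_point:
  assumes "\<tau>0 \<in> \<T>" "v \<in> \<tau>0"
  shows "real (card {\<tau> \<in> \<T>. v \<in> \<tau>}) \<le> (4 * shape_regularity \<T>) ^ 3"
proof -
  let ?S = "{\<tau> \<in> \<T>. v \<in> \<tau>}" and ?\<rho> = "shape_regularity \<T>"
  have fin: "finite ?S" using finite_\<T> by auto
  have \<tau>0: "\<tau>0 \<in> ?S" using assms by simp
  then have ne: "?S \<noteq> {}" by blast
  \<comment> \<open>Cells at \<open>v\<close> are scaled to the smallest of their diameters; the
    scale factors are then at most 1, so by convexity the shrunken cells stay inside the original
    ones.\<close>
  define \<epsilon> where "\<epsilon> = Min (diameter ` ?S)"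
  have \<epsilon>: "0 < \<epsilon>" "\<And>\<tau>. \<tau> \<in> ?S \<Longrightarrow> \<epsilon> \<le> diameter \<tau>"
    unfolding \<epsilon>_def using fin ne diameter_cell_pos by auto
  have "\<forall>\<tau>\<in>?S. \<exists>p. cball (fst p) (snd p) \<subseteq> \<tau> \<and> diameter \<tau> \<le> 4 * ?\<rho> * snd p \<and> snd p > 0"
  proof
    fix \<tau> assume "\<tau> \<in> ?S"
    then obtain c r where "cball c r \<subseteq> \<tau>" "diameter \<tau> \<le> 4 * ?\<rho> * r" "r > 0"
      using inscribed_ball[of \<tau>] by blast
    then show "\<exists>p. cball (fst p) (snd p) \<subseteq> \<tau> \<and> diameter \<tau> \<le> 4 * ?\<rho> * snd p \<and> snd p > 0"
      by (intro exI[of _ "(c, r)"]) simp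
  qed
  from bchoice[OF this] obtain p where
    p: "\<forall>\<tau>\<in>?S. cball (fst (p \<tau>)) (snd (p \<tau>)) \<subseteq> \<tau> \<and> diameter \<tau> \<le> 4 * ?\<rho> * snd (p \<tau>) \<and> snd (p \<tau>) > 0" ..
  define c r where "c \<tau> = fst (p \<tau>)" and "r \<tau> = snd (p \<tau>)" for \<tau>
  have cr: "cball (c \<tau>) (r \<tau>) \<subseteq> \<tau>" "diameter \<tau> \<le> 4 * ?\<rho> * r \<tau>" "r \<tau> > 0" if "\<tau> \<in> ?S" for \<tau>
    using bspec[OF p that] by (simp_all add: c_def r_def)
  have \<rho>: "?\<rho> > 0"
    using \<tau>0 cr(2,3)[of \<tau>0] diameter_cell_pos[of \<tau>0] by (smt (verit) mem_Collect_eq mult_nonpos_nonneg)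
  \<comment> \<open>Each cell contains a ball of radius at least
    \<open>diameter \<tau> / (4 * ?\<rho>)\<close>; after scaling to diameter
    \<open>\<epsilon>\<close> this lower bound is \<open>\<delta>\<close> for all cells
    alike.\<close>
  define \<delta> where "\<delta> = \<epsilon> / (4 * ?\<rho>)"
  have \<delta>: "\<delta> > 0" using \<epsilon> \<rho> by (simp add: \<delta>_def)
  define s where "s \<tau> = \<epsilon> / diameter \<tau>" for \<tau> :: "R3 set"
  define B where "B \<tau> = ball (v + s \<tau> *\<^sub>R (c \<tau> - v)) \<delta>" for \<tau>
  have B: "B \<tau> \<subseteq> interior \<tau>" "B \<tau> \<subseteq> cball v \<epsilon>" if t: "\<tau> \<in> ?S" for \<tau>
  proof -
    have d: "diameter \<tau> > 0" using t diameter_cell_pos by auto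
    have s: "0 < s \<tau>" "s \<tau> \<le> 1" using \<epsilon> t d by (auto simp: s_def divide_le_eq)
    have "\<delta> \<le> s \<tau> * r \<tau>"
    proof -
      have "\<delta> * diameter \<tau> \<le> \<delta> * (4 * ?\<rho> * r \<tau>)"
        using cr(2)[OF t] \<delta> by (intro mult_left_mono) auto
      also have "\<dots> = \<epsilon> * r \<tau>" using \<rho> by (simp add: \<delta>_def)
      finally show ?thesis using d by (simp add: s_def field_simps)
    qed
    have *: "y \<in> \<tau> \<and> dist v y \<le> \<epsilon>" if "y \<in> B \<tau>" for y
    proof -
      \<comment> \<open>Undo the shrinking: \<open>y\<close> lies on the segment from
        \<open>v\<close> to \<open>z\<close>, and \<open>z\<close> will be found in the inscribed
        ball.\<close>
      define z where "z = v + (1 / s \<tau>) *\<^sub>R (y - v)"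
      have y: "y = v + s \<tau> *\<^sub>R (z - v)" using s by (simp add: z_def)
      have "s \<tau> * dist (c \<tau>) z = dist (v + s \<tau> *\<^sub>R (c \<tau> - v)) y"
      proof -
        have "(v + s \<tau> *\<^sub>R (c \<tau> - v)) - y = s \<tau> *\<^sub>R (c \<tau> - z)"
          by (simp add: y scaleR_diff_right)
        then show ?thesis using s by (simp add: dist_norm)
      qed
      also have "\<dots> < \<delta>" using that by (simp add: B_def)
      finally have "s \<tau> * dist (c \<tau>) z < s \<tau> * r \<tau>" using \<open>\<delta> \<le> s \<tau> * r \<tau>\<close> by simp
      then have "z \<in> cball (c \<tau>) (r \<tau>)" using s by simp
      then have z: "z \<in> \<tau>" using cr(1)[OF t] by auto
      have "(1 - s \<tau>) *\<^sub>R v + s \<tau> *\<^sub>R z \<in> \<tau>"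
        using s z t convex_cell by (intro convexD_alt) auto
      moreover have "(1 - s \<tau>) *\<^sub>R v + s \<tau> *\<^sub>R z = y"
        by (simp add: y algebra_simps)
      moreover have "dist v y = s \<tau> * dist v z"
        using s by (simp add: y dist_norm norm_minus_commute)
      moreover have "dist v z \<le> diameter \<tau>"
        using t z compact_imp_bounded[OF compact_cell] by (intro diameter_bounded_bound) auto
      then have "s \<tau> * dist v z \<le> \<epsilon>"
        using d \<epsilon> by (simp add: s_def field_simps mult_left_mono)
      ultimately show ?thesis by simp
    qed
    then show "B \<tau> \<subseteq> cball v \<epsilon>" by auto
    show "B \<tau> \<subseteq> interior \<tau>"
      using * by (intro interior_maximal) (auto simp: B_def)
  qed
  have disj: "B \<tau> \<inter> B \<tau>' = {}" if "\<tau> \<in> ?S" "\<tau>' \<in> ?S" "\<tau> \<noteq> \<tau>'" for \<tau> \<tau>'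
    using interior_cells_disjoint[of \<tau> \<tau>'] that B(1)[OF that(1)] B(1)[OF that(2)] by blast
  let ?\<omega> = "measure lborel (ball (0 :: R3) 1)"
  have ball: "measure lborel (ball a t) = t ^ 3 * ?\<omega>" if "t \<ge> 0" for a :: R3 and t
    using content_ball_conv_unit_ball[OF that, of a] by simp
  have mB: "measure lebesgue (B \<tau>) = \<delta> ^ 3 * ?\<omega>" for \<tau>
    unfolding B_def using \<delta> by (simp add: ball[of \<delta>])
  \<comment> \<open>Volume comparison: the disjoint balls of radius \<open>\<delta>\<close> all lie
    in the ball of radius \<open>\<epsilon>\<close> around \<open>v\<close>.\<close>
  have "real (card ?S) * (\<delta> ^ 3 * ?\<omega>) = (\<Sum>\<tau>\<in>?S. measure lebesgue (B \<tau>))"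
    by (simp add: mB)
  also have "\<dots> = measure lebesgue (\<Union>(B ` ?S))"
  proof (rule measure_negligible_finite_Union_image[symmetric, OF fin])
    show "B \<tau> \<in> lmeasurable" for \<tau>
      by (simp add: B_def)
    show "pairwise (\<lambda>\<tau> \<tau>'. negligible (B \<tau> \<inter> B \<tau>')) ?S"
    proof (rule pairwiseI)
      fix \<tau> \<tau>' assume "\<tau> \<in> ?S" "\<tau>' \<in> ?S" "\<tau> \<noteq> \<tau>'"
      from disj[OF this] show "negligible (B \<tau> \<inter> B \<tau>')" by simp
    qed
  qed
  also have "\<dots> \<le> measure lebesgue (cball v \<epsilon>)"
    using B(2) fin by (intro measure_mono_fmeasurable) (auto simp: B_def)
  also have "\<dots> = \<epsilon> ^ 3 * ?\<omega>"
    using ball[of \<epsilon> v] \<epsilon>(1) content_cball_conv_ball[of v \<epsilon>] by simp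
  finally have "real (card ?S) * \<delta> ^ 3 * ?\<omega> \<le> \<epsilon> ^ 3 * ?\<omega>" by (simp add: mult.assoc)
  then have "real (card ?S) * \<delta> ^ 3 \<le> \<epsilon> ^ 3"
    using content_ball_pos[of 1 "0 :: R3"] by simp
  also have "\<epsilon> ^ 3 = (4 * ?\<rho>) ^ 3 * \<delta> ^ 3"
    using \<rho> by (simp add: \<delta>_def power_divide power_mult_distrib)
  finally show ?thesis
    using \<delta> by simp
qed

text \<open>A nonempty intersection of two cells is a face, hence the hull of some vertices of
  \<open>\<tau>\<close>. Touching cells thus share a vertex, and the factor 4 counts the vertices of
  a tetrahedron.\<close>

lemma card_touching:
  assumes t: "\<tau> \<in> \<T>"
  shows "real (card (touching \<tau>)) \<le> 4 * (4 * shape_regularity \<T>) ^ 3"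
proof -
  obtain C where C: "finite C" "card C = 4" "\<tau> = convex hull C"
    using simplex_\<T>[OF t] by (auto simp: simplex)
  have "touching \<tau> \<subseteq> (\<Union>v\<in>C. {\<tau>' \<in> \<T>. v \<in> \<tau>'})"
  proof
    fix \<tau>' assume "\<tau>' \<in> touching \<tau>"
    then have t': "\<tau>' \<in> \<T>" "\<tau> \<inter> \<tau>' \<noteq> {}" by (auto simp: touching_def)
    obtain S' where S': "S' \<subseteq> C" "\<tau> \<inter> \<tau>' = convex hull S'"
      using face_of_convex_hull_subset[of C "\<tau> \<inter> \<tau>'"] Int_face[OF t t'(1)] C finite_imp_compact by metis
    then obtain v where "v \<in> S'" using t'(2) by fastforce
    then have "v \<in> C" "v \<in> \<tau>'" using S' hull_subset[of S' convex] by auto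
    then show "\<tau>' \<in> (\<Union>v\<in>C. {\<tau>' \<in> \<T>. v \<in> \<tau>'})" using t' by auto
  qed
  then have "card (touching \<tau>) \<le> card (\<Union>v\<in>C. {\<tau>' \<in> \<T>. v \<in> \<tau>'})"
    using C finite_\<T> by (intro card_mono) auto
  also have "\<dots> \<le> (\<Sum>v\<in>C. card {\<tau>' \<in> \<T>. v \<in> \<tau>'})"
    by (rule card_UN_le[OF C(1)])
  finally have "real (card (touching \<tau>)) \<le> real (\<Sum>v\<in>C. card {\<tau>' \<in> \<T>. v \<in> \<tau>'})"
    by (rule of_nat_mono)
  also have "\<dots> = (\<Sum>v\<in>C. real (card {\<tau>' \<in> \<T>. v \<in> \<tau>'}))"
    by simp
  also have "\<dots> \<le> (\<Sum>v\<in>C. (4 * shape_regularity \<T>) ^ 3)"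
    using t C hull_subset[of C convex] by (intro sum_mono card_cells_at_point[OF t]) auto
  finally show ?thesis using C by simp
qed

lemma card_patch2:
  assumes t: "\<tau> \<in> \<T>"
  shows "real (card (patch2 \<tau>)) \<le> (4 * (4 * shape_regularity \<T>) ^ 3)\<^sup>2"
proof -
  let ?N = "4 * (4 * shape_regularity \<T>) ^ 3"
  have N: "0 \<le> ?N" using card_touching[OF t] by linarith
  have fin: "finite (touching \<tau>)" using finite_\<T> touching_subset finite_subset by blast
  have "real (card (patch2 \<tau>)) \<le> real (\<Sum>\<tau>'\<in>touching \<tau>. card (touching \<tau>'))"
    unfolding patch2_def by (intro of_nat_mono card_UN_le fin)
  also have "\<dots> = (\<Sum>\<tau>'\<in>touching \<tau>. real (card (touching \<tau>')))"
    by simp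
  also have "\<dots> \<le> (\<Sum>\<tau>'\<in>touching \<tau>. ?N)"
    using touching_subset by (intro sum_mono card_touching) auto
  also have "\<dots> = real (card (touching \<tau>)) * ?N" by simp
  also have "\<dots> \<le> ?N * ?N"
    by (rule mult_right_mono[OF card_touching[OF t] N])
  finally show ?thesis by (simp add: power2_eq_square)
qed

section \<open>Comparing norms on cells, patches and the domain\<close>

text \<open>Local norms become integrals of one fixed function times an indicator, so that comparing
  sums of norms amounts to comparing sums of indicators.\<close>

lemma L2_sq_eq_integral:
  fixes f :: "R3 \<Rightarrow> 'b::euclidean_space"
  assumes "S \<subseteq> \<Omega>" "S \<in> sets lebesgue"
  shows "L2_sq S f = (LINT x|lebesgue. indicator S x * (indicator \<Omega> x * (norm (f x))\<^sup>2))"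
proof -
  have "L2_sq S f = (LINT x|lebesgue. indicator S x *\<^sub>R (norm (f x))\<^sup>2)"
    unfolding L2_sq_def using assms(2) by (intro integral_restrict_space) auto
  also have "\<dots> = (LINT x|lebesgue. indicator S x * (indicator \<Omega> x * (norm (f x))\<^sup>2))"
    using assms(1) by (intro Bochner_Integration.integral_cong) (auto simp: indicator_def)
  finally show ?thesis .
qed

lemma negligible_outside_interior: "\<tau> \<in> \<T> \<Longrightarrow> negligible (\<tau> - interior \<tau>)"
  using negligible_convex_frontier[OF convex_cell] closure_subset
  by (auto simp: frontier_def intro: negligible_subset)

lemma sets_cell: "\<tau> \<in> \<T> \<Longrightarrow> \<tau> \<in> sets lebesgue"
  using compact_cell by (simp add: compact_imp_closed)

lemma AE_interior_cells: "AE x in lebesgue. \<forall>\<tau>\<in>\<T>. x \<in> \<tau> \<longrightarrow> x \<in> interior \<tau>"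
proof -
  have "negligible (\<Union>\<tau>\<in>\<T>. \<tau> - interior \<tau>)"
    using finite_\<T> negligible_outside_interior by (intro negligible_Union) auto
  then have "AE x in lebesgue. x \<notin> (\<Union>\<tau>\<in>\<T>. \<tau> - interior \<tau>)"
    by (intro AE_not_in) (simp only: negligible_iff_null_sets)
  then show ?thesis by eventually_elim auto
qed

text \<open>\<open>f\<close> is controlled only on the open domain, while a closed cell may reach
  its frontier. The part of the cell outside its interior is null, so cutting off at the domain
  changes nothing.\<close>

lemma L2_sq_cell_eq_integral:
  fixes f :: "R3 \<Rightarrow> 'b::euclidean_space"
  assumes f: "f \<in> L2 \<Omega>" and t: "\<tau> \<in> \<T>"
  shows "L2_sq \<tau> f = (LINT x|lebesgue. indicator \<tau> x * (indicator \<Omega> x * (norm (f x))\<^sup>2))"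
proof -
  let ?g = "\<lambda>x. indicator \<tau> x * (indicator \<Omega> x * (norm (f x))\<^sup>2)"
  have "L2_sq \<tau> f = (LINT x|lebesgue. indicator \<tau> x *\<^sub>R (norm (f x))\<^sup>2)"
    unfolding L2_sq_def using sets_cell[OF t] by (intro integral_restrict_space) auto
  also have "\<dots> = (LINT x|lebesgue. ?g x)"
  proof (rule integral_cong_AE)
    have "integrable lebesgue (\<lambda>x. indicator \<Omega> x *\<^sub>R (norm (f x))\<^sup>2)"
      using f sets_\<Omega> by (simp add: L2_def integrable_restrict_space)
    then have "integrable lebesgue (\<lambda>x. indicator \<tau> x *\<^sub>R (indicator \<Omega> x *\<^sub>R (norm (f x))\<^sup>2))"
      by (rule integrable_mult_indicator[OF sets_cell[OF t]])
    then show m: "?g \<in> borel_measurable lebesgue" by simp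
    show ae: "AE x in lebesgue. indicator \<tau> x *\<^sub>R (norm (f x))\<^sup>2 = ?g x"
      using AE_interior_cells
    proof eventually_elim
      case (elim x)
      then show ?case using interior_cell_subset[OF t] t by (auto simp: indicator_def)
    qed
    \<comment> \<open>No measurability of \<open>f\<close> off the domain is given; it is
      transferred across the null set by completeness of Lebesgue measure.\<close>
    show "(\<lambda>x. indicator \<tau> x *\<^sub>R (norm (f x))\<^sup>2) \<in> borel_measurable lebesgue"
      using m by (rule borel_measurable_AE) (use ae in \<open>auto elim: eventually_mono\<close>)
  qed
  finally show ?thesis .
qed

lemma integrable_indicator_L2:
  fixes f :: "R3 \<Rightarrow> 'b::euclidean_space"
  assumes f: "f \<in> L2 \<Omega>" and S: "S \<in> sets lebesgue"
  shows "integrable lebesgue (\<lambda>x. indicator S x * (indicator \<Omega> x * (norm (f x))\<^sup>2))"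
proof -
  have "integrable lebesgue (\<lambda>x. indicator \<Omega> x *\<^sub>R (norm (f x))\<^sup>2)"
    using f sets_\<Omega> by (simp add: L2_def integrable_restrict_space)
  from integrable_mult_indicator[OF S this] show ?thesis by simp
qed

lemma L2_sq_le_sum_cells:
  fixes f :: "R3 \<Rightarrow> 'b::euclidean_space"
  assumes f: "f \<in> L2 \<Omega>" and S: "S \<subseteq> \<Omega>" "S \<in> sets lebesgue" and P: "P \<subseteq> \<T>" "S \<subseteq> \<Union>P"
  shows "L2_sq S f \<le> (\<Sum>\<tau>\<in>P. L2_sq \<tau> f)"
proof -
  let ?g = "\<lambda>x. indicator \<Omega> x * (norm (f x))\<^sup>2"
  have fin: "finite P" using P(1) finite_\<T> finite_subset by blast
  have i: "integrable lebesgue (\<lambda>x. indicator \<tau> x * ?g x)" if "\<tau> \<in> P" for \<tau>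
    using that P(1) sets_cell by (intro integrable_indicator_L2 f) auto
  have "L2_sq S f = (LINT x|lebesgue. indicator S x * ?g x)"
    by (rule L2_sq_eq_integral[OF S])
  also have "\<dots> \<le> (LINT x|lebesgue. (\<Sum>\<tau>\<in>P. indicator \<tau> x * ?g x))"
  proof (rule integral_mono)
    fix x
    have "indicator S x \<le> (\<Sum>\<tau>\<in>P. indicator \<tau> x :: real)"
    proof (cases "x \<in> S")
      case True
      then obtain \<tau> where "\<tau> \<in> P" "x \<in> \<tau>" using P(2) by auto
      then show ?thesis
        using member_le_sum[of \<tau> P "\<lambda>\<tau>. indicator \<tau> x :: real"] fin by (simp add: indicator_def)
    qed (simp add: sum_nonneg)
    then have "indicator S x * ?g x \<le> (\<Sum>\<tau>\<in>P. indicator \<tau> x) * ?g x"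
      by (rule mult_right_mono) simp
    then show "indicator S x * ?g x \<le> (\<Sum>\<tau>\<in>P. indicator \<tau> x * ?g x)"
      by (simp only: sum_distrib_right)
  qed (use i integrable_indicator_L2[OF f S(2)] in auto)
  also have "\<dots> = (\<Sum>\<tau>\<in>P. (LINT x|lebesgue. indicator \<tau> x * ?g x))"
    using i by (rule Bochner_Integration.integral_sum)
  also have "\<dots> = (\<Sum>\<tau>\<in>P. L2_sq \<tau> f)"
    using P(1) by (intro sum.cong refl L2_sq_cell_eq_integral[OF f, symmetric]) auto
  finally show ?thesis .
qed

text \<open>Almost every point lies in the interior of each cell that contains it, hence in at most
  one cell.\<close>

lemma sum_cells_le_L2_sq:
  fixes f :: "R3 \<Rightarrow> 'b::euclidean_space"
  assumes f: "f \<in> L2 \<Omega>"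
  shows "(\<Sum>\<tau>\<in>\<T>. L2_sq \<tau> f) \<le> L2_sq \<Omega> f"
proof -
  let ?g = "\<lambda>x. indicator \<Omega> x * (norm (f x))\<^sup>2"
  have i: "integrable lebesgue (\<lambda>x. indicator \<tau> x * ?g x)" if "\<tau> \<in> \<T>" for \<tau>
    using that sets_cell by (intro integrable_indicator_L2 f) auto
  have "(\<Sum>\<tau>\<in>\<T>. L2_sq \<tau> f) = (\<Sum>\<tau>\<in>\<T>. (LINT x|lebesgue. indicator \<tau> x * ?g x))"
    by (intro sum.cong refl L2_sq_cell_eq_integral[OF f])
  also have "\<dots> = (LINT x|lebesgue. (\<Sum>\<tau>\<in>\<T>. indicator \<tau> x * ?g x))"
    using i by (rule Bochner_Integration.integral_sum[symmetric])
  also have "\<dots> \<le> (LINT x|lebesgue. indicator \<Omega> x * ?g x)"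
  proof (rule integral_mono_AE)
    show "AE x in lebesgue. (\<Sum>\<tau>\<in>\<T>. indicator \<tau> x * ?g x) \<le> indicator \<Omega> x * ?g x"
      using AE_interior_cells
    proof eventually_elim
      case (elim x)
      have "(\<Sum>\<tau>\<in>\<T>. indicator \<tau> x :: real) \<le> 1"
      proof (cases "\<exists>\<tau>\<in>\<T>. x \<in> \<tau>")
        case True
        then obtain \<tau>0 where t0: "\<tau>0 \<in> \<T>" "x \<in> \<tau>0" by blast
        have "indicator \<tau> x = (if \<tau> = \<tau>0 then 1 else 0 :: real)" if "\<tau> \<in> \<T>" for \<tau>
          using elim t0 that interior_cells_disjoint[of \<tau> \<tau>0] by (auto simp: indicator_def)
        then have "(\<Sum>\<tau>\<in>\<T>. indicator \<tau> x :: real) = (\<Sum>\<tau>\<in>\<T>. if \<tau> = \<tau>0 then 1 else 0)"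
          by (intro sum.cong) auto
        then show ?thesis using finite_\<T> t0 by simp
      next
        case False
        then have "(\<Sum>\<tau>\<in>\<T>. indicator \<tau> x :: real) = 0"
          by (intro sum.neutral) (auto simp: indicator_def)
        then show ?thesis by simp
      qed
      then have "(\<Sum>\<tau>\<in>\<T>. indicator \<tau> x) * ?g x \<le> 1 * ?g x"
        by (rule mult_right_mono) simp
      also have "1 * ?g x = indicator \<Omega> x * ?g x"
        by (simp add: indicator_def)
      finally show ?case
        by (simp only: sum_distrib_right)
    qed
  qed (use i integrable_indicator_L2[OF f sets_\<Omega>] in auto)
  also have "\<dots> = L2_sq \<Omega> f"
    by (rule L2_sq_eq_integral[OF order_refl sets_\<Omega>, symmetric])
  finally show ?thesis .
qed

lemma L2_sq_le_sum_all:
  fixes f :: "R3 \<Rightarrow> 'b::euclidean_space"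
  assumes "f \<in> L2 \<Omega>"
  shows "L2_sq \<Omega> f \<le> (\<Sum>\<tau>\<in>\<T>. L2_sq \<tau> f)"
  using assms sets_\<Omega> closure_subset by (intro L2_sq_le_sum_cells) (auto simp: Union_\<T>)

text \<open>The bound of \<open>card_patch2\<close>, a function of the shape regularity
  alone.\<close>

definition overlap :: real where
  "overlap = (4 * (4 * shape_regularity \<T>) ^ 3)\<^sup>2"

text \<open>After exchanging the sums, a cell is counted once for every patch that contains it. By
  symmetry of \<open>patch2\<close> these are no more than the cells of its own patch.\<close>

lemma sum_patches_le:
  fixes f :: "R3 \<Rightarrow> 'b::euclidean_space"
  assumes f: "f \<in> L2 \<Omega>"
  shows "(\<Sum>\<tau>\<in>\<T>. L2_sq (es \<T> 2 \<tau>) f) \<le> overlap * L2_sq \<Omega> f"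
proof -
  have "(\<Sum>\<tau>\<in>\<T>. L2_sq (es \<T> 2 \<tau>) f) \<le> (\<Sum>\<tau>\<in>\<T>. \<Sum>\<tau>'\<in>patch2 \<tau>. L2_sq \<tau>' f)"
    using es_subset[of 1] open_es[of 1] patch2_subset es2_subset_patch2
    by (intro sum_mono L2_sq_le_sum_cells f) (auto simp: numeral_2_eq_2)
  also have "\<dots> = (\<Sum>\<tau>\<in>\<T>. \<Sum>\<tau>' | \<tau>' \<in> \<T> \<and> \<tau>' \<in> patch2 \<tau>. L2_sq \<tau>' f)"
    using patch2_subset by (intro sum.cong refl) auto
  also have "\<dots> = (\<Sum>\<tau>'\<in>\<T>. \<Sum>\<tau> | \<tau> \<in> \<T> \<and> \<tau>' \<in> patch2 \<tau>. L2_sq \<tau>' f)"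
    using finite_\<T> by (rule sum.swap_restrict[OF finite_\<T>])
  also have "\<dots> \<le> (\<Sum>\<tau>'\<in>\<T>. overlap * L2_sq \<tau>' f)"
  proof (rule sum_mono)
    fix \<tau>' assume t: "\<tau>' \<in> \<T>"
    have "card {\<tau> \<in> \<T>. \<tau>' \<in> patch2 \<tau>} \<le> card (patch2 \<tau>')"
      using patch2_sym finite_subset[OF patch2_subset finite_\<T>] by (intro card_mono) auto
    then have "real (card {\<tau> \<in> \<T>. \<tau>' \<in> patch2 \<tau>}) \<le> overlap"
      using card_patch2[OF t] unfolding overlap_def by linarith
    then show "(\<Sum>\<tau> | \<tau> \<in> \<T> \<and> \<tau>' \<in> patch2 \<tau>. L2_sq \<tau>' f) \<le> overlap * L2_sq \<tau>' f"
      by (simp add: mult_right_mono)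
  qed
  also have "\<dots> = overlap * (\<Sum>\<tau>'\<in>\<T>. L2_sq \<tau>' f)"
    by (simp add: sum_distrib_left)
  also have "\<dots> \<le> overlap * L2_sq \<Omega> f"
    using sum_cells_le_L2_sq[OF f] by (rule mult_left_mono) (simp add: overlap_def)
  finally show ?thesis .
qed

end

section \<open>Lifting operators\<close>

lemma piecewise_lincomb:
  fixes u v :: "R3 \<Rightarrow> 'b::real_vector"
  assumes Q: "\<forall>q\<in>Q. \<forall>r\<in>Q. \<forall>a b. (\<lambda>x. a *\<^sub>R q x + b *\<^sub>R r x) \<in> Q"
    and "u \<in> piecewise \<T> Q" "v \<in> piecewise \<T> Q"
  shows "(\<lambda>x. a *\<^sub>R u x + b *\<^sub>R v x) \<in> piecewise \<T> Q"
  unfolding piecewise_def mem_Collect_eq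
proof
  fix \<tau> assume "\<tau> \<in> \<T>"
  then obtain q r where "q \<in> Q" "ae_eq \<tau> u q" "r \<in> Q" "ae_eq \<tau> v r"
    using assms(2,3) unfolding piecewise_def by blast
  then show "\<exists>q\<in>Q. ae_eq \<tau> (\<lambda>x. a *\<^sub>R u x + b *\<^sub>R v x) q"
    using Q by (intro bexI[of _ "\<lambda>x. a *\<^sub>R q x + b *\<^sub>R r x"] ae_eq_lincomb) simp_all
qed

lemma piecewise_diff:
  fixes u v :: "R3 \<Rightarrow> 'b::real_vector"
  assumes "\<forall>q\<in>Q. \<forall>r\<in>Q. \<forall>a b. (\<lambda>x. a *\<^sub>R q x + b *\<^sub>R r x) \<in> Q"
    and "u \<in> piecewise \<T> Q" "v \<in> piecewise \<T> Q"
  shows "(\<lambda>x. u x - v x) \<in> piecewise \<T> Q"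
  using piecewise_lincomb[OF assms, of 1 "-1"] by simp

lemma vpoly_space_lincomb:
  "q \<in> vpoly_space k \<Longrightarrow> r \<in> vpoly_space k \<Longrightarrow> (\<lambda>x. a *\<^sub>R q x + b *\<^sub>R r x) \<in> vpoly_space k"
  by (simp add: vpoly_space_def poly_space_scale_add)

lemma nedelec_space_lincomb:
  assumes "q \<in> nedelec_space p" "r \<in> nedelec_space p"
  shows "(\<lambda>x. a *\<^sub>R q x + b *\<^sub>R r x) \<in> nedelec_space p"
proof -
  obtain f g f' g' where q: "q = (\<lambda>x. f x + cross3 x (g x))" and r: "r = (\<lambda>x. f' x + cross3 x (g' x))"
    and mem: "f \<in> vpoly_space p" "g \<in> vpoly_space p" "f' \<in> vpoly_space p" "g' \<in> vpoly_space p"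
    using assms by (auto simp: nedelec_space_def)
  have "(\<lambda>x. a *\<^sub>R q x + b *\<^sub>R r x)
    = (\<lambda>x. (a *\<^sub>R f x + b *\<^sub>R f' x) + cross3 x (a *\<^sub>R g x + b *\<^sub>R g' x))"
    by (simp add: q r cross_add_right cross_mult_right scaleR_add_right algebra_simps)
  then show ?thesis
    unfolding nedelec_space_def mem_Collect_eq
    by (intro exI[where x = "\<lambda>x. a *\<^sub>R f x + b *\<^sub>R f' x"] exI[where x = "\<lambda>x. a *\<^sub>R g x + b *\<^sub>R g' x"]
        conjI vpoly_space_lincomb mem)
qed

lemma raviart_thomas_space_lincomb:
  assumes "q \<in> raviart_thomas_space p" "r \<in> raviart_thomas_space p"
  shows "(\<lambda>x. a *\<^sub>R q x + b *\<^sub>R r x) \<in> raviart_thomas_space p"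
proof -
  obtain f g f' g' where q: "q = (\<lambda>x. f x + g x *\<^sub>R x)" and r: "r = (\<lambda>x. f' x + g' x *\<^sub>R x)"
    and mem: "f \<in> vpoly_space p" "g \<in> poly_space p" "f' \<in> vpoly_space p" "g' \<in> poly_space p"
    using assms by (auto simp: raviart_thomas_space_def)
  have "(\<lambda>x. a *\<^sub>R q x + b *\<^sub>R r x)
    = (\<lambda>x. (a *\<^sub>R f x + b *\<^sub>R f' x) + (a * g x + b * g' x) *\<^sub>R x)"
    by (simp add: q r algebra_simps)
  then show ?thesis
    unfolding raviart_thomas_space_def mem_Collect_eq
    by (intro exI[where x = "\<lambda>x. a *\<^sub>R f x + b *\<^sub>R f' x"] exI[where x = "\<lambda>x. a * g x + b * g' x"]
        conjI vpoly_space_lincomb poly_space_scale_add mem)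
qed

lemma trace_norm_nonneg:
  assumes "\<And>v. v \<in> V \<Longrightarrow> 0 \<le> N v" "g \<in> tr ` V"
  shows "0 \<le> trace_norm V tr N g"
  unfolding trace_norm_def using assms by (intro cInf_greatest) auto

section \<open>Global bounds from local estimates\<close>

context mesh
begin

lemma L2_sq_mono:
  fixes f :: "R3 \<Rightarrow> 'b::euclidean_space"
  assumes f: "f \<in> L2 \<Omega>" and "S \<subseteq> S'" "S' \<subseteq> \<Omega>" "S \<in> sets lebesgue" "S' \<in> sets lebesgue"
  shows "L2_sq S f \<le> L2_sq S' f"
proof -
  have "S \<subseteq> \<Omega>" using assms by blast
  show ?thesis
    unfolding L2_sq_eq_integral[OF \<open>S \<subseteq> \<Omega>\<close> assms(4)] L2_sq_eq_integral[OF assms(3,5)]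
    using assms by (intro integral_mono integrable_indicator_L2 f mult_right_mono) (auto simp: indicator_def)
qed

text \<open>Squaring the cell estimates makes them additive over the mesh; the overlap then controls
  the sum over the patches.\<close>

lemma stable_projection_bound:
  assumes F: "stable_projection \<Omega> \<T> K D R F" and u: "u \<in> D" "u \<in> L2 \<Omega>" "F u \<in> L2 \<Omega>"
  shows "L2_sq \<Omega> (F u) \<le> K\<^sup>2 * overlap * L2_sq \<Omega> u"
proof -
  have "L2_sq \<Omega> (F u) \<le> (\<Sum>\<tau>\<in>\<T>. L2_sq \<tau> (F u))"
    by (rule L2_sq_le_sum_all[OF u(3)])
  also have "\<dots> \<le> (\<Sum>\<tau>\<in>\<T>. K\<^sup>2 * L2_sq (es \<T> 2 \<tau>) u)"
  proof (rule sum_mono)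
    fix \<tau> assume "\<tau> \<in> \<T>"
    then have "L2_norm_on \<tau> (F u) \<le> K * L2_norm_on (es \<T> 2 \<tau>) u"
      using F u(1) by (auto simp: stable_projection_def)
    then have "(L2_norm_on \<tau> (F u))\<^sup>2 \<le> (K * L2_norm_on (es \<T> 2 \<tau>) u)\<^sup>2"
      by (intro power_mono) auto
    then show "L2_sq \<tau> (F u) \<le> K\<^sup>2 * L2_sq (es \<T> 2 \<tau>) u"
      by (simp add: power_mult_distrib)
  qed
  also have "\<dots> = K\<^sup>2 * (\<Sum>\<tau>\<in>\<T>. L2_sq (es \<T> 2 \<tau>) u)"
    by (simp add: sum_distrib_left)
  also have "\<dots> \<le> K\<^sup>2 * (overlap * L2_sq \<Omega> u)"
    using sum_patches_le[OF u(2)] by (intro mult_left_mono) auto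
  finally show ?thesis by (simp add: mult.assoc)
qed

text \<open>Cells away from the boundary contribute nothing, and on the others the truncated patch
  is contained in the full one, so the same overlap bound applies. The factor 2 comes from squaring
  a sum, and each cell diameter is replaced by that of the domain.\<close>

lemma boundary_local_bound:
  fixes u :: "R3 \<Rightarrow> 'b::euclidean_space" and d :: "(R3 \<Rightarrow> 'b) \<Rightarrow> (R3 \<Rightarrow> 'c::euclidean_space)"
  assumes F: "boundary_local \<Omega> \<T> K l V d F" and u: "u \<in> V" "u \<in> L2 \<Omega>" "F u \<in> L2 \<Omega>" "d u \<in> L2 \<Omega>"
  shows "L2_sq \<Omega> (F u) \<le> 2 * K\<^sup>2 * overlap * (L2_sq \<Omega> u + (diameter \<Omega>)\<^sup>2 * L2_sq \<Omega> (d u))"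
proof -
  let ?a = "\<lambda>\<tau>. L2_sq (es \<T> 2 \<tau>) u" and ?b = "\<lambda>\<tau>. L2_sq (es \<T> 2 \<tau>) (d u)"
  have "L2_sq \<Omega> (F u) \<le> (\<Sum>\<tau>\<in>\<T>. L2_sq \<tau> (F u))"
    by (rule L2_sq_le_sum_all[OF u(3)])
  also have "\<dots> \<le> (\<Sum>\<tau>\<in>\<T>. 2 * K\<^sup>2 * (?a \<tau> + (diameter \<Omega>)\<^sup>2 * ?b \<tau>))"
  proof (rule sum_mono)
    fix \<tau> assume t: "\<tau> \<in> \<T>"
    show "L2_sq \<tau> (F u) \<le> 2 * K\<^sup>2 * (?a \<tau> + (diameter \<Omega>)\<^sup>2 * ?b \<tau>)"
    proof (cases "\<tau> \<in> boundary_cells \<Omega> \<T> l")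
      case False
      then have "ae_eq \<tau> (F u) (\<lambda>_. 0)"
        using F u(1) t by (auto simp: boundary_local_def)
      then have "L2_sq \<tau> (F u) = 0"
        unfolding L2_sq_def by (intro integral_eq_zero_AE) (auto simp: ae_eq_def elim: eventually_mono)
      then show ?thesis by simp
    next
      case True
      let ?E = "es_boundary \<Omega> \<T> 2 l \<tau>"
      let ?x = "L2_norm_on ?E u" and ?y = "L2_norm_on ?E (d u)"
      have op: "open (es \<T> 2 \<tau>)" "es \<T> 2 \<tau> \<subseteq> \<Omega>"
        using open_es[of 1 \<tau>] es_subset[of 1 \<tau>] by (simp_all add: numeral_2_eq_2)
      have E: "?E \<subseteq> es \<T> 2 \<tau>" "open ?E"
        using op(1) by (auto simp: es_boundary_def)
      have x: "?x\<^sup>2 \<le> ?a \<tau>" and y: "?y\<^sup>2 \<le> ?b \<tau>"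
        using L2_sq_mono[OF u(2) E(1) op(2)] L2_sq_mono[OF u(4) E(1) op(2)] E(2) op(1) by auto
      have "L2_norm_on \<tau> (F u) \<le> K * (?x + diameter \<tau> * ?y)"
        using F u(1) True by (auto simp: boundary_local_def)
      then have "(L2_norm_on \<tau> (F u))\<^sup>2 \<le> (K * (?x + diameter \<tau> * ?y))\<^sup>2"
        by (intro power_mono) auto
      then have "L2_sq \<tau> (F u) \<le> K\<^sup>2 * (?x + diameter \<tau> * ?y)\<^sup>2"
        by (simp add: power_mult_distrib)
      moreover have "(?x + diameter \<tau> * ?y)\<^sup>2 \<le> 2 * (?x\<^sup>2 + (diameter \<tau>)\<^sup>2 * ?y\<^sup>2)"
        using sum_squares_bound[of ?x "diameter \<tau> * ?y"] by (simp add: power2_sum power_mult_distrib)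
      moreover have "2 * (?x\<^sup>2 + (diameter \<tau>)\<^sup>2 * ?y\<^sup>2) \<le> 2 * (?a \<tau> + (diameter \<Omega>)\<^sup>2 * ?b \<tau>)"
      proof -
        have "(diameter \<tau>)\<^sup>2 \<le> (diameter \<Omega>)\<^sup>2"
          using diameter_cell_le[OF t] diameter_cell_pos[OF t] by (intro power_mono) auto
        then have "(diameter \<tau>)\<^sup>2 * ?y\<^sup>2 \<le> (diameter \<Omega>)\<^sup>2 * ?b \<tau>"
          using y by (intro mult_mono) auto
        then show ?thesis using x by simp
      qed
      ultimately have "L2_sq \<tau> (F u) \<le> K\<^sup>2 * (2 * (?a \<tau> + (diameter \<Omega>)\<^sup>2 * ?b \<tau>))"
        by (meson mult_left_mono order_trans zero_le_power2)
      then show ?thesis by (simp add: algebra_simps)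
    qed
  qed
  also have "\<dots> = 2 * K\<^sup>2 * ((\<Sum>\<tau>\<in>\<T>. ?a \<tau>) + (diameter \<Omega>)\<^sup>2 * (\<Sum>\<tau>\<in>\<T>. ?b \<tau>))"
    by (simp add: sum_distrib_left sum.distrib distrib_left)
  also have "\<dots> \<le> 2 * K\<^sup>2 * (overlap * L2_sq \<Omega> u + (diameter \<Omega>)\<^sup>2 * (overlap * L2_sq \<Omega> (d u)))"
    using sum_patches_le[OF u(2)] sum_patches_le[OF u(4)] by (intro mult_left_mono add_mono) auto
  finally show ?thesis by (simp add: algebra_simps)
qed

text \<open>Serves the boundary operator of the last level, whose estimate stays within the cell and
  so costs no overlap.\<close>

lemma cellwise_bound:
  fixes u v :: "R3 \<Rightarrow> 'b::euclidean_space"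
  assumes u: "u \<in> L2 \<Omega>" "v \<in> L2 \<Omega>" and le: "\<And>\<tau>. \<tau> \<in> \<T> \<Longrightarrow> L2_norm_on \<tau> v \<le> K * L2_norm_on \<tau> u"
  shows "L2_sq \<Omega> v \<le> K\<^sup>2 * L2_sq \<Omega> u"
proof -
  have "L2_sq \<Omega> v \<le> (\<Sum>\<tau>\<in>\<T>. L2_sq \<tau> v)"
    by (rule L2_sq_le_sum_all[OF u(2)])
  also have "\<dots> \<le> (\<Sum>\<tau>\<in>\<T>. K\<^sup>2 * L2_sq \<tau> u)"
  proof (rule sum_mono)
    fix \<tau> assume "\<tau> \<in> \<T>"
    then have "(L2_norm_on \<tau> v)\<^sup>2 \<le> (K * L2_norm_on \<tau> u)\<^sup>2"
      by (intro power_mono le) auto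
    then show "L2_sq \<tau> v \<le> K\<^sup>2 * L2_sq \<tau> u"
      by (simp add: power_mult_distrib)
  qed
  also have "\<dots> = K\<^sup>2 * (\<Sum>\<tau>\<in>\<T>. L2_sq \<tau> u)"
    by (simp add: sum_distrib_left)
  also have "\<dots> \<le> K\<^sup>2 * L2_sq \<Omega> u"
    using sum_cells_le_L2_sq[OF u(1)] by (intro mult_left_mono) auto
  finally show ?thesis .
qed

text \<open>On the interior of a cell the weak derivative agrees with the classical one
  \<open>G q\<close> by locality, and the rest of the cell is null. Applied with \<open>G\<close> as
  gradient, curl or divergence, it maps each discrete space into the next.\<close>

lemma piecewise_weak_derivative:
  fixes A :: "(R3 \<Rightarrow> 'c::euclidean_space) \<Rightarrow> (R3 \<Rightarrow> 'b::euclidean_space)"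
  assumes wd: "weak_derivative \<Omega> A s" and u: "u \<in> wd_space \<Omega> A s" "u \<in> piecewise \<T> Q"
    and smooth_Q: "\<And>q. q \<in> Q \<Longrightarrow> smooth q"
    and G: "\<And>q. q \<in> Q \<Longrightarrow> G q \<in> Q'" "\<And>q. q \<in> Q \<Longrightarrow> smooth (G q)"
    and parts: "\<And>q \<phi>. q \<in> Q \<Longrightarrow> \<phi> \<in> test_functions UNIV \<Longrightarrow>
       (LINT x|lebesgue. q x \<bullet> A \<phi> x) = s * (LINT x|lebesgue. G q x \<bullet> \<phi> x)"
  shows "wd \<Omega> A s u \<in> piecewise \<T> Q'"
  unfolding piecewise_def mem_Collect_eq
proof
  interpret weak_derivative \<Omega> A s by (rule wd)
  fix \<tau> assume t: "\<tau> \<in> \<T>"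
  then obtain q where q: "q \<in> Q" "ae_eq \<tau> u q"
    using u(2) by (auto simp: piecewise_def)
  have m: "\<tau> \<in> sets lebesgue" "interior \<tau> \<in> sets lebesgue"
    using sets_cell[OF t] by auto
  have "AE x in lebesgue. x \<in> \<tau> \<longrightarrow> u x = q x"
    using q(2) m(1) by (simp add: ae_eq_def AE_restrict_space_iff)
  then have "AE x in lebesgue. x \<in> interior \<tau> \<longrightarrow> u x = q x"
    by eventually_elim (use interior_subset in blast)
  then have "ae_eq (interior \<tau>) u q"
    using m(2) by (simp add: ae_eq_def AE_restrict_space_iff)
  then have "ae_eq (interior \<tau>) (D u) (G q)"
    using interior_cell_subset[OF t] q(1)
    by (intro D_local[OF u(1) open_interior _ _ smooth_Q G(2) parts]) auto
  then have "AE x in lebesgue. x \<in> interior \<tau> \<longrightarrow> D u x = G q x"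
    using m(2) by (simp add: ae_eq_def AE_restrict_space_iff)
  then have "AE x in lebesgue. x \<in> \<tau> \<longrightarrow> D u x = G q x"
    using AE_interior_cells by eventually_elim (use t in blast)
  then have "ae_eq \<tau> (D u) (G q)"
    using m(1) by (simp add: ae_eq_def AE_restrict_space_iff)
  then show "\<exists>q\<in>Q'. ae_eq \<tau> (D u) q"
    using G(1)[OF q(1)] by blast
qed

end

section \<open>The lifting on one level of the complex\<close>

text \<open>\<open>M\<close> stands for the overlap bound and \<open>d\<close> for the diameter of
  the domain. The first two summands control the lifted field, the last two its derivative.
  \<open>B\<close> bounds the boundary operator of the next level on derivatives:
  \<open>2 * k\<close> is what a patchwise estimate gives, \<open>K\<^sup>2\<close> what the
  cellwise one gives on the last level.\<close>

definition lifting_constant :: "real \<Rightarrow> real \<Rightarrow> real \<Rightarrow> real" where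
  "lifting_constant K M d = (let k = K\<^sup>2 * M; B = 2 * k + K\<^sup>2 in
     4 * k + (4 * k + 2) * (2 * k) * (1 + d\<^sup>2) + 4 * k * (1 + B) + 2 * B)"

text \<open>The next level is described by properties of \<open>V'\<close>, \<open>Vh'\<close>,
  \<open>Vz'\<close> and \<open>tr'\<close> alone, so that \<open>tr'\<close> may be a weak trace
  or, on the last level, the integral. \<open>Gb_bound\<close> appears in final form because it is
  reached by different estimates in these two cases.\<close>

locale lifting_step = mesh \<Omega> \<T> + weak_derivative \<Omega> A s
  for \<Omega> :: "R3 set" and \<T> :: "R3 set set"
    and A :: "(R3 \<Rightarrow> 'c::euclidean_space) \<Rightarrow> (R3 \<Rightarrow> 'b::euclidean_space)" and s :: real +
  fixes Q :: "(R3 \<Rightarrow> 'b) set" and V' Vh' Vz' :: "(R3 \<Rightarrow> 'c) set" and tr' :: "(R3 \<Rightarrow> 'c) \<Rightarrow> 'g"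
    and F0 Fb :: "(R3 \<Rightarrow> 'b) \<Rightarrow> (R3 \<Rightarrow> 'b)" and G0 Gb :: "(R3 \<Rightarrow> 'c) \<Rightarrow> (R3 \<Rightarrow> 'c)"
    and K :: real and l :: nat
  assumes Q_lincomb: "\<forall>q\<in>Q. \<forall>r\<in>Q. \<forall>a b. (\<lambda>x. a *\<^sub>R q x + b *\<^sub>R r x) \<in> Q"
    and V'_L2: "\<And>x. x \<in> V' \<Longrightarrow> x \<in> L2 \<Omega>"
    and V'_diff: "\<And>x y. x \<in> V' \<Longrightarrow> y \<in> V' \<Longrightarrow> (\<lambda>z. x z - y z) \<in> V'"
    and tr'_diff: "\<And>x y. x \<in> V' \<Longrightarrow> y \<in> V' \<Longrightarrow> tr' x = tr' y \<longleftrightarrow> (\<lambda>z. x z - y z) \<in> Vz'"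
    and Vz'_cong: "\<And>x y. x \<in> Vz' \<Longrightarrow> y \<in> V' \<Longrightarrow> ae_eq \<Omega> x y \<Longrightarrow> y \<in> Vz'"
    and Vz'_V': "\<And>x. x \<in> Vz' \<Longrightarrow> x \<in> V'"
    and Vh'_V': "\<And>x. x \<in> Vh' \<Longrightarrow> x \<in> V'"
    and Vh'_diff: "\<And>x y. x \<in> Vh' \<Longrightarrow> y \<in> Vh' \<Longrightarrow> (\<lambda>z. x z - y z) \<in> Vh'"
    and D_V': "\<And>u. u \<in> V \<Longrightarrow> D u \<in> V'"
    and D_Vz': "\<And>u. u \<in> V \<Longrightarrow> tr u = (\<lambda>_. 0) \<Longrightarrow> D u \<in> Vz'"
    and D_Vh': "\<And>u. u \<in> V \<inter> piecewise \<T> Q \<Longrightarrow> D u \<in> Vh'"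
    and F0: "stable_projection \<Omega> \<T> K {u \<in> V. tr u = (\<lambda>_. 0)}
        ((V \<inter> piecewise \<T> Q) \<inter> {u \<in> V. tr u = (\<lambda>_. 0)}) F0"
    and G0: "stable_projection \<Omega> \<T> K Vz' (Vh' \<inter> Vz') G0"
    and F0_G0: "\<And>u. u \<in> {u \<in> V. tr u = (\<lambda>_. 0)} \<Longrightarrow> ae_eq \<Omega> (D (F0 u)) (G0 (D u))"
    and Fb: "field_operator \<Omega> V (V \<inter> piecewise \<T> Q) Fb"
    and Fb_trace: "trace_preserving V (V \<inter> piecewise \<T> Q) tr Fb"
    and Fb_local: "boundary_local \<Omega> \<T> K l V D Fb"
    and Gb: "\<And>x. x \<in> V' \<Longrightarrow> Gb x \<in> Vh'"
    and Gb_trace: "trace_preserving V' Vh' tr' Gb"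
    and Fb_Gb: "\<And>u. u \<in> V \<Longrightarrow> tr' (D (Fb u)) = tr' (Gb (D u))"
    and Gb_bound: "\<And>u. u \<in> V \<Longrightarrow> L2_sq \<Omega> (Gb (D u)) \<le> (2 * (K\<^sup>2 * overlap) + K\<^sup>2) * L2_sq \<Omega> (D u)"
begin

abbreviation "Vh \<equiv> V \<inter> piecewise \<T> Q"
abbreviation "Vz \<equiv> {u \<in> V. tr u = (\<lambda>_. 0)}"
abbreviation "P \<equiv> combined_operator F0 Fb"
abbreviation "C \<equiv> lifting_constant K overlap (diameter \<Omega>)"

lemma Vh_lincomb: "u \<in> Vh \<Longrightarrow> v \<in> Vh \<Longrightarrow> (\<lambda>x. a *\<^sub>R u x + b *\<^sub>R v x) \<in> Vh"
  using V_lincomb piecewise_lincomb[OF Q_lincomb] by blast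

lemma Vh_add: "u \<in> Vh \<Longrightarrow> v \<in> Vh \<Longrightarrow> (\<lambda>x. u x + v x) \<in> Vh"
  using Vh_lincomb[of u v 1 1] by simp

lemma Vz_lincomb: "u \<in> Vz \<Longrightarrow> v \<in> Vz \<Longrightarrow> (\<lambda>x. a *\<^sub>R u x + b *\<^sub>R v x) \<in> Vz"
  using V_lincomb trace_lincomb[of u v a b] by simp

lemma Fb_Vh: "u \<in> V \<Longrightarrow> Fb u \<in> Vh"
  and Fb_cong: "u \<in> V \<Longrightarrow> v \<in> V \<Longrightarrow> ae_eq \<Omega> u v \<Longrightarrow> ae_eq \<Omega> (Fb u) (Fb v)"
  and Fb_lincomb: "u \<in> V \<Longrightarrow> v \<in> V \<Longrightarrow>
    ae_eq \<Omega> (Fb (\<lambda>x. a *\<^sub>R u x + b *\<^sub>R v x)) (\<lambda>x. a *\<^sub>R Fb u x + b *\<^sub>R Fb v x)"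
  using Fb unfolding field_operator_def ae_linear_def by blast+

lemma F0_operator: "field_operator \<Omega> Vz (Vh \<inter> Vz) F0"
  using F0 by (simp add: stable_projection_def)

lemma F0_Vh: "u \<in> Vz \<Longrightarrow> F0 u \<in> Vh" and F0_Vz: "u \<in> Vz \<Longrightarrow> F0 u \<in> Vz"
  and F0_cong: "u \<in> Vz \<Longrightarrow> v \<in> Vz \<Longrightarrow> ae_eq \<Omega> u v \<Longrightarrow> ae_eq \<Omega> (F0 u) (F0 v)"
  and F0_lincomb: "u \<in> Vz \<Longrightarrow> v \<in> Vz \<Longrightarrow>
    ae_eq \<Omega> (F0 (\<lambda>x. a *\<^sub>R u x + b *\<^sub>R v x)) (\<lambda>x. a *\<^sub>R F0 u x + b *\<^sub>R F0 v x)"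
  using F0_operator unfolding field_operator_def ae_linear_def by blast+

lemma G0_operator: "field_operator \<Omega> Vz' (Vh' \<inter> Vz') G0"
  using G0 by (simp add: stable_projection_def)

lemma G0_Vh': "x \<in> Vz' \<Longrightarrow> G0 x \<in> Vh'"
  and G0_cong: "x \<in> Vz' \<Longrightarrow> y \<in> Vz' \<Longrightarrow> ae_eq \<Omega> x y \<Longrightarrow> ae_eq \<Omega> (G0 x) (G0 y)"
  and G0_lincomb: "x \<in> Vz' \<Longrightarrow> y \<in> Vz' \<Longrightarrow>
    ae_eq \<Omega> (G0 (\<lambda>z. a *\<^sub>R x z + b *\<^sub>R y z)) (\<lambda>z. a *\<^sub>R G0 x z + b *\<^sub>R G0 y z)"
  using G0_operator unfolding field_operator_def ae_linear_def by blast+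

lemma G0_proj: "x \<in> Vh' \<Longrightarrow> x \<in> Vz' \<Longrightarrow> ae_eq \<Omega> (G0 x) x"
  using G0 by (simp add: stable_projection_def)

lemma G0_diff: "x \<in> Vz' \<Longrightarrow> y \<in> Vz' \<Longrightarrow> ae_eq \<Omega> (G0 (\<lambda>z. x z - y z)) (\<lambda>z. G0 x z - G0 y z)"
  using G0_lincomb[of x y 1 "-1"] by simp

lemma trace_Fb: "u \<in> V \<Longrightarrow> tr u \<in> tr ` Vh \<Longrightarrow> tr (Fb u) = tr u"
  using Fb_trace unfolding trace_preserving_def by blast

text \<open>Discreteness of the trace enters here: \<open>Fb\<close> reproduces only traces of
  discrete fields, and \<open>F0\<close> is controlled only on fields with zero trace.\<close>

lemma remainder_Vz:
  assumes "u \<in> V" "tr u \<in> tr ` Vh"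
  shows "(\<lambda>x. u x - Fb u x) \<in> Vz"
  using trace_Fb[OF assms] trace_eq_iff_diff[OF assms(1), of "Fb u"] V_diff[OF assms(1)] Fb_Vh[OF assms(1)] by simp

lemma P_Vh: "u \<in> V \<Longrightarrow> tr u \<in> tr ` Vh \<Longrightarrow> P u \<in> Vh"
  unfolding combined_operator_def by (intro Vh_add F0_Vh remainder_Vz Fb_Vh)

lemma trace_P:
  assumes u: "u \<in> V" "tr u \<in> tr ` Vh"
  shows "tr (P u) = tr u"
proof -
  have "(\<lambda>x. P u x - Fb u x) = F0 (\<lambda>x. u x - Fb u x)"
    by (simp add: combined_operator_def)
  then have "tr (\<lambda>x. P u x - Fb u x) = (\<lambda>_. 0)"
    using F0_Vz[OF remainder_Vz[OF u]] by simp
  then have "tr (P u) = tr (Fb u)"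
    using trace_eq_iff_diff[of "P u" "Fb u"] P_Vh[OF u] Fb_Vh[OF u(1)] by simp
  then show ?thesis using trace_Fb[OF u] by simp
qed

lemma P_cong:
  assumes "u \<in> V" "tr u \<in> tr ` Vh" "v \<in> V" "ae_eq \<Omega> u v"
  shows "ae_eq \<Omega> (P u) (P v)"
proof -
  have "tr v \<in> tr ` Vh" using assms trace_cong by metis
  then show ?thesis
    unfolding combined_operator_def using assms
    by (intro ae_eq_add F0_cong remainder_Vz ae_eq_diff Fb_cong)
qed

lemma P_lincomb:
  assumes u: "u \<in> V" "tr u \<in> tr ` Vh" and v: "v \<in> V" "tr v \<in> tr ` Vh"
  shows "ae_eq \<Omega> (P (\<lambda>x. a *\<^sub>R u x + b *\<^sub>R v x)) (\<lambda>x. a *\<^sub>R P u x + b *\<^sub>R P v x)"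
proof -
  let ?w = "\<lambda>x. a *\<^sub>R u x + b *\<^sub>R v x" and ?r = "\<lambda>u x. u x - Fb u x"
  \<comment> \<open>Discrete fields with the traces of \<open>u\<close> and \<open>v\<close>; their
    combination shows that the trace of \<open>?w\<close> is discrete as well.\<close>
  obtain x y where xy: "x \<in> Vh" "y \<in> Vh" "tr x = tr u" "tr y = tr v"
    using u(2) v(2) by (metis (no_types, lifting) imageE)
  have "tr ?w = tr (\<lambda>z. a *\<^sub>R x z + b *\<^sub>R y z)"
    using trace_lincomb[OF u(1) v(1)] trace_lincomb[of x y] xy by auto
  then have w: "?w \<in> V" "tr ?w \<in> tr ` Vh"
    using V_lincomb[OF u(1) v(1)] Vh_lincomb[OF xy(1,2)] by auto
  have b: "ae_eq \<Omega> (Fb ?w) (\<lambda>x. a *\<^sub>R Fb u x + b *\<^sub>R Fb v x)"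
    by (rule Fb_lincomb[OF u(1) v(1)])
  then have "ae_eq \<Omega> (?r ?w) (\<lambda>x. ?w x - (a *\<^sub>R Fb u x + b *\<^sub>R Fb v x))"
    by (intro ae_eq_diff ae_eq_refl)
  also have "(\<lambda>x. ?w x - (a *\<^sub>R Fb u x + b *\<^sub>R Fb v x)) = (\<lambda>x. a *\<^sub>R ?r u x + b *\<^sub>R ?r v x)"
    by (simp add: algebra_simps)
  finally have "ae_eq \<Omega> (F0 (?r ?w)) (F0 (\<lambda>x. a *\<^sub>R ?r u x + b *\<^sub>R ?r v x))"
    by (intro F0_cong remainder_Vz w Vz_lincomb u v)
  also have "ae_eq \<Omega> \<dots> (\<lambda>x. a *\<^sub>R F0 (?r u) x + b *\<^sub>R F0 (?r v) x)"
    by (intro F0_lincomb remainder_Vz u v)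
  finally have "ae_eq \<Omega> (\<lambda>x. F0 (?r ?w) x + Fb ?w x)
      (\<lambda>x. (a *\<^sub>R F0 (?r u) x + b *\<^sub>R F0 (?r v) x) + (a *\<^sub>R Fb u x + b *\<^sub>R Fb v x))"
    using b by (rule ae_eq_add)
  then show ?thesis
    by (simp add: combined_operator_def algebra_simps)
qed

text \<open>The right-hand side is \<open>combined_operator G0 Gb (D u)\<close>: on fields of
  discrete trace the combined operators commute with the derivative, although for \<open>Fb\<close>
  and \<open>Gb\<close> only the traces are known to match.\<close>

lemma D_P:
  assumes u: "u \<in> V" "tr u \<in> tr ` Vh"
  shows "(\<lambda>x. D u x - Gb (D u) x) \<in> Vz'"
    and "ae_eq \<Omega> (D (P u)) (\<lambda>x. G0 (\<lambda>z. D u z - Gb (D u) z) x + Gb (D u) x)"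
proof -
  let ?v = "Fb u" and ?r = "\<lambda>x. u x - Fb u x"
  have v: "?v \<in> Vh" "?v \<in> V" using Fb_Vh[OF u(1)] by auto
  have r: "?r \<in> Vz" by (rule remainder_Vz[OF u])
  have Du: "D u \<in> V'" and Dv: "D ?v \<in> Vh'" "D ?v \<in> V'" and Gbu: "Gb (D u) \<in> Vh'" "Gb (D u) \<in> V'"
    using u(1) v D_V' D_Vh' Gb Vh'_V' by blast+
  have ae: "ae_eq \<Omega> (D ?r) (\<lambda>x. D u x - D ?v x)"
    by (rule D_diff[OF u(1) v(2)])
  have Dr: "D ?r \<in> Vz'" using r D_Vz' by simp
  \<comment> \<open>\<open>D ?r\<close> agrees with this difference only almost everywhere, so the
    zero trace is transferred by \<open>Vz'_cong\<close>.\<close>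
  then have dz: "(\<lambda>x. D u x - D ?v x) \<in> Vz'"
    using V'_diff[OF Du Dv(2)] ae by (rule Vz'_cong)
  then have "tr' (D u) = tr' (D ?v)"
    using tr'_diff[OF Du Dv(2)] by simp
  \<comment> \<open>\<open>Gb (D u)\<close> is tied by assumption to the trace of
    \<open>D ?v\<close>, which has just been identified with the trace of
    \<open>D u\<close>.\<close>
  then have "tr' (Gb (D u)) = tr' (D u)"
    using Fb_Gb[OF u(1)] by simp
  then show gz: "(\<lambda>x. D u x - Gb (D u) x) \<in> Vz'"
    using tr'_diff[OF Du Gbu(2)] by simp
  have hz: "(\<lambda>x. D ?v x - Gb (D u) x) \<in> Vz'"
    using tr'_diff[OF Dv(2) Gbu(2)] Fb_Gb[OF u(1)] by simp
  have hp: "ae_eq \<Omega> (G0 (\<lambda>x. D ?v x - Gb (D u) x)) (\<lambda>x. D ?v x - Gb (D u) x)"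
    using Vh'_diff[OF Dv(1) Gbu(1)] hz by (rule G0_proj)
  have "ae_eq \<Omega> (D (P u)) (\<lambda>x. D (F0 ?r) x + D ?v x)"
    unfolding combined_operator_def using F0_Vz[OF r] v by (intro D_add) auto
  also have "ae_eq \<Omega> \<dots> (\<lambda>x. G0 (D ?r) x + D ?v x)"
    by (rule ae_eq_add[OF F0_G0[OF r] ae_eq_refl])
  also have "ae_eq \<Omega> \<dots> (\<lambda>x. G0 (\<lambda>x. D u x - D ?v x) x + D ?v x)"
    by (rule ae_eq_add[OF G0_cong[OF Dr dz ae] ae_eq_refl])
  \<comment> \<open>Inserting \<open>Gb (D u)\<close> splits the argument of \<open>G0\<close> into
    the desired remainder and a discrete field of zero trace; \<open>G0\<close> fixes the latter,
    and its \<open>D ?v\<close> then cancels the one outside.\<close>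
  also have "(\<lambda>x. D u x - D ?v x) = (\<lambda>x. (D u x - Gb (D u) x) - (D ?v x - Gb (D u) x))"
    by simp
  also have "ae_eq \<Omega> (\<lambda>x. G0 (\<lambda>x. (D u x - Gb (D u) x) - (D ?v x - Gb (D u) x)) x + D ?v x)
      (\<lambda>x. (G0 (\<lambda>x. D u x - Gb (D u) x) x - G0 (\<lambda>x. D ?v x - Gb (D u) x) x) + D ?v x)"
    by (rule ae_eq_add[OF G0_diff[OF gz hz] ae_eq_refl])
  also have "ae_eq \<Omega> \<dots>
      (\<lambda>x. (G0 (\<lambda>x. D u x - Gb (D u) x) x - (D ?v x - Gb (D u) x)) + D ?v x)"
    by (intro ae_eq_add ae_eq_diff ae_eq_refl hp)
  finally show "ae_eq \<Omega> (D (P u)) (\<lambda>x. G0 (\<lambda>z. D u z - Gb (D u) z) x + Gb (D u) x)"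
    by simp
qed

text \<open>In \<open>D_P\<close> all operators act on \<open>D u\<close>, so the second bound does
  not involve \<open>u\<close> itself; the diameter enters the first bound through the estimate for
  \<open>Fb\<close>.\<close>

lemma L2_P_bounds:
  assumes u: "u \<in> V" "tr u \<in> tr ` Vh"
  defines "k \<equiv> K\<^sup>2 * overlap"
  shows "L2_sq \<Omega> (P u) \<le> 4 * k * L2_sq \<Omega> u
      + (4 * k + 2) * (2 * k * (L2_sq \<Omega> u + (diameter \<Omega>)\<^sup>2 * L2_sq \<Omega> (D u)))"
    and "L2_sq \<Omega> (D (P u)) \<le> (4 * k * (1 + (2 * k + K\<^sup>2)) + 2 * (2 * k + K\<^sup>2)) * L2_sq \<Omega> (D u)"
proof -
  let ?r = "\<lambda>x. u x - Fb u x" and ?g = "\<lambda>x. D u x - Gb (D u) x"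
  have k: "0 \<le> k" by (simp add: k_def overlap_def)
  have uL: "u \<in> L2 \<Omega>" "Fb u \<in> L2 \<Omega>" "D u \<in> L2 \<Omega>" "Gb (D u) \<in> L2 \<Omega>" "?r \<in> L2 \<Omega>" "?g \<in> L2 \<Omega>"
    "F0 ?r \<in> L2 \<Omega>" "G0 ?g \<in> L2 \<Omega>" "D (P u) \<in> L2 \<Omega>"
  proof -
    show "u \<in> L2 \<Omega>" "D u \<in> L2 \<Omega>" using u V_L2 D_L2 by auto
    show "Fb u \<in> L2 \<Omega>" using Fb_Vh[OF u(1)] V_L2 by auto
    show "Gb (D u) \<in> L2 \<Omega>" using Gb[OF D_V'[OF u(1)]] Vh'_V' V'_L2 by blast
    show "?r \<in> L2 \<Omega>" "F0 ?r \<in> L2 \<Omega>" using remainder_Vz[OF u] F0_Vz[OF remainder_Vz[OF u]] V_L2 by auto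
    show "?g \<in> L2 \<Omega>" by (rule V'_L2[OF Vz'_V'[OF D_P(1)[OF u]]])
    show "G0 ?g \<in> L2 \<Omega>" by (rule V'_L2[OF Vh'_V'[OF G0_Vh'[OF D_P(1)[OF u]]]])
    show "D (P u) \<in> L2 \<Omega>" using P_Vh[OF u] D_L2 by auto
  qed
  have b: "L2_sq \<Omega> (Fb u) \<le> 2 * k * (L2_sq \<Omega> u + (diameter \<Omega>)\<^sup>2 * L2_sq \<Omega> (D u))"
    using boundary_local_bound[where F = Fb and d = D and u = u, OF Fb_local u(1) uL(1,2,3)] by (simp add: k_def mult.assoc)
  have "L2_sq \<Omega> (F0 ?r) \<le> k * L2_sq \<Omega> ?r"
    using stable_projection_bound[where F = F0 and u = ?r, OF F0 remainder_Vz[OF u] uL(5,7)] by (simp add: k_def)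
  also have "\<dots> \<le> k * (2 * L2_sq \<Omega> u + 2 * L2_sq \<Omega> (Fb u))"
    using L2_sq_diff_le[OF uL(1,2)] k by (rule mult_left_mono)
  finally have f: "L2_sq \<Omega> (F0 ?r) \<le> k * (2 * L2_sq \<Omega> u + 2 * L2_sq \<Omega> (Fb u))" .
  have "L2_sq \<Omega> (P u) \<le> 2 * L2_sq \<Omega> (F0 ?r) + 2 * L2_sq \<Omega> (Fb u)"
    unfolding combined_operator_def by (rule L2_sq_add_le[OF uL(7,2)])
  also have "\<dots> \<le> 4 * k * L2_sq \<Omega> u + (4 * k + 2) * L2_sq \<Omega> (Fb u)"
    using f by (simp add: algebra_simps)
  also have "\<dots> \<le> 4 * k * L2_sq \<Omega> u
      + (4 * k + 2) * (2 * k * (L2_sq \<Omega> u + (diameter \<Omega>)\<^sup>2 * L2_sq \<Omega> (D u)))"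
    using b k by (intro add_left_mono mult_left_mono) auto
  finally show "L2_sq \<Omega> (P u) \<le> 4 * k * L2_sq \<Omega> u
      + (4 * k + 2) * (2 * k * (L2_sq \<Omega> u + (diameter \<Omega>)\<^sup>2 * L2_sq \<Omega> (D u)))" .
  define B where "B = 2 * k + K\<^sup>2"
  have gb: "L2_sq \<Omega> (Gb (D u)) \<le> B * L2_sq \<Omega> (D u)"
    using Gb_bound[OF u(1)] by (simp add: B_def k_def)
  have "L2_sq \<Omega> (G0 ?g) \<le> k * L2_sq \<Omega> ?g"
    using stable_projection_bound[where F = G0 and u = ?g, OF G0 D_P(1)[OF u] uL(6,8)] by (simp add: k_def)
  also have "\<dots> \<le> k * (2 * L2_sq \<Omega> (D u) + 2 * L2_sq \<Omega> (Gb (D u)))"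
    using L2_sq_diff_le[OF uL(3,4)] k by (rule mult_left_mono)
  also have "\<dots> \<le> k * (2 * L2_sq \<Omega> (D u) + 2 * (B * L2_sq \<Omega> (D u)))"
    using gb k by (intro mult_left_mono) auto
  finally have g: "L2_sq \<Omega> (G0 ?g) \<le> k * (2 * L2_sq \<Omega> (D u) + 2 * (B * L2_sq \<Omega> (D u)))" .
  have "L2_sq \<Omega> (D (P u)) = L2_sq \<Omega> (\<lambda>x. G0 ?g x + Gb (D u) x)"
    by (rule L2_sq_cong[OF uL(9) L2_add[OF uL(8,4)] D_P(2)[OF u]])
  also have "\<dots> \<le> 2 * L2_sq \<Omega> (G0 ?g) + 2 * L2_sq \<Omega> (Gb (D u))"
    by (rule L2_sq_add_le[OF uL(8,4)])
  also have "\<dots> \<le> (4 * k * (1 + B) + 2 * B) * L2_sq \<Omega> (D u)"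
    using g gb by (simp add: algebra_simps)
  finally show "L2_sq \<Omega> (D (P u)) \<le> (4 * k * (1 + (2 * k + K\<^sup>2)) + 2 * (2 * k + K\<^sup>2)) * L2_sq \<Omega> (D u)"
    by (simp add: B_def)
qed

lemma graph_norm_P:
  assumes u: "u \<in> V" "tr u \<in> tr ` Vh"
  shows "graph_norm \<Omega> D (P u) \<le> sqrt C * graph_norm \<Omega> D u"
proof -
  let ?k = "K\<^sup>2 * overlap" and ?d = "(diameter \<Omega>)\<^sup>2" and ?U = "L2_sq \<Omega> u" and ?W = "L2_sq \<Omega> (D u)"
  have k: "0 \<le> ?k" by (simp add: overlap_def)
  define X Y where "X = (4 * ?k + 2) * (2 * ?k)" and "Y = 4 * ?k * (1 + (2 * ?k + K\<^sup>2)) + 2 * (2 * ?k + K\<^sup>2)"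
  have X: "0 \<le> X" and Y: "0 \<le> Y" using k by (auto simp: X_def Y_def intro!: add_nonneg_nonneg mult_nonneg_nonneg)
  have C: "C = 4 * ?k + X * (1 + ?d) + Y"
    by (simp add: lifting_constant_def Let_def X_def Y_def)
  have "L2_sq \<Omega> (P u) + L2_sq \<Omega> (D (P u)) \<le> 4 * ?k * ?U + X * (?U + ?d * ?W) + Y * ?W"
    using L2_P_bounds[OF u] by (simp add: X_def Y_def mult.assoc)
  also have "\<dots> \<le> C * (?U + ?W)"
  proof -
    \<comment> \<open>These are exactly the terms by which \<open>C * (?U + ?W)\<close> exceeds the
      sum to be bounded.\<close>
    have "0 \<le> 4 * ?k * ?W + X * ?W + X * ?d * ?U + Y * ?U"
      using k X Y by (intro add_nonneg_nonneg mult_nonneg_nonneg[of "4 * ?k"] mult_nonneg_nonneg[of X]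
          mult_nonneg_nonneg[of Y] mult_nonneg_nonneg[of "X * ?d"]) auto
    then show ?thesis by (simp add: C algebra_simps)
  qed
  finally have "sqrt (L2_sq \<Omega> (P u) + L2_sq \<Omega> (D (P u))) \<le> sqrt (C * (?U + ?W))"
    by (rule real_sqrt_le_mono)
  then show ?thesis
    by (simp add: graph_norm_def real_sqrt_mult)
qed

lemma stable_lifting_step:
  assumes E: "stable_extension \<Omega> K\<^sub>E V tr (graph_norm \<Omega> D) E"
  shows "stable_lifting \<Omega> (sqrt C * \<bar>K\<^sub>E\<bar>) V Vh tr (graph_norm \<Omega> D) (lifting F0 Fb E)"
proof -
  have EV: "E g \<in> V" "tr (E g) = g" "graph_norm \<Omega> D (E g) \<le> K\<^sub>E * trace_norm V tr (graph_norm \<Omega> D) g"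
    if "g \<in> tr ` V" for g
    using E that by (auto simp: stable_extension_def)
  have Elin: "ae_linear \<Omega> (tr ` V) E" using E by (simp add: stable_extension_def)
  have sub: "g \<in> tr ` V" if "g \<in> tr ` Vh" for g using that by auto
  have C0: "0 \<le> C" by (simp add: lifting_constant_def Let_def overlap_def)
  have "ae_linear \<Omega> (tr ` Vh) (lifting F0 Fb E)"
    unfolding ae_linear_def lifting_def comp_def
  proof (intro ballI allI)
    fix g g' and a b :: real
    assume g: "g \<in> tr ` Vh" and g': "g' \<in> tr ` Vh"
    let ?h = "\<lambda>\<phi>. a *\<^sub>R g \<phi> + b *\<^sub>R g' \<phi>"
    obtain x y where xy: "x \<in> Vh" "y \<in> Vh" "g = tr x" "g' = tr y" using g g' by blast
    have "?h = tr (\<lambda>z. a *\<^sub>R x z + b *\<^sub>R y z)"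
      using trace_lincomb[of x y a b] xy by simp
    then have h: "?h \<in> tr ` Vh" using Vh_lincomb[OF xy(1,2)] by blast
    have "ae_eq \<Omega> (E ?h) (\<lambda>x. a *\<^sub>R E g x + b *\<^sub>R E g' x)"
      using Elin sub[OF g] sub[OF g'] unfolding ae_linear_def by blast
    \<comment> \<open>\<open>E\<close> is linear only almost everywhere, so \<open>P\<close> has to
      respect null sets before its own linearity can be used.\<close>
    then have "ae_eq \<Omega> (P (E ?h)) (P (\<lambda>x. a *\<^sub>R E g x + b *\<^sub>R E g' x))"
      using EV[OF sub[OF h]] h EV(1)[OF sub[OF g]] EV(1)[OF sub[OF g']] by (intro P_cong V_lincomb) auto
    also have "ae_eq \<Omega> \<dots> (\<lambda>x. a *\<^sub>R P (E g) x + b *\<^sub>R P (E g') x)"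
      using EV[OF sub[OF g]] EV[OF sub[OF g']] g g' by (intro P_lincomb) auto
    finally show "ae_eq \<Omega> (P (E ?h)) (\<lambda>x. a *\<^sub>R P (E g) x + b *\<^sub>R P (E g') x)" .
  qed
  moreover have "lifting F0 Fb E g \<in> Vh \<and> tr (lifting F0 Fb E g) = g \<and>
     graph_norm \<Omega> D (lifting F0 Fb E g) \<le> sqrt C * \<bar>K\<^sub>E\<bar> * trace_norm V tr (graph_norm \<Omega> D) g"
    if g: "g \<in> tr ` Vh" for g
  proof -
    note e = EV[OF sub[OF g]]
    have t: "tr (E g) \<in> tr ` Vh" using e(2) g by simp
    have n: "0 \<le> trace_norm V tr (graph_norm \<Omega> D) g"
      using sub[OF g] by (intro trace_norm_nonneg) (auto simp: graph_norm_def)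
    have "graph_norm \<Omega> D (P (E g)) \<le> sqrt C * graph_norm \<Omega> D (E g)"
      by (rule graph_norm_P[OF e(1) t])
    also have "\<dots> \<le> sqrt C * (\<bar>K\<^sub>E\<bar> * trace_norm V tr (graph_norm \<Omega> D) g)"
      using C0 order_trans[OF e(3) mult_right_mono[OF abs_ge_self n]] by (intro mult_left_mono) auto
    finally show ?thesis
      using P_Vh[OF e(1) t] trace_P[OF e(1) t] e(2) by (simp add: lifting_def mult.assoc)
  qed
  ultimately show ?thesis
    by (simp add: stable_lifting_def)
qed

end

section \<open>The three levels\<close>

context mesh
begin

text \<open>Serves the levels whose successor is again a weak derivative; the assumptions of
  \<open>lifting_step\<close> on zero traces then follow from the complex property.\<close>

lemma lifting_step_complex:
  fixes A :: "(R3 \<Rightarrow> 'c::euclidean_space) \<Rightarrow> (R3 \<Rightarrow> 'b::euclidean_space)"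
    and A' :: "(R3 \<Rightarrow> 'd::euclidean_space) \<Rightarrow> (R3 \<Rightarrow> 'c)"
  assumes complex: "weak_complex \<Omega> A s A' s'"
    and Q: "\<forall>q\<in>Q. \<forall>r\<in>Q. \<forall>a b. (\<lambda>x. a *\<^sub>R q x + b *\<^sub>R r x) \<in> Q"
    and Q': "\<forall>q\<in>Q'. \<forall>r\<in>Q'. \<forall>a b. (\<lambda>x. a *\<^sub>R q x + b *\<^sub>R r x) \<in> Q'"
    and smooth_Q: "\<And>q. q \<in> Q \<Longrightarrow> smooth q"
    and G: "\<And>q. q \<in> Q \<Longrightarrow> G q \<in> Q'" "\<And>q. q \<in> Q \<Longrightarrow> smooth (G q)"
    and parts: "\<And>q \<phi>. q \<in> Q \<Longrightarrow> \<phi> \<in> test_functions UNIV \<Longrightarrow>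
       (LINT x|lebesgue. q x \<bullet> A \<phi> x) = s * (LINT x|lebesgue. G q x \<bullet> \<phi> x)"
  defines "V \<equiv> wd_space \<Omega> A s" and "V' \<equiv> wd_space \<Omega> A' s'"
    and "D \<equiv> wd \<Omega> A s" and "tr \<equiv> wd_trace \<Omega> A s" and "tr' \<equiv> wd_trace \<Omega> A' s'"
  assumes F0: "stable_projection \<Omega> \<T> K {u \<in> V. tr u = (\<lambda>_. 0)}
        ((V \<inter> piecewise \<T> Q) \<inter> {u \<in> V. tr u = (\<lambda>_. 0)}) F0"
    and G0: "stable_projection \<Omega> \<T> K {u \<in> V'. tr' u = (\<lambda>_. 0)}
        ((V' \<inter> piecewise \<T> Q') \<inter> {u \<in> V'. tr' u = (\<lambda>_. 0)}) G0"
    and F0_G0: "\<forall>u\<in>{u \<in> V. tr u = (\<lambda>_. 0)}. ae_eq \<Omega> (D (F0 u)) (G0 (D u))"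
    and Fb: "field_operator \<Omega> V (V \<inter> piecewise \<T> Q) Fb"
    and Gb: "field_operator \<Omega> V' (V' \<inter> piecewise \<T> Q') Gb"
    and Fb_trace: "trace_preserving V (V \<inter> piecewise \<T> Q) tr Fb"
    and Gb_trace: "trace_preserving V' (V' \<inter> piecewise \<T> Q') tr' Gb"
    and Fb_Gb: "\<forall>u\<in>V. tr' (D (Fb u)) = tr' (Gb (D u))"
    and Fb_local: "boundary_local \<Omega> \<T> K l V D Fb"
    and Gb_local: "boundary_local \<Omega> \<T> K l' V' (wd \<Omega> A' s') Gb"
  shows "lifting_step \<Omega> \<T> A s Q V' (V' \<inter> piecewise \<T> Q') {u \<in> V'. tr' u = (\<lambda>_. 0)} tr' F0 Fb G0 Gb K l"
proof -
  interpret weak_complex \<Omega> A s A' s' by (rule complex)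
  note pw_diff = piecewise_diff[OF Q', where \<T> = \<T>]
  have GbL: "Gb x \<in> L2 \<Omega>" if "x \<in> V'" for x
    using Gb that snd.V_L2 unfolding field_operator_def V'_def by blast
  show ?thesis
  proof (unfold_locales, goal_cases)
    case 1 show ?case by (rule Q)
  next
    case (2 x) then show ?case using snd.V_L2 by (simp add: V'_def)
  next
    case (3 x y) then show ?case using snd.V_diff by (simp add: V'_def)
  next
    case (4 x y) then show ?case
      using snd.trace_eq_iff_diff[of x y] snd.V_diff[of x y] by (simp add: V'_def tr'_def)
  next
    case (5 x y) then show ?case
      using snd.trace_cong[of x y] by (simp add: V'_def tr'_def)
  next
    case (6 x) then show ?case by simp
  next
    case (7 x) then show ?case by simp
  next
    case (8 x y) then show ?case
      using snd.V_diff[of x y] pw_diff[of x y] by (simp add: V'_def)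
  next
    case (9 u) then show ?case using D_in_V by (simp add: V'_def)
  next
    case (10 u) then show ?case using D_in_V trace_D_zero by (simp add: V'_def tr'_def)
  next
    case (11 u)
    then show ?case
      using D_in_V[of u] piecewise_weak_derivative[where G = G and Q = Q and Q' = Q' and u = u, OF fst.weak_derivative_axioms _ _ smooth_Q G parts]
      by (simp add: V'_def)
  next
    case 12 show ?case using F0 by (simp add: V_def tr_def)
  next
    case 13 show ?case by (rule G0)
  next
    case (14 u) then show ?case using F0_G0 by (simp add: V_def D_def tr_def)
  next
    case 15 show ?case using Fb by (simp add: V_def)
  next
    case 16 show ?case using Fb_trace by (simp add: V_def tr_def)
  next
    case 17 show ?case using Fb_local by (simp add: V_def D_def)
  next
    case (18 x) then show ?case using Gb by (simp add: field_operator_def)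
  next
    case 19 show ?case by (rule Gb_trace)
  next
    case (20 u) then show ?case using Fb_Gb by (simp add: V_def D_def)
  next
    case (21 u)
    have u: "fst.D u \<in> V'" using D_in_V[OF 21] by (simp add: V'_def)
    then have L: "fst.D u \<in> L2 \<Omega>" "snd.D (fst.D u) \<in> L2 \<Omega>"
      using snd.V_L2 snd.D_L2 by (auto simp: V'_def)
    \<comment> \<open>Consecutive derivatives compose to zero, so the term weighted with the
      diameter drops out of the estimate for \<open>Gb\<close>.\<close>
    have "L2_sq \<Omega> (snd.D (fst.D u)) = 0"
      using L2_sq_cong[OF L(2) L2_zero D_D_zero[OF 21]] by (simp add: L2_sq_def)
    then have "L2_sq \<Omega> (Gb (fst.D u)) \<le> 2 * K\<^sup>2 * overlap * L2_sq \<Omega> (fst.D u)"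
      using boundary_local_bound[where F = Gb and d = "wd \<Omega> A' s'" and u = "fst.D u",
          OF Gb_local u L(1) GbL[OF u] L(2)] by simp
    also have "\<dots> \<le> (2 * (K\<^sup>2 * overlap) + K\<^sup>2) * L2_sq \<Omega> (fst.D u)"
      by (intro mult_right_mono) auto
    finally show ?case .
  qed
qed

lemma lifting_step_0:
  assumes "admissible_pair \<Omega> \<T> p K P\<^sub>0 P\<^sub>b"
  shows "lifting_step \<Omega> \<T> cl_div (- 1) (poly_space (p + 1)) (wd_space \<Omega> cl_curl 1)
    (wd_space \<Omega> cl_curl 1 \<inter> piecewise \<T> (nedelec_space p))
    {u \<in> wd_space \<Omega> cl_curl 1. wd_trace \<Omega> cl_curl 1 u = (\<lambda>_. 0)} (wd_trace \<Omega> cl_curl 1)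
    (op0 P\<^sub>0) (op0 P\<^sub>b) (op1 P\<^sub>0) (op1 P\<^sub>b) K 0"
proof (rule lifting_step_complex[where G = cl_grad and l' = 1])
  show "weak_complex \<Omega> cl_div (- 1) cl_curl 1"
    using open_\<Omega> bounded_\<Omega> by (rule grad_curl_complex)
qed (use assms in \<open>simp_all add: admissible_pair_def interior_operators_def boundary_operators_def
    V0_zero_def V1_zero_def V0_h_def V1_h_def wd_grad_eqs wd_curl_eqs poly_space_scale_add
    nedelec_space_lincomb smooth_poly_space smooth_cl_grad cl_grad_poly_space[unfolded Suc_eq_plus1] cl_grad_by_parts[simplified]
    del: One_nat_def Suc_eq_plus1 add_Suc_right add_0_right\<close>)

lemma lifting_step_1:
  assumes "admissible_pair \<Omega> \<T> p K P\<^sub>0 P\<^sub>b"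
  shows "lifting_step \<Omega> \<T> cl_curl 1 (nedelec_space p) (wd_space \<Omega> cl_grad (- 1))
    (wd_space \<Omega> cl_grad (- 1) \<inter> piecewise \<T> (raviart_thomas_space p))
    {u \<in> wd_space \<Omega> cl_grad (- 1). wd_trace \<Omega> cl_grad (- 1) u = (\<lambda>_. 0)} (wd_trace \<Omega> cl_grad (- 1))
    (op1 P\<^sub>0) (op1 P\<^sub>b) (op2 P\<^sub>0) (op2 P\<^sub>b) K 1"
proof (rule lifting_step_complex[where G = cl_curl and l' = 2])
  show "weak_complex \<Omega> cl_curl 1 cl_grad (- 1)"
    using open_\<Omega> bounded_\<Omega> by (rule curl_div_complex)
qed (use assms in \<open>simp_all add: admissible_pair_def interior_operators_def boundary_operators_def
    V1_zero_def V2_zero_def V1_h_def V2_h_def wd_curl_eqs wd_div_eqs raviart_thomas_space_lincomb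
    nedelec_space_lincomb smooth_nedelec_space smooth_cl_curl cl_curl_nedelec_space
    cl_curl_by_parts[simplified]
    del: One_nat_def\<close>)

text \<open>The successor is all of \<open>L2 \<Omega>\<close> and its trace is the integral, so
  vanishing mean takes the place of a boundary condition.\<close>

lemma lifting_step_2:
  assumes "admissible_pair \<Omega> \<T> p K P\<^sub>0 P\<^sub>b"
  shows "lifting_step \<Omega> \<T> cl_grad (- 1) (raviart_thomas_space p) (V3 \<Omega>) (V3_h \<Omega> \<T> p) (V3_zero \<Omega>) (tr3 \<Omega>)
    (op2 P\<^sub>0) (op2 P\<^sub>b) (op3 P\<^sub>0) (op3 P\<^sub>b) K 2"
proof -
  interpret weak_derivative \<Omega> cl_grad "- 1"
    using open_\<Omega> bounded_\<Omega> by (rule weak_div)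
  have Om: "\<Omega> \<in> lmeasurable"
    using open_\<Omega> bounded_\<Omega> by (simp add: lmeasurable_open)
  have int: "integrable (lebesgue_on \<Omega>) x" if "x \<in> V3 \<Omega>" for x
    using that Om by (auto simp: V3_def intro: L2_imp_integrable)
  have diff: "(\<lambda>z. x z - y z) \<in> V3 \<Omega>" if "x \<in> V3 \<Omega>" "y \<in> V3 \<Omega>" for x y
    using that by (simp add: V3_def L2_diff)
  have pw_diff: "(\<lambda>z. x z - y z) \<in> piecewise \<T> (poly_space p)"
    if "x \<in> piecewise \<T> (poly_space p)" "y \<in> piecewise \<T> (poly_space p)" for x y
    using that by (intro piecewise_diff) (simp_all add: poly_space_scale_add)
  note adm = assms[unfolded admissible_pair_def interior_operators_def boundary_operators_def
      V2_zero_def V2_h_def wd_div_eqs]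
  show ?thesis
  proof (unfold_locales, goal_cases)
    case 1 show ?case by (simp add: raviart_thomas_space_lincomb)
  next
    case (2 x) then show ?case by (simp add: V3_def)
  next
    case (3 x y) then show ?case by (rule diff)
  next
    case (4 x y) then show ?case
      using int[of x] int[of y] diff by (simp add: V3_zero_def tr3_def)
  next
    case (5 x y)
    then have "tr3 \<Omega> x = tr3 \<Omega> y"
      unfolding tr3_def ae_eq_def using int[of x] int[of y]
      by (intro integral_cong_AE) (auto simp: V3_zero_def)
    with 5 show ?case by (simp add: V3_zero_def)
  next
    case (6 x) then show ?case by (simp add: V3_zero_def)
  next
    case (7 x) then show ?case by (simp add: V3_h_def)
  next
    case (8 x y) then show ?case using diff pw_diff by (simp add: V3_h_def)
  next
    case (9 u) then show ?case using D_L2 by (simp add: V3_def)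
  next
    case (10 u)
    \<comment> \<open>Testing the normal trace with the constant 1 is the divergence theorem: a
      field with zero normal trace has a divergence of mean zero.\<close>
    have one: "smooth (\<lambda>_. 1 :: real)" by (rule smooth_const)
    have "cl_grad (\<lambda>_. 1) = (\<lambda>_. 0)"
      by (simp add: cl_grad_def fun_eq_iff vec_eq_iff)
    moreover have "tr u (\<lambda>_. 1) = 0" using 10 by simp
    ultimately have "(LINT x|lebesgue_on \<Omega>. D u x) = 0"
      using trace_eq[OF 10(1) one] by simp
    then show ?case using D_L2[OF 10(1)] by (simp add: V3_zero_def V3_def tr3_def)
  next
    case (11 u)
    then have "D u \<in> piecewise \<T> (poly_space p)"
      by (intro piecewise_weak_derivative[where G = cl_div and Q = "raviart_thomas_space p"] weak_derivative_axioms
          cl_div_by_parts cl_div_raviart_thomas_space smooth_raviart_thomas_space smooth_cl_div) auto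
    then show ?case using 11 D_L2 by (simp add: V3_h_def V3_def)
  next
    case (18 x) then show ?case using adm by (simp add: field_operator_def)
  next
    case (21 u)
    have x: "D u \<in> V3 \<Omega>" using D_L2[OF 21] by (simp add: V3_def)
    then have "op3 P\<^sub>b (D u) \<in> V3_h \<Omega> \<T> p" using adm by (simp add: field_operator_def)
    then have "op3 P\<^sub>b (D u) \<in> L2 \<Omega>" by (simp add: V3_h_def V3_def)
    then have "L2_sq \<Omega> (op3 P\<^sub>b (D u)) \<le> K\<^sup>2 * L2_sq \<Omega> (D u)"
      using D_L2[OF 21] adm x by (intro cellwise_bound) auto
    \<comment> \<open>The cellwise estimate gives only the last summand; the first is added to reach
      the constant shared by all levels.\<close>
    also have "\<dots> \<le> (2 * (K\<^sup>2 * overlap) + K\<^sup>2) * L2_sq \<Omega> (D u)"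
      by (intro mult_right_mono) (auto simp: overlap_def)
    finally show ?case .
  qed (use adm in auto)
qed

end

text \<open>The hidden constants are functions \<open>K\<close> and \<open>K\<^sub>E\<close> of
  shape regularity and degree, fixed before the mesh and the operators. \<open>C\<close> is built
  from them and from the diameter of the domain.\<close>

theorem lemma4p4:
  fixes \<Omega> :: "R3 set" and K K\<^sub>E :: "real \<Rightarrow> nat \<Rightarrow> real"
  assumes "lipschitz_polyhedral_domain \<Omega>"
  shows "\<exists>C :: real \<Rightarrow> nat \<Rightarrow> real. \<forall>\<T> p P\<^sub>0 P\<^sub>b E0 E1 E2.
    simplicial_mesh \<Omega> \<T> \<longrightarrow>
    admissible_pair \<Omega> \<T> p (K (shape_regularity \<T>) p) P\<^sub>0 P\<^sub>b \<longrightarrow>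
    stable_extension \<Omega> (K\<^sub>E (shape_regularity \<T>) p) (V0 \<Omega>) (tr0 \<Omega>) (graph_norm \<Omega> (d0 \<Omega>)) E0 \<longrightarrow>
    stable_extension \<Omega> (K\<^sub>E (shape_regularity \<T>) p) (V1 \<Omega>) (tr1 \<Omega>) (graph_norm \<Omega> (d1 \<Omega>)) E1 \<longrightarrow>
    stable_extension \<Omega> (K\<^sub>E (shape_regularity \<T>) p) (V2 \<Omega>) (tr2 \<Omega>) (graph_norm \<Omega> (d2 \<Omega>)) E2 \<longrightarrow>
    stable_lifting \<Omega> (C (shape_regularity \<T>) p) (V0 \<Omega>) (V0_h \<Omega> \<T> p) (tr0 \<Omega>)
      (graph_norm \<Omega> (d0 \<Omega>)) (lifting (op0 P\<^sub>0) (op0 P\<^sub>b) E0) \<and>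
    stable_lifting \<Omega> (C (shape_regularity \<T>) p) (V1 \<Omega>) (V1_h \<Omega> \<T> p) (tr1 \<Omega>)
      (graph_norm \<Omega> (d1 \<Omega>)) (lifting (op1 P\<^sub>0) (op1 P\<^sub>b) E1) \<and>
    stable_lifting \<Omega> (C (shape_regularity \<T>) p) (V2 \<Omega>) (V2_h \<Omega> \<T> p) (tr2 \<Omega>)
      (graph_norm \<Omega> (d2 \<Omega>)) (lifting (op2 P\<^sub>0) (op2 P\<^sub>b) E2)"
proof (intro exI allI impI)
  fix \<T> p P\<^sub>0 P\<^sub>b E0 E1 E2
  let ?K = "K (shape_regularity \<T>) p" and ?KE = "K\<^sub>E (shape_regularity \<T>) p"
  \<comment> \<open>The overlap bound is spelled out as a function of \<open>\<rho>\<close>, since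
    the constant has to be chosen independently of the mesh.\<close>
  let ?C = "\<lambda>\<rho> p. sqrt (lifting_constant (K \<rho> p) ((4 * (4 * \<rho>) ^ 3)\<^sup>2) (diameter \<Omega>)) * \<bar>K\<^sub>E \<rho> p\<bar>"
  assume mesh: "simplicial_mesh \<Omega> \<T>" and adm: "admissible_pair \<Omega> \<T> p ?K P\<^sub>0 P\<^sub>b"
    and E: "stable_extension \<Omega> ?KE (V0 \<Omega>) (tr0 \<Omega>) (graph_norm \<Omega> (d0 \<Omega>)) E0"
      "stable_extension \<Omega> ?KE (V1 \<Omega>) (tr1 \<Omega>) (graph_norm \<Omega> (d1 \<Omega>)) E1"
      "stable_extension \<Omega> ?KE (V2 \<Omega>) (tr2 \<Omega>) (graph_norm \<Omega> (d2 \<Omega>)) E2"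
  interpret mesh \<Omega> \<T>
    using assms mesh by unfold_locales
  show "stable_lifting \<Omega> (?C (shape_regularity \<T>) p) (V0 \<Omega>) (V0_h \<Omega> \<T> p) (tr0 \<Omega>)
      (graph_norm \<Omega> (d0 \<Omega>)) (lifting (op0 P\<^sub>0) (op0 P\<^sub>b) E0) \<and>
    stable_lifting \<Omega> (?C (shape_regularity \<T>) p) (V1 \<Omega>) (V1_h \<Omega> \<T> p) (tr1 \<Omega>)
      (graph_norm \<Omega> (d1 \<Omega>)) (lifting (op1 P\<^sub>0) (op1 P\<^sub>b) E1) \<and>
    stable_lifting \<Omega> (?C (shape_regularity \<T>) p) (V2 \<Omega>) (V2_h \<Omega> \<T> p) (tr2 \<Omega>)
      (graph_norm \<Omega> (d2 \<Omega>)) (lifting (op2 P\<^sub>0) (op2 P\<^sub>b) E2)"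
    using lifting_step.stable_lifting_step[OF lifting_step_0[OF adm] E(1)[unfolded wd_grad_eqs]]
      lifting_step.stable_lifting_step[OF lifting_step_1[OF adm] E(2)[unfolded wd_curl_eqs]]
      lifting_step.stable_lifting_step[OF lifting_step_2[OF adm] E(3)[unfolded wd_div_eqs]]
    unfolding V0_h_def V1_h_def V2_h_def wd_grad_eqs wd_curl_eqs wd_div_eqs overlap_def
    by (intro conjI)
qed

end
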